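(* Let $V>0$. Then there exists a bounded convex domain $\Omega\subset\mathbb{R}^3$ of volume $V$, axially symmetric with respect to some line, such that $\mu_1(\Omega)\le\mu_1(\Omega')$ for every bounded convex axially symmetric domain $\Omega'$ of volume $V$.
   Context: For a bounded Lipschitz (e.g. convex) domain $\Omega$, $\mathcal{K}(\Omega)=\{v\in L^2(\Omega):\int_\Omega v\cdot w\,dx=0$ for all $w\in L^2(\Omega)$ with $\operatorname{curl}w=0\}$; curl with domain $\{v\in\mathcal{K}(\Omega):\operatorname{curl}v\in\mathcal{K}(\Omega)\}$ is a self-adjoint operator on $\mathcal{K}(\Omega)$ with compact inverse, and $\mu_1(\Omega)$ denotes its smallest positive eigenvalue. A domain is axially symmetric if it is invariant under all rotations about some fixed line. *)

theory Defs
  imports "HOL-Analysis.Analysis"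
begin

type_synonym vec3 = "real ^ 3"

definition L2 :: "vec3 set \<Rightarrow> (vec3 \<Rightarrow> vec3) set" where
  "L2 \<Omega> = {v. v \<in> borel_measurable (lebesgue_on \<Omega>) \<and>
                 integrable (lebesgue_on \<Omega>) (\<lambda>x. (norm (v x))\<^sup>2)}"

definition L2_inner :: "vec3 set \<Rightarrow> (vec3 \<Rightarrow> vec3) \<Rightarrow> (vec3 \<Rightarrow> vec3) \<Rightarrow> real" where
  "L2_inner \<Omega> v w = integral\<^sup>L (lebesgue_on \<Omega>) (\<lambda>x. v x \<bullet> w x)"

definition pd :: "(vec3 \<Rightarrow> vec3) \<Rightarrow> 3 \<Rightarrow> 3 \<Rightarrow> vec3 \<Rightarrow> real" where
  "pd \<phi> i j x = (frechet_derivative \<phi> (at x) (axis j 1)) $ i"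

definition curl :: "(vec3 \<Rightarrow> vec3) \<Rightarrow> vec3 \<Rightarrow> vec3" where
  "curl \<phi> x = vector [pd \<phi> 3 2 x - pd \<phi> 2 3 x,
                       pd \<phi> 1 3 x - pd \<phi> 3 1 x,
                       pd \<phi> 2 1 x - pd \<phi> 1 2 x]"

definition test_field :: "vec3 set \<Rightarrow> (vec3 \<Rightarrow> vec3) \<Rightarrow> bool" where
  "test_field \<Omega> \<phi> \<longleftrightarrow>
     (\<forall>x. \<phi> differentiable (at x)) \<and>
     (\<forall>j. continuous_on UNIV (\<lambda>x. frechet_derivative \<phi> (at x) (axis j 1))) \<and>
     compact (closure {x. \<phi> x \<noteq> 0}) \<and> closure {x. \<phi> x \<noteq> 0} \<subseteq> \<Omega>"

definition weak_curl :: "vec3 set \<Rightarrow> (vec3 \<Rightarrow> vec3) \<Rightarrow> (vec3 \<Rightarrow> vec3) \<Rightarrow> bool" where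
  "weak_curl \<Omega> v u \<longleftrightarrow>
     (\<forall>\<phi>. test_field \<Omega> \<phi> \<longrightarrow> L2_inner \<Omega> v (curl \<phi>) = L2_inner \<Omega> u \<phi>)"

definition Kspace :: "vec3 set \<Rightarrow> (vec3 \<Rightarrow> vec3) set" where
  "Kspace \<Omega> = {v \<in> L2 \<Omega>. \<forall>w \<in> L2 \<Omega>. weak_curl \<Omega> w (\<lambda>_. 0) \<longrightarrow> L2_inner \<Omega> v w = 0}"

text \<open>Eigenvalues of curl as operator on K(\<Omega>) with domain {v \<in> K. curl v \<in> K};
  elements of L2 are identified a.e.\<close>
definition curl_eigenvalue :: "vec3 set \<Rightarrow> real \<Rightarrow> bool" where
  "curl_eigenvalue \<Omega> \<mu> \<longleftrightarrow>
     (\<exists>v u. v \<in> Kspace \<Omega> \<and> u \<in> Kspace \<Omega> \<and> weak_curl \<Omega> v u \<and>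
        \<not> (AE x in lebesgue_on \<Omega>. v x = 0) \<and>
        (AE x in lebesgue_on \<Omega>. u x = \<mu> *\<^sub>R v x))"

definition mu1 :: "vec3 set \<Rightarrow> real" where
  "mu1 \<Omega> = Inf {\<mu>. \<mu> > 0 \<and> curl_eigenvalue \<Omega> \<mu>}"

definition bounded_convex_domain :: "vec3 set \<Rightarrow> bool" where
  "bounded_convex_domain \<Omega> \<longleftrightarrow>
     open \<Omega> \<and> connected \<Omega> \<and> \<Omega> \<noteq> {} \<and> bounded \<Omega> \<and> convex \<Omega>"

definition axially_symmetric :: "vec3 set \<Rightarrow> bool" where
  "axially_symmetric \<Omega> \<longleftrightarrow>
     (\<exists>a d::vec3. d \<noteq> 0 \<and>
        (\<forall>R::real^3^3. orthogonal_matrix R \<and> det R = 1 \<and> R *v d = d \<longrightarrow>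
           (\<lambda>x. a + R *v (x - a)) ` \<Omega> = \<Omega>))"

end

theory Submission
  imports Defs "HOL-Complex_Analysis.Great_Picard" "HOL-Library.Diagonal_Subsequence" "HOL-Real_Asymp.Real_Asymp"
begin

text \<open>
  A vector potential of a field \<open>u\<close> in \<open>K(\<Omega>)\<close>, extended by zero, is obtained by integrating \<open>d \<times> u\<close> along
  the rays \<open>x + t d\<close> and averaging over the direction \<open>d\<close>: the average over the sphere is the Biot-Savart
  field. If \<open>\<Omega>\<close> lies in a slab of width \<open>h\<close> with normal \<open>e\<close>, directions with \<open>d \<bullet> e \<ge> 1\<close> and times \<open>t \<le> h\<close>
  suffice, so this operator \<open>T\<close> has norm at most \<open>3h\<close>; averaging over an open set of directions makes it
  compact. For a normalised eigenfield \<open>v\<close> with eigenvalue \<open>\<mu>\<close> the field \<open>v - \<mu> T v\<close> is curl-free, hence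
  orthogonal to \<open>K(\<Omega>)\<close>, so \<open>1 = \<mu> \<langle>v, T v\<rangle> \<le> 3h\<mu>\<close>.

  Along a minimising sequence the eigenvalues are bounded, so all widths are bounded below. By axial
  symmetry the domains contain balls of a fixed radius centred on their axes; as the volume is fixed,
  the diameters are bounded. After translations and passing to a subsequence the domains
  become an increasing sequence under scalings that tend to the identity. Then \<open>K(\<Omega>\<^sub>i) \<subseteq> K(\<Omega>\<^sub>j)\<close> for
  \<open>i \<le> j\<close>, and \<open>\<langle>v\<^sub>i, v\<^sub>j\<rangle> = \<mu>\<^sub>j \<langle>v\<^sub>i, T v\<^sub>j\<rangle>\<close> together with the compactness of \<open>T\<close> shows that the eigenfields
  converge in \<open>L\<^sup>2\<close> to an eigenfield of the union, whose eigenvalue is the infimum.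
\<close>

section \<open>Square-integrable fields\<close>

text \<open>The rays are used because the norm of the operator has to shrink with the thickness of
  the domain: an estimate in terms of volume or diameter alone would not exclude flat domains from a
  minimising sequence. In \<open>3h\<close>, the factor 3 is the largest length of an admissible
  direction and \<open>h\<close> is the total mass of the measure on times and directions. The
  second obstacle is that the space \<open>K(\<Omega>)\<close> changes with the domain. Extension by
  zero maps \<open>K\<close> of a smaller domain into \<open>K\<close> of a larger one, but domains
  that are merely close to each other allow no such comparison. Hence the sequence is rescaled until
  it is nested, and the scalings must tend to the identity so that the limits of the volumes and of
  the eigenvalues are unchanged. The minimising sequence consists of arbitrary positive eigenvalues
  of admissible domains, not of first eigenvalues: everything reduces to showing that a limit of
  such eigenvalues is an eigenvalue of the limit domain.\<close>

definition sq_int :: "'a measure \<Rightarrow> ('a \<Rightarrow> 'b::euclidean_space) \<Rightarrow> bool" where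
  "sq_int M f \<longleftrightarrow> f \<in> borel_measurable M \<and> integrable M (\<lambda>x. (norm (f x))\<^sup>2)"

abbreviation normsq :: "'a measure \<Rightarrow> ('a \<Rightarrow> 'b::real_normed_vector) \<Rightarrow> real" where
  "normsq M f \<equiv> (\<integral>x. (norm (f x))\<^sup>2 \<partial>M)"

abbreviation norm1 :: "('a::euclidean_space \<Rightarrow> 'b::real_normed_vector) \<Rightarrow> real" where
  "norm1 f \<equiv> (\<integral>x. norm (f x) \<partial>lborel)"

abbreviation ip :: "('a::euclidean_space \<Rightarrow> 'b::real_inner) \<Rightarrow> ('a \<Rightarrow> 'b) \<Rightarrow> real" where
  "ip f g \<equiv> (\<integral>x. f x \<bullet> g x \<partial>lborel)"

lemma sq_intD:
  assumes "sq_int M f"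
  shows "f \<in> borel_measurable M" "integrable M (\<lambda>x. (norm (f x))\<^sup>2)"
  using assms by (auto simp: sq_int_def)

lemma L2_iff_sq_int: "v \<in> L2 \<Omega> \<longleftrightarrow> sq_int (lebesgue_on \<Omega>) v"
  by (simp add: L2_def sq_int_def)

lemma norm_mult_le_squares: "a * b \<le> (a\<^sup>2 + b\<^sup>2) / (2::real)"
  using sum_squares_bound[of a b] by simp

lemma sq_int_inner_integrable:
  assumes "sq_int M f" "sq_int M g"
  shows "integrable M (\<lambda>x. f x \<bullet> g x)"
proof (rule Bochner_Integration.integrable_bound)
  note [measurable] = sq_intD(1)[OF assms(1)] sq_intD(1)[OF assms(2)]
  show "integrable M (\<lambda>x. (norm (f x))\<^sup>2 + (norm (g x))\<^sup>2)"
    using assms by (auto dest: sq_intD)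
  show "(\<lambda>x. f x \<bullet> g x) \<in> borel_measurable M" by measurable
  have "norm (f x \<bullet> g x) \<le> norm ((norm (f x))\<^sup>2 + (norm (g x))\<^sup>2)" for x
    using norm_mult_le_squares[of "norm (f x)" "norm (g x)"] Cauchy_Schwarz_ineq2[of "f x" "g x"]
      zero_le_power2[of "norm (f x)"] zero_le_power2[of "norm (g x)"]
    unfolding real_norm_def abs_of_nonneg[OF add_nonneg_nonneg[OF zero_le_power2 zero_le_power2]] by argo
  then show "AE x in M. norm (f x \<bullet> g x) \<le> norm ((norm (f x))\<^sup>2 + (norm (g x))\<^sup>2)" by simp
qed

lemma norm_add_square_le: "(norm (x + y))\<^sup>2 \<le> 2 * (norm x)\<^sup>2 + 2 * (norm (y::'a::real_inner))\<^sup>2"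
proof -
  have "(norm (x + y))\<^sup>2 + (norm (x - y))\<^sup>2 = 2 * (norm x)\<^sup>2 + 2 * (norm y)\<^sup>2"
    by (simp add: power2_norm_eq_inner algebra_simps inner_commute)
  then show ?thesis using zero_le_power2[of "norm (x - y)"] by linarith
qed

lemma sq_int_add:
  assumes "sq_int M f" "sq_int M g"
  shows "sq_int M (\<lambda>x. f x + g x)"
  unfolding sq_int_def
proof
  note [measurable] = sq_intD(1)[OF assms(1)] sq_intD(1)[OF assms(2)]
  show "(\<lambda>x. f x + g x) \<in> borel_measurable M" by measurable
  show "integrable M (\<lambda>x. (norm (f x + g x))\<^sup>2)"
  proof (rule Bochner_Integration.integrable_bound)
    show "integrable M (\<lambda>x. 2 * (norm (f x))\<^sup>2 + 2 * (norm (g x))\<^sup>2)"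
      using assms[THEN sq_intD(2)] by simp
  qed (use norm_add_square_le[of "f _" "g _"] in \<open>auto\<close>)
qed

lemma sq_int_scaleR:
  assumes "sq_int M f"
  shows "sq_int M (\<lambda>x. c *\<^sub>R f x)"
  using assms by (auto simp: sq_int_def power_mult_distrib)

lemma sq_int_diff:
  assumes "sq_int M f" "sq_int M g"
  shows "sq_int M (\<lambda>x. f x - g x)"
  using sq_int_add[OF assms(1) sq_int_scaleR[OF assms(2), of "-1"]] by simp

text \<open>The squared norm of \<open>s f + t g\<close> is a nonnegative quadratic form in
  \<open>s\<close> and \<open>t\<close>; the choice \<open>s = B\<close>, \<open>t = - C\<close>
  turns this into the discriminant inequality, up to a factor \<open>B\<close>.\<close>

lemma L2_Cauchy_Schwarz:
  assumes "sq_int M f" "sq_int M g"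
  shows "\<bar>\<integral>x. f x \<bullet> g x \<partial>M\<bar> \<le> sqrt (normsq M f) * sqrt (normsq M g)"
proof -
  let ?A = "\<integral>x. (norm (f x))\<^sup>2 \<partial>M" and ?B = "\<integral>x. (norm (g x))\<^sup>2 \<partial>M" and ?C = "\<integral>x. f x \<bullet> g x \<partial>M"
  have quad: "0 \<le> s\<^sup>2 * ?A + 2 * s * t * ?C + t\<^sup>2 * ?B" for s t
  proof -
    have "s\<^sup>2 * ?A + 2 * s * t * ?C + t\<^sup>2 * ?B
        = (\<integral>x. s\<^sup>2 * (norm (f x))\<^sup>2 + 2 * s * t * (f x \<bullet> g x) + t\<^sup>2 * (norm (g x))\<^sup>2 \<partial>M)"
      using sq_intD(2)[OF assms(1)] sq_intD(2)[OF assms(2)] sq_int_inner_integrable[OF assms] by simp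
    also have "\<dots> = normsq M (\<lambda>x. s *\<^sub>R f x + t *\<^sub>R g x)"
      by (intro Bochner_Integration.integral_cong refl)
         (simp only: power2_norm_eq_inner, simp add: algebra_simps inner_commute power2_eq_square)
    also have "\<dots> \<ge> 0" by simp
    finally show ?thesis .
  qed
  have nn: "?A \<ge> 0" "?B \<ge> 0" by simp_all
  have "?C\<^sup>2 \<le> ?A * ?B"
  proof (cases "?B = 0")
    case True
    have "?C = 0"
    proof (rule ccontr)
      assume "?C \<noteq> 0"
      have "0 \<le> ?A + 2 * t * ?C" for t using quad[of 1 t] True by simp
      \<comment> \<open>With \<open>B = 0\<close> the form is affine in \<open>t\<close>; at this
        \<open>t\<close> it would equal -1.\<close>
      from this[of "-(?A + 1) / (2 * ?C)"] \<open>?C \<noteq> 0\<close> show False by (simp add: field_simps)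
    qed
    then show ?thesis using nn by simp
  next
    case False
    then have "?B > 0" using nn(2) by linarith
    have "0 \<le> ?B * (?A * ?B - ?C\<^sup>2)" using quad[of ?B "-?C"] by (simp add: algebra_simps power2_eq_square)
    then show ?thesis using \<open>?B > 0\<close> by (simp add: zero_le_mult_iff)
  qed
  then have "sqrt (?C\<^sup>2) \<le> sqrt (?A * ?B)" by (rule real_sqrt_le_mono)
  then show ?thesis by (simp add: real_sqrt_mult)
qed

lemma L2_norm_diff_expand:
  assumes "sq_int M f" "sq_int M g"
  shows "normsq M (\<lambda>x. f x - g x)
       = normsq M f - 2 * (\<integral>x. f x \<bullet> g x \<partial>M) + normsq M g"
proof -
  have "normsq M (\<lambda>x. f x - g x) = (\<integral>x. (norm (f x))\<^sup>2 - 2 * (f x \<bullet> g x) + (norm (g x))\<^sup>2 \<partial>M)"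
    by (intro Bochner_Integration.integral_cong refl)
       (simp only: power2_norm_eq_inner, simp add: algebra_simps inner_commute)
  then show ?thesis
    using sq_intD(2)[OF assms(1)] sq_intD(2)[OF assms(2)] sq_int_inner_integrable[OF assms] by simp
qed

lemma sq_int_imp_integrable:
  assumes "sq_int M f" "finite_measure M"
  shows "integrable M f"
proof (rule Bochner_Integration.integrable_bound)
  interpret finite_measure M by fact
  show "integrable M (\<lambda>x. 1 + (norm (f x))\<^sup>2)" using assms by (auto dest: sq_intD)
  have "norm (f x) \<le> norm (1 + (norm (f x))\<^sup>2)" for x
    using norm_mult_le_squares[of "norm (f x)" 1] zero_le_power2[of "norm (f x)"]
      norm_ge_zero[of "f x"]
    unfolding real_norm_def abs_of_nonneg[OF add_nonneg_nonneg[OF zero_le_one zero_le_power2]] one_power2 mult_1_right by argo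
  then show "AE x in M. norm (f x) \<le> norm (1 + (norm (f x))\<^sup>2)" by simp
qed (use assms in \<open>auto dest: sq_intD\<close>)

lemma integral_norm_le_sqrt:
  assumes "sq_int M f" "finite_measure M"
  shows "(\<integral>x. norm (f x) \<partial>M) \<le> sqrt (measure M (space M)) * sqrt (normsq M f)"
proof -
  interpret finite_measure M by fact
  have 1: "sq_int M (\<lambda>x. 1::real)" by (simp add: sq_int_def)
  have 2: "sq_int M (\<lambda>x. norm (f x))" using assms(1) by (auto simp: sq_int_def)
  show ?thesis using L2_Cauchy_Schwarz[OF 1 2] by simp
qed

text \<open>Riesz-Fischer. Finiteness of the measure turns an L2-Cauchy sequence into an L1-Cauchy
  one, which has an almost everywhere convergent subsequence; Fatou's lemma then shows that the
  pointwise limit is the L2 limit of the whole sequence.\<close>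

lemma L2_complete:
  fixes s :: "nat \<Rightarrow> 'a \<Rightarrow> 'b::euclidean_space"
  assumes fin: "finite_measure M" and s: "\<And>n. sq_int M (s n)"
    and Cauchy: "\<And>e. e > 0 \<Longrightarrow> \<exists>N. \<forall>i\<ge>N. \<forall>j\<ge>N. normsq M (\<lambda>x. s i x - s j x) < e"
  obtains v where "sq_int M v" "(\<lambda>n. \<integral>x. (norm (s n x - v x))\<^sup>2 \<partial>M) \<longlonglongrightarrow> 0"
proof -
  interpret finite_measure M by fact
  have "\<exists>N. \<forall>i\<ge>N. \<forall>j\<ge>N. (LINT x|M. norm (s i x - s j x)) < e" if "e > 0" for e
  proof -
    \<comment> \<open>The added 1 keeps the constant positive on a null space.\<close>
    let ?c = "sqrt (measure M (space M)) + 1"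
    have c: "?c > 0" by (simp add: add_nonneg_pos)
    have "(e / ?c)\<^sup>2 > 0" using \<open>e > 0\<close> c by simp
    then obtain N where N: "\<And>i j. i \<ge> N \<Longrightarrow> j \<ge> N \<Longrightarrow> normsq M (\<lambda>x. s i x - s j x) < (e / ?c)\<^sup>2"
      using Cauchy by blast
    have "(LINT x|M. norm (s i x - s j x)) < e" if "i \<ge> N" "j \<ge> N" for i j
    proof -
      have "sqrt (normsq M (\<lambda>x. s i x - s j x)) < e / ?c"
        using N[OF that] \<open>e > 0\<close> c by (intro real_less_lsqrt) auto
      moreover have "(LINT x|M. norm (s i x - s j x)) \<le> ?c * sqrt (normsq M (\<lambda>x. s i x - s j x))"
        using integral_norm_le_sqrt[OF sq_int_diff[OF s s] fin, of i j]
        by (rule order_trans) (intro mult_right_mono, auto)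
      ultimately show ?thesis using c by (simp add: field_simps)
    qed
    then show ?thesis by blast
  qed
  then obtain r where r: "strict_mono r" and ae: "AE x in M. Cauchy (\<lambda>i. s (r i) x)"
    using cauchy_L1_AE_cauchy_subseq[of M s] sq_int_imp_integrable[OF s fin] by metis
  have [measurable]: "\<And>n. s n \<in> borel_measurable M" using s by (auto dest: sq_intD)
  define v where "v x = lim (\<lambda>i. s (r i) x)" for x
  have [measurable]: "v \<in> borel_measurable M" unfolding v_def by measurable
  have conv: "AE x in M. (\<lambda>i. s (r i) x) \<longlonglongrightarrow> v x"
    using ae by eventually_elim (simp add: v_def Cauchy_convergent_iff convergent_LIMSEQ_iff)
  \<comment> \<open>With \<open>n\<close> fixed, the Cauchy estimate survives as the second index
    runs to infinity along the subsequence.\<close>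
  have bound: "(\<integral>\<^sup>+x. ennreal ((norm (s n x - v x))\<^sup>2) \<partial>M) \<le> ennreal e"
    if e: "e > 0" and N: "\<forall>i\<ge>N. \<forall>j\<ge>N. normsq M (\<lambda>x. s i x - s j x) < e" and n: "n \<ge> N" for n N e
  proof -
    have "(\<integral>\<^sup>+x. ennreal ((norm (s n x - v x))\<^sup>2) \<partial>M)
        = (\<integral>\<^sup>+x. liminf (\<lambda>i. ennreal ((norm (s n x - s (r i) x))\<^sup>2)) \<partial>M)"
    proof (rule nn_integral_cong_AE)
      show "AE x in M. ennreal ((norm (s n x - v x))\<^sup>2) = liminf (\<lambda>i. ennreal ((norm (s n x - s (r i) x))\<^sup>2))"
        using conv
      proof eventually_elim
        case (elim x)
        have "(\<lambda>i. ennreal ((norm (s n x - s (r i) x))\<^sup>2)) \<longlonglongrightarrow> ennreal ((norm (s n x - v x))\<^sup>2)"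
          by (intro tendsto_intros elim tendsto_ennrealI)
        then show ?case by (rule lim_imp_Liminf[OF trivial_limit_sequentially, symmetric])
      qed
    qed
    also have "\<dots> \<le> liminf (\<lambda>i. \<integral>\<^sup>+x. ennreal ((norm (s n x - s (r i) x))\<^sup>2) \<partial>M)"
      by (intro nn_integral_liminf) measurable
    also have "\<dots> \<le> ennreal e"
    proof -
      have "eventually (\<lambda>i. (\<integral>\<^sup>+x. ennreal ((norm (s n x - s (r i) x))\<^sup>2) \<partial>M) \<le> ennreal e) sequentially"
        using eventually_ge_at_top[of N]
      proof eventually_elim
        case (elim i)
        have "r i \<ge> N" using seq_suble[OF r, of i] elim by simp
        then have "normsq M (\<lambda>x. s n x - s (r i) x) < e" using N n by blast
        then show ?case
          using sq_intD(2)[OF sq_int_diff[OF s[of n] s[of "r i"]]]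
          by (subst nn_integral_eq_integral) (auto intro!: ennreal_leI)
      qed
      then have "liminf (\<lambda>i. \<integral>\<^sup>+x. ennreal ((norm (s n x - s (r i) x))\<^sup>2) \<partial>M) \<le> liminf (\<lambda>i. ennreal e)"
        by (rule Liminf_mono)
      then show ?thesis by (simp add: Liminf_const)
    qed
    finally show ?thesis .
  qed
  have diff: "sq_int M (\<lambda>x. s n x - v x)" if "n \<ge> N" "\<forall>i\<ge>N. \<forall>j\<ge>N. normsq M (\<lambda>x. s i x - s j x) < 1" for n N
    unfolding sq_int_def
  proof
    show "integrable M (\<lambda>x. (norm (s n x - v x))\<^sup>2)"
      using bound[OF _ that(2,1)] le_less_trans by (intro integrableI_nonneg) fastforce+
  qed measurable
  obtain N1 where N1: "\<forall>i\<ge>N1. \<forall>j\<ge>N1. (normsq M (\<lambda>x. s i x - s j x)) < 1"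
    using Cauchy[of 1] by auto
  show thesis
  proof
    show "sq_int M v" using sq_int_diff[OF s[of N1] diff[OF _ N1, of N1]] by simp
    show "(\<lambda>n. \<integral>x. (norm (s n x - v x))\<^sup>2 \<partial>M) \<longlonglongrightarrow> 0"
    proof (rule LIMSEQ_I)
      fix e :: real assume "e > 0"
      then obtain N where N: "\<forall>i\<ge>N. \<forall>j\<ge>N. normsq M (\<lambda>x. s i x - s j x) < e/2"
        using Cauchy[of "e/2"] by auto
      have "norm ((normsq M (\<lambda>x. s n x - v x)) - 0) < e" if "n \<ge> max N N1" for n
      proof -
        have "n \<ge> N" "n \<ge> N1" using that by auto
        have "ennreal (normsq M (\<lambda>x. s n x - v x)) = (\<integral>\<^sup>+x. ennreal ((norm (s n x - v x))\<^sup>2) \<partial>M)"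
          using sq_intD(2)[OF diff[OF \<open>n \<ge> N1\<close> N1]] by (subst nn_integral_eq_integral) auto
        also have "\<dots> \<le> ennreal (e/2)" using bound[OF _ N \<open>n \<ge> N\<close>] \<open>e > 0\<close> by simp
        finally have "normsq M (\<lambda>x. s n x - v x) \<le> e/2" using \<open>e > 0\<close> by simp
        then show ?thesis using \<open>e > 0\<close> by simp
      qed
      then show "\<exists>no. \<forall>n\<ge>no. norm ((normsq M (\<lambda>x. s n x - v x)) - 0) < e" by blast
    qed
  qed
qed

lemma L2_inner_tendsto:
  assumes s: "\<And>n. sq_int M (s n)" and v: "sq_int M v" and g: "sq_int M g"
    and lim: "(\<lambda>n. \<integral>x. (norm (s n x - v x))\<^sup>2 \<partial>M) \<longlonglongrightarrow> 0"
  shows "(\<lambda>n. \<integral>x. s n x \<bullet> g x \<partial>M) \<longlonglongrightarrow> (\<integral>x. v x \<bullet> g x \<partial>M)"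
proof -
  have "(\<lambda>n. (\<integral>x. s n x \<bullet> g x \<partial>M) - (\<integral>x. v x \<bullet> g x \<partial>M)) \<longlonglongrightarrow> 0"
  proof (rule Lim_null_comparison)
    show "eventually (\<lambda>n. norm ((\<integral>x. s n x \<bullet> g x \<partial>M) - (\<integral>x. v x \<bullet> g x \<partial>M))
        \<le> sqrt (normsq M (\<lambda>x. s n x - v x)) * sqrt (normsq M g)) sequentially"
    proof (rule always_eventually, rule allI)
      fix n
      have "(\<integral>x. s n x \<bullet> g x \<partial>M) - (\<integral>x. v x \<bullet> g x \<partial>M) = (\<integral>x. (s n x - v x) \<bullet> g x \<partial>M)"
        using sq_int_inner_integrable[OF s g] sq_int_inner_integrable[OF v g] by (simp add: inner_diff_left)
      then show "norm ((\<integral>x. s n x \<bullet> g x \<partial>M) - (\<integral>x. v x \<bullet> g x \<partial>M))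
        \<le> sqrt (normsq M (\<lambda>x. s n x - v x)) * sqrt (normsq M g)"
        using L2_Cauchy_Schwarz[OF sq_int_diff[OF s v] g] by simp
    qed
    show "(\<lambda>n. sqrt (normsq M (\<lambda>x. s n x - v x)) * sqrt (normsq M g)) \<longlonglongrightarrow> 0"
      using tendsto_mult_right[OF tendsto_real_sqrt[OF lim]] by (simp add: tendsto_mult_left_zero)
  qed
  then show ?thesis by (simp add: LIM_zero_iff)
qed

text \<open>The squared norm of \<open>s n\<close> is that of \<open>s n - v\<close>, plus twice the
  inner product with \<open>v\<close>, minus the squared norm of \<open>v\<close>; each of these
  terms has a known limit.\<close>

lemma L2_norm_tendsto:
  assumes s: "\<And>n. sq_int M (s n)" and v: "sq_int M v"
    and lim: "(\<lambda>n. \<integral>x. (norm (s n x - v x))\<^sup>2 \<partial>M) \<longlonglongrightarrow> 0"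
  shows "(\<lambda>n. \<integral>x. (norm (s n x))\<^sup>2 \<partial>M) \<longlonglongrightarrow> (normsq M v)"
proof -
  have eq: "normsq M (s n) = normsq M (\<lambda>x. s n x - v x)
      + 2 * (\<integral>x. s n x \<bullet> v x \<partial>M) - normsq M v" for n
    using L2_norm_diff_expand[OF s v, of n] by simp
  have "(\<lambda>n. (normsq M (\<lambda>x. s n x - v x))
      + 2 * (\<integral>x. s n x \<bullet> v x \<partial>M) - normsq M v)
     \<longlonglongrightarrow> 0 + 2 * (\<integral>x. v x \<bullet> v x \<partial>M) - normsq M v"
    by (intro tendsto_intros lim L2_inner_tendsto s v)
  then show ?thesis unfolding eq by (simp add: power2_norm_eq_inner)
qed

section \<open>Test fields\<close>

definition dd :: "(vec3 \<Rightarrow> vec3) \<Rightarrow> 3 \<Rightarrow> vec3 \<Rightarrow> vec3" where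
  "dd \<phi> i x = frechet_derivative \<phi> (at x) (axis i 1)"

lemma pd_eq_dd: "pd \<phi> i j x = dd \<phi> j x $ i"
  by (simp add: pd_def dd_def)

section \<open>Translations and compactly supported fields\<close>

lemma integral_lborel_translate:
  fixes f :: "'a::euclidean_space \<Rightarrow> 'b::{banach, second_countable_topology}"
  assumes [measurable]: "f \<in> borel_measurable borel"
  shows "(\<integral>x. f (x + c) \<partial>lborel) = (\<integral>x. f x \<partial>lborel)"
proof -
  have "(\<integral>x. f x \<partial>lborel) = (\<integral>x. f x \<partial>distr lborel borel ((+) c))"
    by (simp add: lborel_distr_plus)
  also have "\<dots> = (\<integral>x. f (c + x) \<partial>lborel)" by (rule integral_distr) measurable
  finally show ?thesis by (simp add: add.commute)
qed

lemma integrable_lborel_translate: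
  fixes f :: "'a::euclidean_space \<Rightarrow> 'b::{banach, second_countable_topology}"
  assumes "integrable lborel f"
  shows "integrable lborel (\<lambda>x. f (x + c))"
proof -
  have [measurable]: "f \<in> borel_measurable borel" using assms by auto
  have "integrable (distr lborel borel ((+) c)) f" using assms by (simp add: lborel_distr_plus)
  then have "integrable lborel (\<lambda>x. f (c + x))" by (subst (asm) integrable_distr_eq) measurable
  then show ?thesis by (simp add: add.commute)
qed

lemma integrable_continuous_compact_support:
  fixes f :: "'a::euclidean_space \<Rightarrow> 'b::euclidean_space"
  assumes "continuous_on UNIV f" "compact S" "\<And>x. x \<notin> S \<Longrightarrow> f x = 0"
  shows "integrable lborel f"
proof -
  have "integrable lborel (\<lambda>x. indicator S x *\<^sub>R f x)"
    using assms by (intro borel_integrable_compact) (auto intro: continuous_on_subset)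
  moreover have "(\<lambda>x. indicator S x *\<^sub>R f x) = f" using assms(3) by (auto simp: indicator_def)
  ultimately show ?thesis by simp
qed

lemma sq_int_continuous_compact_support:
  fixes f :: "'a::euclidean_space \<Rightarrow> 'b::euclidean_space"
  assumes "continuous_on UNIV f" "compact S" "\<And>x. x \<notin> S \<Longrightarrow> f x = 0"
  shows "sq_int lborel f"
  unfolding sq_int_def
proof
  show "f \<in> borel_measurable lborel" using borel_measurable_continuous_onI[OF assms(1)] by simp
  show "integrable lborel (\<lambda>x. (norm (f x))\<^sup>2)"
    using assms by (intro integrable_continuous_compact_support[of _ S] continuous_intros) auto
qed

lemma bounded_continuous_compact_support:
  fixes f :: "'a::euclidean_space \<Rightarrow> 'b::euclidean_space"
  assumes "continuous_on UNIV f" "compact S" "\<And>x. x \<notin> S \<Longrightarrow> f x = 0"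
  obtains M where "M \<ge> 0" "\<And>x. norm (f x) \<le> M"
proof -
  have "compact (f ` S)" using assms by (intro compact_continuous_image) (auto intro: continuous_on_subset)
  then have "bounded (f ` S)" by (rule compact_imp_bounded)
  then obtain M where M: "\<And>x. x \<in> S \<Longrightarrow> norm (f x) \<le> M" by (auto simp: bounded_iff)
  have "norm (f x) \<le> max M 0" for x using M[of x] assms(3)[of x] by (cases "x \<in> S") auto
  then show thesis by (intro that[of "max M 0"]) auto
qed

text \<open>Symmetry of mixed second derivatives without second derivatives: both integrals are limits of the
  same second difference of the correlation function of \<open>f\<close> and \<open>g\<close>.\<close>

lemma integral_mixed_derivatives:
  fixes f g fa fb ga gb :: "'a::euclidean_space \<Rightarrow> real"
  assumes S: "compact S" and f0: "\<And>x. x \<notin> S \<Longrightarrow> f x = 0" and g0: "\<And>x. x \<notin> S \<Longrightarrow> g x = 0"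
    and cf: "continuous_on UNIV f" and cg: "continuous_on UNIV g"
    and c: "continuous_on UNIV fa" "continuous_on UNIV fb" "continuous_on UNIV ga" "continuous_on UNIV gb"
    and z: "\<And>x. x \<notin> S \<Longrightarrow> fa x = 0" "\<And>x. x \<notin> S \<Longrightarrow> fb x = 0" "\<And>x. x \<notin> S \<Longrightarrow> ga x = 0" "\<And>x. x \<notin> S \<Longrightarrow> gb x = 0"
    and fa: "\<And>x t. ((\<lambda>t. f (x + t *\<^sub>R a)) has_real_derivative fa (x + t *\<^sub>R a)) (at t)"
    and fb: "\<And>x t. ((\<lambda>t. f (x + t *\<^sub>R b)) has_real_derivative fb (x + t *\<^sub>R b)) (at t)"
    and ga: "\<And>x t. ((\<lambda>t. g (x + t *\<^sub>R a)) has_real_derivative ga (x + t *\<^sub>R a)) (at t)"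
    and gb: "\<And>x t. ((\<lambda>t. g (x + t *\<^sub>R b)) has_real_derivative gb (x + t *\<^sub>R b)) (at t)"
  shows "(\<integral>x. fa x * gb x \<partial>lborel) = (\<integral>x. fb x * ga x \<partial>lborel)"
proof -
  define h where "h n = 1 / (real n + 1)" for n
  have h: "h n > 0" "h n \<le> 1" for n by (auto simp: h_def)
  have h_lim: "h \<longlonglongrightarrow> 0" unfolding h_def using LIMSEQ_inverse_real_of_nat by (simp add: inverse_eq_divide add.commute)
  have h_nz: "h n \<noteq> 0" for n using h(1)[of n] by simp
  have h_at: "filterlim h (at 0) sequentially"
    unfolding filterlim_at using h_lim h_nz by (simp add: eventually_sequentially)
  have minus_h_at: "filterlim (\<lambda>n. - h n) (at 0) sequentially"
    unfolding filterlim_at using tendsto_minus[OF h_lim] h_nz by (simp add: eventually_sequentially)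
  \<comment> \<open>A forward difference for \<open>f\<close> and a backward difference for
    \<open>g\<close>: after translation only sums of the two shifts occur, which makes the integral
    symmetric in \<open>a\<close> and \<open>b\<close>.\<close>
  define Q where "Q a b n x = ((f (x + h n *\<^sub>R a) - f x) / h n) * ((g x - g (x - h n *\<^sub>R b)) / h n)" for a b n x
  note [measurable] = borel_measurable_continuous_onI[OF cf] borel_measurable_continuous_onI[OF cg]
  define co where "co s = (\<integral>x. f (x + s) * g x \<partial>lborel)" for s
  have co_int: "integrable lborel (\<lambda>x. f (x + s) * g (x + r))" for s r
  proof -
    have "integrable lborel (\<lambda>x. f (x + (s - r)) * g x)"
      using S g0 by (intro integrable_continuous_compact_support[of _ S] continuous_intros
          continuous_on_compose2[OF cf] cg) auto
    from integrable_lborel_translate[OF this, of r] show ?thesis by (simp add: algebra_simps)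
  qed
  have co_shift: "(\<integral>x. f (x + s) * g (x + r) \<partial>lborel) = co (s - r)" for s r
  proof -
    have "co (s - r) = (\<integral>x. f ((x + r) + (s - r)) * g (x + r) \<partial>lborel)"
      unfolding co_def by (subst integral_lborel_translate[of "\<lambda>x. f (x + (s - r)) * g x" r]) measurable
    then show ?thesis by (simp add: algebra_simps)
  qed
  have Qint: "(\<integral>x. Q a b n x \<partial>lborel)
      = (co (h n *\<^sub>R a) - co (h n *\<^sub>R a + h n *\<^sub>R b) - co 0 + co (h n *\<^sub>R b)) / (h n)\<^sup>2" for a b n
  proof -
    have "Q a b n x = (f (x + h n *\<^sub>R a) * g (x + 0) - f (x + h n *\<^sub>R a) * g (x + - (h n *\<^sub>R b))
         - f (x + 0) * g (x + 0) + f (x + 0) * g (x + - (h n *\<^sub>R b))) / (h n)\<^sup>2" for x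
      by (simp add: Q_def power2_eq_square field_simps)
    then have "(\<integral>x. Q a b n x \<partial>lborel) = (\<integral>x. (f (x + h n *\<^sub>R a) * g (x + 0) - f (x + h n *\<^sub>R a) * g (x + - (h n *\<^sub>R b))
         - f (x + 0) * g (x + 0) + f (x + 0) * g (x + - (h n *\<^sub>R b))) / (h n)\<^sup>2 \<partial>lborel)" by presburger
    also have "\<dots> = (co (h n *\<^sub>R a) - co (h n *\<^sub>R a + h n *\<^sub>R b) - co 0 + co (h n *\<^sub>R b)) / (h n)\<^sup>2"
      by (simp only: integral_divide_zero Bochner_Integration.integral_add Bochner_Integration.integral_diff
          Bochner_Integration.integrable_diff co_int co_shift) simp
    finally show ?thesis .
  qed
  have Qlim: "(\<lambda>n. \<integral>x. Q a b n x \<partial>lborel) \<longlonglongrightarrow> (\<integral>x. fa x * gb x \<partial>lborel)"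
    if fa: "\<And>x t. ((\<lambda>t. f (x + t *\<^sub>R a)) has_real_derivative fa (x + t *\<^sub>R a)) (at t)"
    and gb: "\<And>x t. ((\<lambda>t. g (x + t *\<^sub>R b)) has_real_derivative gb (x + t *\<^sub>R b)) (at t)"
    and cfa: "continuous_on UNIV fa" and cgb: "continuous_on UNIV gb"
    and zfa: "\<And>x. x \<notin> S \<Longrightarrow> fa x = 0" and zgb: "\<And>x. x \<notin> S \<Longrightarrow> gb x = 0" for a b fa gb
  proof -
    obtain M1 where M1: "M1 \<ge> 0" "\<And>x. norm (fa x) \<le> M1"
      using bounded_continuous_compact_support[OF cfa S zfa] by blast
    obtain M2 where M2: "M2 \<ge> 0" "\<And>x. norm (gb x) \<le> M2"
      using bounded_continuous_compact_support[OF cgb S zgb] by blast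
    obtain R where R: "\<And>x. x \<in> S \<Longrightarrow> norm x \<le> R" using compact_imp_bounded[OF S] by (auto simp: bounded_iff)
    have q: "\<bar>(f (x + h n *\<^sub>R a) - f x) / h n\<bar> \<le> M1" for n x
    proof -
      obtain t where "0 < t" "t < h n" "f (x + h n *\<^sub>R a) - f (x + 0 *\<^sub>R a) = (h n - 0) * fa (x + t *\<^sub>R a)"
        using MVT2[of 0 "h n" "\<lambda>t. f (x + t *\<^sub>R a)" "\<lambda>t. fa (x + t *\<^sub>R a)"] h(1)[of n] fa by blast
      then have "(f (x + h n *\<^sub>R a) - f x) / h n = fa (x + t *\<^sub>R a)" using h(1)[of n] by (simp add: field_simps)
      then show ?thesis using M1(2)[of "x + t *\<^sub>R a"] by simp
    qed
    have p: "\<bar>(g x - g (x - h n *\<^sub>R b)) / h n\<bar> \<le> M2" for n x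
    proof -
      have "- h n < 0" using h(1)[of n] by simp
      then obtain t where "- h n < t" "t < 0" "g (x + 0 *\<^sub>R b) - g (x + (- h n) *\<^sub>R b) = (0 - (- h n)) * gb (x + t *\<^sub>R b)"
        using MVT2[of "- h n" 0 "\<lambda>t. g (x + t *\<^sub>R b)" "\<lambda>t. gb (x + t *\<^sub>R b)"] gb by blast
      then have "(g x - g (x - h n *\<^sub>R b)) / h n = gb (x + t *\<^sub>R b)" using h(1)[of n] by (simp add: field_simps)
      then show ?thesis using M2(2)[of "x + t *\<^sub>R b"] by simp
    qed
    show ?thesis
    \<comment> \<open>The derivative bounds dominate the difference quotients; since
      \<open>h n \<le> 1\<close>, the quotient of \<open>f\<close> vanishes outside the ball
      enlarged by \<open>norm a\<close>.\<close>
    proof (rule integral_dominated_convergence[where w = "\<lambda>x. indicator (cball 0 (R + norm a)) x * (M1 * M2)"])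
      show "(\<lambda>x. fa x * gb x) \<in> borel_measurable lborel"
        using borel_measurable_continuous_onI[OF cfa] borel_measurable_continuous_onI[OF cgb] by simp
      show "(\<lambda>x. Q a b n x) \<in> borel_measurable lborel" for n unfolding Q_def by measurable
      show "integrable lborel (\<lambda>x. indicator (cball 0 (R + norm a)) x * (M1 * M2))"
        by (intro integrable_mult_left integrable_real_indicator) (auto simp: emeasure_lborel_cball_finite[unfolded infinity_ennreal_def])
      have "(\<lambda>n. Q a b n x) \<longlonglongrightarrow> fa x * gb x" for x
      proof -
        have "((\<lambda>t. (f (x + t *\<^sub>R a) - f x) / t) \<longlongrightarrow> fa x) (at 0)"
          using fa[of x 0] by (simp add: has_field_derivative_iff)
        then have 1: "(\<lambda>n. (f (x + h n *\<^sub>R a) - f x) / h n) \<longlonglongrightarrow> fa x"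
          by (rule filterlim_compose[OF _ h_at])
        have "((\<lambda>t. (g (x + t *\<^sub>R b) - g x) / t) \<longlongrightarrow> gb x) (at 0)"
          using gb[of x 0] by (simp add: has_field_derivative_iff)
        then have "(\<lambda>n. (g (x + (- h n) *\<^sub>R b) - g x) / (- h n)) \<longlonglongrightarrow> gb x"
          by (rule filterlim_compose[OF _ minus_h_at])
        moreover have "(g (x + (- h n) *\<^sub>R b) - g x) / (- h n) = (g x - g (x - h n *\<^sub>R b)) / h n" for n
          using h_nz[of n] by (simp add: divide_simps)
        ultimately show ?thesis unfolding Q_def using 1 by (intro tendsto_mult) simp_all
      qed
      then show "AE x in lborel. (\<lambda>n. Q a b n x) \<longlonglongrightarrow> fa x * gb x" by simp
      have "norm (Q a b n x) \<le> indicator (cball 0 (R + norm a)) x * (M1 * M2)" for n x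
      proof (cases "x \<in> cball 0 (R + norm a)")
        case True
        then show ?thesis using mult_mono[OF q p, of x n x n] M1 by (simp add: Q_def abs_mult)
      next
        case False
        have "x \<notin> S" using R[of x] False norm_ge_zero[of a] by (auto simp del: norm_ge_zero)
        moreover have "x + h n *\<^sub>R a \<notin> S"
        proof
          assume "x + h n *\<^sub>R a \<in> S"
          then have "norm x \<le> R + norm (h n *\<^sub>R a)" 
            using R[of "x + h n *\<^sub>R a"] norm_triangle_ineq4[of "x + h n *\<^sub>R a" "h n *\<^sub>R a"] by simp
          moreover have "norm (h n *\<^sub>R a) \<le> norm a" using h[of n] by (simp add: mult_left_le_one_le)
          ultimately show False using False by simp
        qed
        ultimately show ?thesis using f0 False by (simp add: Q_def)
      qed
      then show "AE x in lborel. norm (Q a b n x) \<le> indicator (cball 0 (R + norm a)) x * (M1 * M2)" for n by simp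
    qed
  qed
  have "(\<integral>x. Q a b n x \<partial>lborel) = (\<integral>x. Q b a n x \<partial>lborel)" for n unfolding Qint by (simp add: add.commute)
  moreover have "(\<lambda>n. \<integral>x. Q a b n x \<partial>lborel) \<longlonglongrightarrow> (\<integral>x. fa x * gb x \<partial>lborel)"
    by (rule Qlim) (use assms in auto)
  moreover have "(\<lambda>n. \<integral>x. Q b a n x \<partial>lborel) \<longlonglongrightarrow> (\<integral>x. fb x * ga x \<partial>lborel)"
    by (rule Qlim) (use assms in auto)
  ultimately show ?thesis using LIMSEQ_unique by simp
qed

section \<open>Calculus of test fields\<close>

lemma test_fieldD:
  assumes "test_field \<Omega> \<phi>"
  shows "\<phi> differentiable (at x)" "continuous_on UNIV (dd \<phi> j)"
    "compact (closure {x. \<phi> x \<noteq> 0})" "closure {x. \<phi> x \<noteq> 0} \<subseteq> \<Omega>"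
  using assms by (auto simp: test_field_def dd_def)

lemma test_field_subset: "test_field \<Omega> \<phi> \<Longrightarrow> \<Omega> \<subseteq> \<Omega>' \<Longrightarrow> test_field \<Omega>' \<phi>"
  by (auto simp: test_field_def)

lemma test_field_has_derivative:
  assumes "test_field \<Omega> \<phi>"
  shows "(\<phi> has_derivative frechet_derivative \<phi> (at x)) (at x)"
  using test_fieldD(1)[OF assms] frechet_derivative_works by blast

lemma test_field_continuous: "test_field \<Omega> \<phi> \<Longrightarrow> continuous_on UNIV \<phi>"
  using test_fieldD(1) by (intro differentiable_imp_continuous_on) (auto simp: differentiable_on_def)

lemma test_field_zero: "test_field \<Omega> \<phi> \<Longrightarrow> x \<notin> closure {x. \<phi> x \<noteq> 0} \<Longrightarrow> \<phi> x = 0"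
  using closure_subset[of "{x. \<phi> x \<noteq> 0}"] by auto

lemma frechet_derivative_zero_off_support:
  assumes "x \<notin> closure {x. \<phi> x \<noteq> 0}"
  shows "frechet_derivative \<phi> (at x) = (\<lambda>_. 0)"
proof -
  have "((\<lambda>_. 0) has_derivative (\<lambda>_. 0)) (at x)" by simp
  then have "(\<phi> has_derivative (\<lambda>_. 0)) (at x)"
    by (rule has_derivative_transform_within_open[where s = "- closure {x. \<phi> x \<noteq> 0}"])
       (use assms closure_subset[of "{x. \<phi> x \<noteq> 0}"] in auto)
  then show ?thesis using frechet_derivative_at by metis
qed

lemma dd_zero_off_support: "x \<notin> closure {x. \<phi> x \<noteq> 0} \<Longrightarrow> dd \<phi> j x = 0"
  by (simp add: dd_def frechet_derivative_zero_off_support)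

lemma curl_zero_off_support: "x \<notin> closure {x. \<phi> x \<noteq> 0} \<Longrightarrow> curl \<phi> x = 0"
  by (simp add: curl_def pd_eq_dd dd_zero_off_support vec_eq_iff forall_3)

lemma continuous_on_vector3:
  fixes f g h :: "'a::topological_space \<Rightarrow> real"
  assumes "continuous_on S f" "continuous_on S g" "continuous_on S h"
  shows "continuous_on S (\<lambda>x. vector [f x, g x, h x] :: vec3)"
proof -
  have eq: "(\<lambda>x. vector [f x, g x, h x] :: vec3) = (\<lambda>x. f x *\<^sub>R axis 1 1 + g x *\<^sub>R axis 2 1 + h x *\<^sub>R axis 3 1)"
    by (simp add: fun_eq_iff vec_eq_iff forall_3 axis_def)
  show ?thesis unfolding eq
    by (intro continuous_on_add continuous_on_scaleR continuous_on_const assms)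
qed

lemma test_field_curl_continuous:
  assumes "test_field \<Omega> \<phi>"
  shows "continuous_on UNIV (curl \<phi>)"
proof -
  have "continuous_on UNIV (\<lambda>x. dd \<phi> j x $ i)" for i j
    by (intro continuous_on_component test_fieldD(2)[OF assms])
  then show ?thesis unfolding curl_def[abs_def] pd_eq_dd
    by (intro continuous_on_vector3 continuous_on_diff)
qed

lemma test_field_sq_int:
  assumes "test_field \<Omega> \<phi>"
  shows "sq_int lborel \<phi>" "sq_int lborel (curl \<phi>)"
  by (rule sq_int_continuous_compact_support[OF _ test_fieldD(3)[OF assms]],
      rule test_field_continuous[OF assms], erule test_field_zero[OF assms],
      rule sq_int_continuous_compact_support[OF _ test_fieldD(3)[OF assms]],
      rule test_field_curl_continuous[OF assms], erule curl_zero_off_support)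

lemma frechet_derivative_eq_sum_dd:
  assumes "\<phi> differentiable (at x)"
  shows "frechet_derivative \<phi> (at x) d = (\<Sum>j\<in>UNIV. (d $ j) *\<^sub>R dd \<phi> j x)"
proof -
  have lin: "linear (frechet_derivative \<phi> (at x))" by (rule linear_frechet_derivative[OF assms])
  have "d = (\<Sum>j\<in>UNIV. (d $ j) *\<^sub>R axis j 1)"
    using basis_expansion[of d] by (simp add: scalar_mult_eq_scaleR)
  then have "frechet_derivative \<phi> (at x) d = frechet_derivative \<phi> (at x) (\<Sum>j\<in>UNIV. (d $ j) *\<^sub>R axis j 1)" by simp
  also have "\<dots> = (\<Sum>j\<in>UNIV. (d $ j) *\<^sub>R dd \<phi> j x)"
    using lin by (simp add: linear_sum linear_cmul dd_def)
  finally show ?thesis .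
qed

text \<open>The gradient of the scalar function \<open>\<phi> x \<bullet> d\<close> of
  \<open>x\<close> for a fixed vector \<open>d\<close>, in other words the transposed Jacobian
  applied to \<open>d\<close>.\<close>

definition grad_dot :: "(vec3 \<Rightarrow> vec3) \<Rightarrow> vec3 \<Rightarrow> vec3 \<Rightarrow> vec3" where
  "grad_dot \<phi> d x = (\<chi> i. dd \<phi> i x \<bullet> d)"

text \<open>The Jacobian minus its transpose acts as the cross product with the curl. This splits
  the product into a derivative along \<open>d\<close>, which can be integrated along rays, and a
  gradient.\<close>

lemma curl_cross3:
  assumes "\<phi> differentiable (at x)"
  shows "cross3 (curl \<phi> x) d = frechet_derivative \<phi> (at x) d - grad_dot \<phi> d x"
  unfolding frechet_derivative_eq_sum_dd[OF assms]
  by (simp add: cross3_def curl_def pd_eq_dd grad_dot_def vec_eq_iff forall_3 sum_3 inner_vec_def algebra_simps)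

lemma continuous_grad_dot:
  assumes "test_field \<Omega> \<phi>" shows "continuous_on UNIV (grad_dot \<phi> d)"
proof -
  have "grad_dot \<phi> d = (\<lambda>x. vector [dd \<phi> 1 x \<bullet> d, dd \<phi> 2 x \<bullet> d, dd \<phi> 3 x \<bullet> d])"
    by (simp add: fun_eq_iff grad_dot_def vec_eq_iff forall_3)
  then show ?thesis
    by (simp only:) (intro continuous_on_vector3 continuous_on_inner continuous_on_const test_fieldD(2)[OF assms])
qed

lemma grad_dot_zero_off_support: "x \<notin> closure {x. \<phi> x \<noteq> 0} \<Longrightarrow> grad_dot \<phi> d x = 0"
  by (simp add: grad_dot_def dd_zero_off_support vec_eq_iff)

lemma test_field_derivative_on_line:
  assumes "test_field \<Omega> \<phi>"
  shows "((\<lambda>t. \<phi> (x + t *\<^sub>R d)) has_vector_derivative frechet_derivative \<phi> (at (x + t *\<^sub>R d)) d) (at t)"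
proof -
  have lin: "linear (frechet_derivative \<phi> (at (x + t *\<^sub>R d)))"
    by (rule linear_frechet_derivative[OF test_fieldD(1)[OF assms]])
  have "((\<lambda>t. x + t *\<^sub>R d) has_derivative (\<lambda>s. s *\<^sub>R d)) (at t)" by (auto intro!: derivative_eq_intros)
  from has_derivative_compose[OF this test_field_has_derivative[OF assms]]
  show ?thesis using lin by (simp add: has_vector_derivative_def linear_cmul)
qed

text \<open>Test fields are only C1, so the curl of a gradient cannot be formed classically. The
  symmetry of \<open>I i j k\<close> in \<open>i\<close> and \<open>j\<close> takes its place, and
  the six terms cancel in pairs.\<close>

lemma integral_grad_dot_curl:
  assumes p: "test_field UNIV \<phi>" and q: "test_field UNIV \<psi>"
  shows "ip (grad_dot \<phi> d) (curl \<psi>) = 0"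
proof -
  define S where "S = closure {x. \<phi> x \<noteq> 0} \<union> closure {x. \<psi> x \<noteq> 0}"
  have S: "compact S" unfolding S_def using p q by (auto dest: test_fieldD)
  have S0: "\<phi> x = 0" "\<psi> x = 0" "dd \<phi> i x = 0" "dd \<psi> i x = 0" if "x \<notin> S" for x i
    using that test_field_zero[OF p, of x] test_field_zero[OF q, of x]
      dd_zero_off_support[of x \<phi> i] dd_zero_off_support[of x \<psi> i] unfolding S_def by blast+
  define I where "I i j k = (\<integral>x. (dd \<phi> i x \<bullet> d) * (dd \<psi> j x $ k) \<partial>lborel)" for i j k
  have cont: "continuous_on UNIV (\<lambda>x. dd \<phi> i x \<bullet> d)" "continuous_on UNIV (\<lambda>x. dd \<psi> j x $ k)" for i j k
    by (intro continuous_on_inner continuous_on_const continuous_on_component test_fieldD(2)[OF p] test_fieldD(2)[OF q])+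
  have der1: "((\<lambda>t. \<phi> (x + t *\<^sub>R axis i 1) \<bullet> d) has_real_derivative dd \<phi> i (x + t *\<^sub>R axis i 1) \<bullet> d) (at t)" for x t i
    using bounded_linear.has_vector_derivative[OF bounded_linear_inner_left test_field_derivative_on_line[OF p]]
    by (simp add: dd_def has_real_derivative_iff_has_vector_derivative)
  have der2: "((\<lambda>t. \<psi> (x + t *\<^sub>R axis i 1) $ k) has_real_derivative dd \<psi> i (x + t *\<^sub>R axis i 1) $ k) (at t)" for x t i k
    using bounded_linear.has_vector_derivative[OF bounded_linear_vec_nth test_field_derivative_on_line[OF q]]
    by (simp add: dd_def has_real_derivative_iff_has_vector_derivative)
  have sym: "I i j k = I j i k" for i j k
    unfolding I_def
  proof (rule integral_mixed_derivatives[OF S, where f = "\<lambda>x. \<phi> x \<bullet> d" and g = "\<lambda>x. \<psi> x $ k" and a = "axis i 1" and b = "axis j 1"])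
    show "continuous_on UNIV (\<lambda>x. \<phi> x \<bullet> d)" "continuous_on UNIV (\<lambda>x. \<psi> x $ k)"
      by (intro continuous_on_inner continuous_on_const continuous_on_component
          test_field_continuous[OF p] test_field_continuous[OF q])+
    show "continuous_on UNIV (\<lambda>x. dd \<phi> i x \<bullet> d)" "continuous_on UNIV (\<lambda>x. dd \<phi> j x \<bullet> d)"
      "continuous_on UNIV (\<lambda>x. dd \<psi> i x $ k)" "continuous_on UNIV (\<lambda>x. dd \<psi> j x $ k)"
      by (rule cont)+
  qed (simp_all add: S0 der1 der2)
  have int: "integrable lborel (\<lambda>x. (dd \<phi> i x \<bullet> d) * (dd \<psi> j x $ k))" for i j k
    by (rule integrable_continuous_compact_support[OF continuous_on_mult[OF cont] S])
       (simp add: S0)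
  have "ip (grad_dot \<phi> d) (curl \<psi>)
     = (\<integral>x. (dd \<phi> 1 x \<bullet> d) * (dd \<psi> 2 x $ 3) - (dd \<phi> 1 x \<bullet> d) * (dd \<psi> 3 x $ 2)
       + (dd \<phi> 2 x \<bullet> d) * (dd \<psi> 3 x $ 1) - (dd \<phi> 2 x \<bullet> d) * (dd \<psi> 1 x $ 3)
       + (dd \<phi> 3 x \<bullet> d) * (dd \<psi> 1 x $ 2) - (dd \<phi> 3 x \<bullet> d) * (dd \<psi> 2 x $ 1) \<partial>lborel)"
    by (intro Bochner_Integration.integral_cong refl)
       (simp add: grad_dot_def curl_def pd_eq_dd inner_vec_def[of "vec_lambda _"] sum_3 algebra_simps)
  also have "\<dots> = I 1 2 3 - I 1 3 2 + I 2 3 1 - I 2 1 3 + I 3 1 2 - I 3 2 1"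
    unfolding I_def using int by simp
  also have "\<dots> = 0" using sym[of 1 2 3] sym[of 1 3 2] sym[of 2 3 1] by simp
  finally show ?thesis .
qed

text \<open>The adjoint of the ray operator may shift a test field out of \<open>\<Omega>\<close>,
  hence the formulation on the whole space.\<close>

lemma test_field_translate:
  assumes "test_field UNIV \<phi>"
  shows "test_field UNIV (\<lambda>x. \<phi> (x - s))" "dd (\<lambda>x. \<phi> (x - s)) j x = dd \<phi> j (x - s)"
    "grad_dot (\<lambda>x. \<phi> (x - s)) d x = grad_dot \<phi> d (x - s)"
proof -
  have der: "((\<lambda>x. \<phi> (x - s)) has_derivative frechet_derivative \<phi> (at (x - s))) (at x)" for x
  proof -
    have "((\<lambda>x. x - s) has_derivative (\<lambda>x. x)) (at x)" by (auto intro!: derivative_eq_intros)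
    from has_derivative_compose[OF this test_field_has_derivative[OF assms]] show ?thesis by simp
  qed
  have eq: "frechet_derivative (\<lambda>x. \<phi> (x - s)) (at x) = frechet_derivative \<phi> (at (x - s))" for x
    using frechet_derivative_at[OF der] by simp
  then show dd: "dd (\<lambda>x. \<phi> (x - s)) j x = dd \<phi> j (x - s)" for j x by (simp add: dd_def)
  then show "grad_dot (\<lambda>x. \<phi> (x - s)) d x = grad_dot \<phi> d (x - s)" by (simp add: grad_dot_def)
  have "{x. \<phi> (x - s) \<noteq> 0} = (+) s ` {x. \<phi> x \<noteq> 0}" 
    by (auto simp: image_iff intro!: exI[of _ "_ - s"])
  then have cl: "closure {x. \<phi> (x - s) \<noteq> 0} = (+) s ` closure {x. \<phi> x \<noteq> 0}" by (simp add: closure_translation)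
  show "test_field UNIV (\<lambda>x. \<phi> (x - s))"
    unfolding test_field_def cl dd_def[symmetric] dd
  proof (intro conjI allI)
    show "(\<lambda>x. \<phi> (x - s)) differentiable at x" for x using der differentiable_def by blast
    show "continuous_on UNIV (\<lambda>x. dd \<phi> j (x - s))" for j
      by (intro continuous_on_compose2[OF test_fieldD(2)[OF assms]] continuous_intros) auto
    show "compact ((+) s ` closure {x. \<phi> x \<noteq> 0})" using test_fieldD(3)[OF assms] by (rule compact_translation)
  qed simp
qed

section \<open>Borel representatives and eigenfields\<close>

lemma sq_int_lborelD: "sq_int lborel f \<Longrightarrow> f \<in> borel_measurable borel"
  by (auto dest: sq_intD)

text \<open>Translations and Fubini arguments are carried out for Borel functions and
  \<open>lborel\<close>, whereas the notions of the theorem use Lebesgue measure restricted to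
  \<open>\<Omega>\<close>; this identity passes between the two.\<close>

lemma L2_inner_lborel:
  assumes "open \<Omega>" and [measurable]: "f \<in> borel_measurable borel" "g \<in> borel_measurable borel"
    and "\<And>x. x \<notin> \<Omega> \<Longrightarrow> f x = 0 \<or> g x = 0"
  shows "L2_inner \<Omega> f g = ip f g"
proof -
  have "L2_inner \<Omega> f g = (\<integral>x. indicator \<Omega> x *\<^sub>R (f x \<bullet> g x) \<partial>lebesgue)"
    unfolding L2_inner_def using \<open>open \<Omega>\<close> by (subst integral_restrict_space) auto
  also have "\<dots> = (\<integral>x. f x \<bullet> g x \<partial>lebesgue)"
    by (intro Bochner_Integration.integral_cong) (use assms(4) in \<open>fastforce simp: indicator_def\<close>)+
  also have "\<dots> = ip f g"
    by (rule integral_completion) measurable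
  finally show ?thesis .
qed

lemma sq_int_lebesgue_on:
  assumes "open \<Omega>" "sq_int lborel f"
  shows "sq_int (lebesgue_on \<Omega>) f"
  unfolding sq_int_def
proof
  have [measurable]: "f \<in> borel_measurable borel" using assms(2) by (rule sq_int_lborelD)
  have "f \<in> borel_measurable lebesgue" using measurable_completion[of f lborel borel] by simp
  then show "f \<in> borel_measurable (lebesgue_on \<Omega>)" by (rule measurable_restrict_space1)
  have "integrable lebesgue (\<lambda>x. (norm (f x))\<^sup>2)"
    using sq_intD(2)[OF assms(2)] by (subst integrable_completion) measurable
  then show "integrable (lebesgue_on \<Omega>) (\<lambda>x. (norm (f x))\<^sup>2)"
    using \<open>open \<Omega>\<close> integrable_mult_indicator[of \<Omega> lebesgue "\<lambda>x. (norm (f x))\<^sup>2"]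
    by (subst integrable_restrict_space) auto
qed

text \<open>Each coordinate of a Lebesgue measurable field agrees almost everywhere with a Borel
  function, and the indicator makes the representative vanish everywhere off
  \<open>\<Omega>\<close>. Borel measurability survives composition with maps such as
  \<open>x + t d\<close>.\<close>

lemma borel_representative:
  fixes v :: "vec3 \<Rightarrow> vec3"
  assumes "open \<Omega>" "v \<in> L2 \<Omega>"
  obtains V where "sq_int lborel V" "\<And>x. x \<notin> \<Omega> \<Longrightarrow> V x = 0" "AE x in lebesgue_on \<Omega>. V x = v x"
proof -
  have v: "sq_int (lebesgue_on \<Omega>) v" using assms(2) by (simp add: L2_iff_sq_int)
  define v' where "v' x = indicator \<Omega> x *\<^sub>R v x" for x
  have \<Omega>: "\<Omega> \<in> sets lborel" "\<Omega> \<in> sets lebesgue" using \<open>open \<Omega>\<close> by auto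
  have v'_meas: "v' \<in> borel_measurable lebesgue"
    using sq_intD(1)[OF v] \<Omega> unfolding v'_def by (subst (asm) borel_measurable_restrict_space_iff) auto
  have v'_int: "integrable lebesgue (\<lambda>x. (norm (v' x))\<^sup>2)"
  proof -
    have "integrable lebesgue (\<lambda>x. indicator \<Omega> x *\<^sub>R (norm (v x))\<^sup>2)"
      using sq_intD(2)[OF v] \<Omega> by (subst (asm) integrable_restrict_space) auto
    then show ?thesis
      by (rule Bochner_Integration.integrable_cong[THEN iffD1, rotated -1]) (auto simp: v'_def indicator_def)
  qed
  have "\<forall>i. \<exists>g\<in>borel_measurable lborel. AE x in lborel. v' x $ i = g x"
  proof
    fix i :: 3
    have "(\<lambda>x. v' x $ i) \<in> borel_measurable lebesgue"
      using borel_measurable_inner[OF v'_meas borel_measurable_const[of "axis i 1"]] by (simp add: inner_axis)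
    then show "\<exists>g\<in>borel_measurable lborel. AE x in lborel. v' x $ i = g x"
      by (rule completion_ex_borel_measurable_real)
  qed
  then obtain g where g: "\<And>i. g i \<in> borel_measurable lborel" "\<And>i. AE x in lborel. v' x $ i = g i x"
    by metis
  note [measurable] = g(1)[simplified]
  define V where "V x = indicator \<Omega> x *\<^sub>R (\<Sum>i\<in>UNIV. g i x *\<^sub>R axis i 1 :: vec3)" for x
  have [measurable]: "V \<in> borel_measurable borel" unfolding V_def using \<Omega>(1) by measurable
  have "AE x in lborel. \<forall>i. v' x $ i = g i x" using g(2) by (simp add: AE_all_countable)
  then have eq: "AE x in lborel. V x = v' x"
  proof eventually_elim
    case (elim x)
    then have "V x = indicator \<Omega> x *\<^sub>R (\<Sum>i\<in>UNIV. v' x $ i *\<^sub>R axis i 1)" by (simp add: V_def)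
    also have "(\<Sum>i\<in>UNIV. v' x $ i *\<^sub>R axis i 1) = v' x"
      using basis_expansion[of "v' x"] by (simp add: scalar_mult_eq_scaleR)
    finally show ?case by (simp add: v'_def indicator_def)
  qed
  then have eq': "AE x in lebesgue. V x = v' x" by (rule AE_completion)
  show thesis
  proof
    show "V x = 0" if "x \<notin> \<Omega>" for x using that by (simp add: V_def)
    show "AE x in lebesgue_on \<Omega>. V x = v x"
      using eq' \<Omega>(2) by (subst AE_restrict_space_iff) (auto simp: v'_def elim: eventually_mono)
    have V_meas: "V \<in> borel_measurable lebesgue" using measurable_completion[of V lborel borel] by simp
    have "integrable lebesgue (\<lambda>x. (norm (V x))\<^sup>2)"
      by (rule Bochner_Integration.integrable_cong_AE[THEN iffD1, OF _ _ _ v'_int])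
         (use V_meas v'_meas eq' in \<open>auto elim: eventually_mono\<close>)
    then show "sq_int lborel V"
      unfolding sq_int_def by (subst (asm) integrable_completion) auto
  qed
qed

lemma L2_inner_cong_AE:
  assumes "f \<in> L2 \<Omega>" "f' \<in> L2 \<Omega>" "g \<in> L2 \<Omega>" "AE x in lebesgue_on \<Omega>. f x = f' x"
  shows "L2_inner \<Omega> f g = L2_inner \<Omega> f' g"
proof -
  have [measurable]: "f \<in> borel_measurable (lebesgue_on \<Omega>)" "f' \<in> borel_measurable (lebesgue_on \<Omega>)"
    "g \<in> borel_measurable (lebesgue_on \<Omega>)" using assms by (auto simp: L2_def)
  show ?thesis unfolding L2_inner_def
    by (intro integral_cong_AE) (use assms(4) in \<open>auto elim: eventually_mono\<close>)
qed

lemma Kspace_L2: "v \<in> Kspace \<Omega> \<Longrightarrow> v \<in> L2 \<Omega>"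
  by (simp add: Kspace_def)

lemma Kspace_cong_AE:
  assumes "v \<in> Kspace \<Omega>" "v' \<in> L2 \<Omega>" "AE x in lebesgue_on \<Omega>. v' x = v x"
  shows "v' \<in> Kspace \<Omega>"
  using assms L2_inner_cong_AE[OF assms(2) Kspace_L2[OF assms(1)] _ assms(3)] by (simp add: Kspace_def)

lemma Kspace_scaleR:
  assumes "v \<in> Kspace \<Omega>" shows "(\<lambda>x. c *\<^sub>R v x) \<in> Kspace \<Omega>"
  using assms sq_int_scaleR[of "lebesgue_on \<Omega>" v c]
  by (auto simp: Kspace_def L2_iff_sq_int L2_inner_def)

lemma test_field_L2:
  assumes "open \<Omega>" "test_field \<Omega> \<phi>"
  shows "\<phi> \<in> L2 \<Omega>" "curl \<phi> \<in> L2 \<Omega>"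
  using test_field_sq_int[OF assms(2)] sq_int_lebesgue_on[OF assms(1)] by (auto simp: L2_iff_sq_int)

lemma L2_inner_test_field:
  assumes "open \<Omega>" "test_field \<Omega> \<phi>" "f \<in> borel_measurable borel"
  shows "L2_inner \<Omega> f \<phi> = ip f \<phi>"
    "L2_inner \<Omega> f (curl \<phi>) = ip f (curl \<phi>)"
  using L2_inner_lborel[OF assms(1,3) sq_int_lborelD[OF test_field_sq_int(1)[OF assms(2)]]]
    L2_inner_lborel[OF assms(1,3) sq_int_lborelD[OF test_field_sq_int(2)[OF assms(2)]]]
    test_field_zero[OF assms(2)] curl_zero_off_support[of _ \<phi>] test_fieldD(4)[OF assms(2)]
  by blast+

lemma weak_curl_zero_iff:
  assumes "open \<Omega>" "w \<in> borel_measurable borel"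
  shows "weak_curl \<Omega> w (\<lambda>_. 0) \<longleftrightarrow> (\<forall>\<phi>. test_field \<Omega> \<phi> \<longrightarrow> ip w (curl \<phi>) = 0)"
  using L2_inner_test_field(2)[OF assms(1) _ assms(2)] by (auto simp: weak_curl_def L2_inner_def[of _ "\<lambda>_. 0"])

text \<open>The form in which membership in \<open>K\<close> is exploited: \<open>w\<close> is a
  field on the whole space that may be nonzero outside \<open>\<Omega>\<close>, while its curl is
  tested only inside.\<close>

lemma Kspace_orthogonal:
  assumes "open \<Omega>" "sq_int lborel V" "\<And>x. x \<notin> \<Omega> \<Longrightarrow> V x = 0" "V \<in> Kspace \<Omega>"
    and "sq_int lborel w" "\<And>\<phi>. test_field \<Omega> \<phi> \<Longrightarrow> ip w (curl \<phi>) = 0"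
  shows "ip V w = 0"
proof -
  have "weak_curl \<Omega> w (\<lambda>_. 0)"
    using weak_curl_zero_iff[OF assms(1) sq_int_lborelD[OF assms(5)]] assms(6) by blast
  moreover have "w \<in> L2 \<Omega>" using sq_int_lebesgue_on[OF assms(1,5)] by (simp add: L2_iff_sq_int)
  ultimately have "L2_inner \<Omega> V w = 0" using assms(4) by (auto simp: Kspace_def)
  then show ?thesis
    using L2_inner_lborel[OF assms(1) sq_int_lborelD[OF assms(2)] sq_int_lborelD[OF assms(5)]] assms(3) by auto
qed

text \<open>A normalised Borel representative of an eigenfield, extended by zero to the whole space.\<close>

definition eigenfield :: "vec3 set \<Rightarrow> real \<Rightarrow> (vec3 \<Rightarrow> vec3) \<Rightarrow> bool" where
  "eigenfield \<Omega> \<mu> V \<longleftrightarrow> sq_int lborel V \<and> (\<forall>x. x \<notin> \<Omega> \<longrightarrow> V x = 0) \<and> V \<in> Kspace \<Omega> \<and>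
     normsq lborel V = 1 \<and>
     (\<forall>\<phi>. test_field \<Omega> \<phi> \<longrightarrow> ip V (curl \<phi>) = \<mu> * ip V \<phi>)"

lemma eigenfieldD:
  assumes "eigenfield \<Omega> \<mu> V"
  shows "sq_int lborel V" "\<And>x. x \<notin> \<Omega> \<Longrightarrow> V x = 0" "V \<in> Kspace \<Omega>" "normsq lborel V = 1"
    "\<And>\<phi>. test_field \<Omega> \<phi> \<Longrightarrow> ip V (curl \<phi>) = \<mu> * ip V \<phi>"
  using assms by (auto simp: eigenfield_def)

lemma AE_lebesgue_on_zero_iff:
  assumes "open \<Omega>" "sq_int lborel V" "\<And>x. x \<notin> \<Omega> \<Longrightarrow> V x = 0"
  shows "(AE x in lebesgue_on \<Omega>. V x = 0) \<longleftrightarrow> normsq lborel V = 0"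
proof -
  have "{x. V x = 0} \<in> sets borel" 
    using sq_int_lborelD[OF assms(2)] by (simp add: pred_def[symmetric] borel_measurable_const)
  have "(AE x in lebesgue_on \<Omega>. V x = 0) \<longleftrightarrow> (AE x in lebesgue. V x = 0)"
    using assms(1,3) by (subst AE_restrict_space_iff) (auto elim: eventually_mono intro!: AE_cong)
  also have "\<dots> \<longleftrightarrow> (AE x in lborel. V x = 0)"
    using sq_int_lborelD[OF assms(2)] by (intro AE_completion_iff)
  also have "\<dots> \<longleftrightarrow> normsq lborel V = 0"
    using sq_intD(2)[OF assms(2)] by (subst integral_nonneg_eq_0_iff_AE) auto
  finally show ?thesis .
qed

text \<open>Passing to a Borel representative and dividing by its norm removes the auxiliary field
  \<open>u\<close>, which agrees with \<open>\<mu> v\<close> almost everywhere. Conversely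
  \<open>K\<close> is closed under scalar multiples, so \<open>\<mu> V\<close> can serve as
  \<open>u\<close>.\<close>

lemma curl_eigenvalue_iff:
  assumes "open \<Omega>"
  shows "curl_eigenvalue \<Omega> \<mu> \<longleftrightarrow> (\<exists>V. eigenfield \<Omega> \<mu> V)"
proof
  assume "curl_eigenvalue \<Omega> \<mu>"
  then obtain v u where v: "v \<in> Kspace \<Omega>" "u \<in> Kspace \<Omega>" "weak_curl \<Omega> v u"
    "\<not> (AE x in lebesgue_on \<Omega>. v x = 0)" "AE x in lebesgue_on \<Omega>. u x = \<mu> *\<^sub>R v x"
    unfolding curl_eigenvalue_def by blast
  obtain V where V: "sq_int lborel V" "\<And>x. x \<notin> \<Omega> \<Longrightarrow> V x = 0" "AE x in lebesgue_on \<Omega>. V x = v x"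
    using borel_representative[OF assms Kspace_L2[OF v(1)]] by blast
  have VL: "V \<in> L2 \<Omega>" using sq_int_lebesgue_on[OF assms V(1)] by (simp add: L2_iff_sq_int)
  have VK: "V \<in> Kspace \<Omega>" by (rule Kspace_cong_AE[OF v(1) VL V(3)])
  have eq: "ip V (curl \<phi>) = \<mu> * ip V \<phi>" if \<phi>: "test_field \<Omega> \<phi>" for \<phi>
  proof -
    have "ip V (curl \<phi>) = L2_inner \<Omega> v (curl \<phi>)"
      using L2_inner_test_field(2)[OF assms \<phi> sq_int_lborelD[OF V(1)]]
        L2_inner_cong_AE[OF VL Kspace_L2[OF v(1)] test_field_L2(2)[OF assms \<phi>] V(3)] by simp
    also have "\<dots> = L2_inner \<Omega> u \<phi>" using v(3) \<phi> by (simp add: weak_curl_def)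
    also have "\<dots> = L2_inner \<Omega> (\<lambda>x. \<mu> *\<^sub>R V x) \<phi>"
      by (rule L2_inner_cong_AE[OF Kspace_L2[OF v(2)] Kspace_L2[OF Kspace_scaleR[OF VK]] test_field_L2(1)[OF assms \<phi>]])
         (use v(5) V(3) in \<open>eventually_elim, simp\<close>)
    also have "\<dots> = \<mu> * ip V \<phi>"
      using L2_inner_test_field(1)[OF assms \<phi> sq_int_lborelD[OF V(1)]] by (simp add: L2_inner_def)
    finally show ?thesis .
  qed
  define n where "n = sqrt (normsq lborel V)"
  have "normsq lborel V \<noteq> 0"
  proof
    assume "normsq lborel V = 0"
    then have "AE x in lebesgue_on \<Omega>. V x = 0" using AE_lebesgue_on_zero_iff[OF assms V(1,2)] by blast
    then have "AE x in lebesgue_on \<Omega>. v x = 0" using V(3) by eventually_elim simp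
    then show False using v(4) by contradiction
  qed
  then have n: "n \<noteq> 0" "n\<^sup>2 = normsq lborel V" by (auto simp: n_def)
  have "eigenfield \<Omega> \<mu> (\<lambda>x. (1 / n) *\<^sub>R V x)"
    unfolding eigenfield_def
  proof (intro conjI allI impI)
    show "normsq lborel (\<lambda>x. (1 / n) *\<^sub>R V x) = 1"
      using n(1) by (simp add: power_mult_distrib power_divide n(2)[symmetric])
  qed (use V(2) sq_int_scaleR[OF V(1)] Kspace_scaleR[OF VK] eq in auto)
  then show "\<exists>V. eigenfield \<Omega> \<mu> V" by blast
next
  assume "\<exists>V. eigenfield \<Omega> \<mu> V"
  then obtain V where V: "eigenfield \<Omega> \<mu> V" by blast
  show "curl_eigenvalue \<Omega> \<mu>"
    unfolding curl_eigenvalue_def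
  proof (rule exI[of _ V], rule exI[of _ "\<lambda>x. \<mu> *\<^sub>R V x"], intro conjI)
    show "weak_curl \<Omega> V (\<lambda>x. \<mu> *\<^sub>R V x)"
      unfolding weak_curl_def
      using L2_inner_test_field[OF assms _ sq_int_lborelD[OF eigenfieldD(1)[OF V]]] eigenfieldD(5)[OF V]
      by (auto simp: L2_inner_def)
    show "\<not> (AE x in lebesgue_on \<Omega>. V x = 0)"
      using AE_lebesgue_on_zero_iff[OF assms eigenfieldD(1,2)[OF V]] eigenfieldD(4)[OF V] by simp
  qed (use eigenfieldD(3)[OF V] Kspace_scaleR in auto)
qed

section \<open>The vector potential obtained by averaging over rays\<close>

text \<open>The measure \<open>N\<close> on pairs of a time and a direction is left open, so that
  the same estimates serve for the full operator and for its truncations to a range of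
  times.\<close>

definition vpot :: "(real \<times> vec3) measure \<Rightarrow> (vec3 \<Rightarrow> vec3) \<Rightarrow> vec3 \<Rightarrow> vec3" where
  "vpot N u x = (\<integral>p. cross3 (snd p) (u (x + fst p *\<^sub>R snd p)) \<partial>N)"

lemma sets_borel_pair:
  "sets ((borel :: 'a::second_countable_topology measure) \<Otimes>\<^sub>M (borel :: 'b::second_countable_topology measure)) = sets borel"
  unfolding borel_prod ..

lemma norm_cross3_le: "norm (cross3 a b) \<le> norm a * norm b"
proof (rule power2_le_imp_le)
  show "(norm (cross3 a b))\<^sup>2 \<le> (norm a * norm b)\<^sup>2"
    using norm_cross_dot[of a b] zero_le_power2[of "a \<bullet> b"] by linarith
qed simp

lemma cross3_inner_commute: "cross3 d u \<bullet> c = u \<bullet> cross3 c d"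
  by (simp add: cross3_def inner_vec_def sum_3 algebra_simps)

lemma borel_measurable_cross3 [measurable]:
  assumes "f \<in> borel_measurable M" "g \<in> borel_measurable M"
  shows "(\<lambda>x. cross3 (f x) (g x)) \<in> borel_measurable M"
  by (rule borel_measurable_continuous_Pair[OF assms])
     (intro continuous_on_cross continuous_on_fst continuous_on_snd continuous_on_id)

lemma square_integral_le:
  fixes f :: "'a \<Rightarrow> real"
  assumes "finite_measure M" "sq_int M f"
  shows "(\<integral>x. \<bar>f x\<bar> \<partial>M)\<^sup>2 \<le> measure M (space M) * (\<integral>x. (f x)\<^sup>2 \<partial>M)"
proof -
  have "(\<integral>x. \<bar>f x\<bar> \<partial>M)\<^sup>2 \<le> (sqrt (measure M (space M)) * sqrt (\<integral>x. (f x)\<^sup>2 \<partial>M))\<^sup>2"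
    using integral_norm_le_sqrt[OF assms(2,1)] by (intro power_mono) auto
  then show ?thesis by (simp add: power_mult_distrib)
qed

lemma integrable_of_sq_int_bounded_support:
  fixes u :: "vec3 \<Rightarrow> vec3"
  assumes u: "sq_int lborel u" and u0: "\<And>x. x \<notin> cball 0 R \<Longrightarrow> u x = 0"
  shows "integrable lborel u"
    "norm1 u \<le> measure lborel (cball (0::vec3) R) + normsq lborel u"
proof -
  let ?k = "\<lambda>x::vec3. indicator (cball 0 R) x + (norm (u x))\<^sup>2"
  have ind: "integrable lborel (indicator (cball (0::vec3) R) :: _ \<Rightarrow> real)"
    using emeasure_lborel_cball_finite[of "0::vec3" R] by (intro integrable_real_indicator) auto
  have k: "integrable lborel ?k" using sq_intD(2)[OF u] ind by simp
  have b: "norm (u x) \<le> ?k x" for x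
  proof (cases "x \<in> cball 0 R")
    case True
    have "norm (u x) \<le> 1 + (norm (u x))\<^sup>2"
      using norm_mult_le_squares[of "norm (u x)" 1] norm_ge_zero[of "u x"] zero_le_power2[of "norm (u x)"]
      unfolding mult_1_right one_power2 by argo
    then show ?thesis using True by simp
  qed (simp add: u0)
  show int: "integrable lborel u"
    by (rule Bochner_Integration.integrable_bound[OF k])
       (use order_trans[OF b abs_ge_self] sq_int_lborelD[OF u] in auto)
  have "norm1 u \<le> (\<integral>x. ?k x \<partial>lborel)" by (rule integral_mono[OF integrable_norm[OF int] k b])
  then show "norm1 u \<le> measure lborel (cball (0::vec3) R) + normsq lborel u"
    using ind sq_intD(2)[OF u] by simp
qed

lemma test_field_derivative_bound:
  assumes "test_field \<Omega> \<phi>"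
  obtains M where "M \<ge> 0" "\<And>x d. norm (frechet_derivative \<phi> (at x) d) \<le> M * norm d"
proof -
  have "\<exists>M\<ge>0. \<forall>x. norm (dd \<phi> j x) \<le> M" for j
    using bounded_continuous_compact_support[OF test_fieldD(2,3)[OF assms] dd_zero_off_support] by metis
  then obtain M where M: "\<And>j. M j \<ge> 0" "\<And>j x. norm (dd \<phi> j x) \<le> M j" by metis
  show thesis
  proof
    show "(\<Sum>j\<in>UNIV. M j) \<ge> 0" by (intro sum_nonneg M)
    fix x d
    have "norm (frechet_derivative \<phi> (at x) d) \<le> (\<Sum>j\<in>UNIV. M j * norm d)"
      unfolding frechet_derivative_eq_sum_dd[OF test_fieldD(1)[OF assms]]
    proof (rule sum_norm_le)
      fix j :: 3
      show "norm (d $ j *\<^sub>R dd \<phi> j x) \<le> M j * norm d"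
        using mult_mono[OF component_le_norm_cart[of d j] M(2)[of j x] norm_ge_zero norm_ge_zero] by (simp add: mult.commute)
    qed
    then show "norm (frechet_derivative \<phi> (at x) d) \<le> (\<Sum>j\<in>UNIV. M j) * norm d"
      by (simp add: sum_distrib_right)
  qed
qed

text \<open>Collects what the L2 theory of the operator uses. Its norm will be at most
  \<open>C\<close> times the mass of \<open>N\<close>.\<close>

locale ray_measure = finite_measure N for N :: "(real \<times> vec3) measure" +
  fixes C :: real
  assumes sets_N: "sets N = sets borel" and C: "C \<ge> 0" "AE p in N. norm (snd p) \<le> C"
begin

lemma space_N: "space N = UNIV"
  using sets_eq_imp_space_eq[OF sets_N] by simp

sublocale N: pair_sigma_finite N "lborel :: vec3 measure" ..

lemma sets_pair_N: "sets (N \<Otimes>\<^sub>M (lborel :: vec3 measure)) = sets borel"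
  using sets_pair_measure_cong[OF sets_N sets_lborel] sets_borel_pair by (rule trans)

lemma measurable_pair_N: "f \<in> borel_measurable borel \<Longrightarrow> f \<in> borel_measurable (N \<Otimes>\<^sub>M (lborel :: vec3 measure))"
  using measurable_cong_sets[OF sets_pair_N refl] by blast

lemma measurable_N: "f \<in> borel_measurable borel \<Longrightarrow> f \<in> borel_measurable N"
  using measurable_cong_sets[OF sets_N refl] by blast

lemma measurable_shift:
  "(\<lambda>q::(real \<times> vec3) \<times> vec3. snd q + fst (fst q) *\<^sub>R snd (fst q)) \<in> borel_measurable borel"
  "(\<lambda>q::(real \<times> vec3) \<times> vec3. snd q - fst (fst q) *\<^sub>R snd (fst q)) \<in> borel_measurable borel"
  "(\<lambda>q::(real \<times> vec3) \<times> vec3. snd (fst q)) \<in> borel_measurable borel"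
  "(\<lambda>q::(real \<times> vec3) \<times> vec3. snd q) \<in> borel_measurable borel"
  by (intro borel_measurable_continuous_onI continuous_intros)+

text \<open>Tonelli: a uniform bound on the inner integrals is integrable because \<open>N\<close>
  is finite.\<close>

lemma integrable_pairI:
  fixes f :: "real \<times> vec3 \<Rightarrow> vec3 \<Rightarrow> 'b::{banach, second_countable_topology}"
  assumes f: "case_prod f \<in> borel_measurable borel"
    and AE: "AE p in N. integrable lborel (f p) \<and> (\<integral>x. norm (f p x) \<partial>lborel) \<le> B"
  shows "integrable (N \<Otimes>\<^sub>M lborel) (case_prod f)"
proof (rule N.Fubini_integrable)
  show f': "case_prod f \<in> borel_measurable (N \<Otimes>\<^sub>M lborel)" by (rule measurable_pair_N[OF f])
  show "AE p in N. integrable lborel (\<lambda>y. case (p, y) of (p, y) \<Rightarrow> f p y)"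
    using AE by eventually_elim simp
  have "(\<lambda>p. \<integral>y. norm (f p y) \<partial>lborel) \<in> borel_measurable N"
    by (rule lborel.borel_measurable_lebesgue_integral) (use f' in simp)
  then show "integrable N (\<lambda>p. \<integral>y. norm (case (p, y) of (p, y) \<Rightarrow> f p y) \<partial>lborel)"
    using AE by (intro integrable_const_bound[where B = B]) (auto elim: eventually_mono)
qed

context
  fixes u :: "vec3 \<Rightarrow> vec3"
  assumes u: "sq_int lborel u"
begin

lemma measurable_u_shift: "(\<lambda>(p, x). u (x + fst p *\<^sub>R snd p)) \<in> borel_measurable borel"
  using measurable_compose[OF measurable_shift(1) sq_int_lborelD[OF u]] by (simp add: case_prod_unfold)

lemma measurable_u_shift_N: "(\<lambda>p. u (x + fst p *\<^sub>R snd p)) \<in> borel_measurable N"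
proof (rule measurable_N, rule measurable_compose[OF _ sq_int_lborelD[OF u]])
  show "(\<lambda>p::real \<times> vec3. x + fst p *\<^sub>R snd p) \<in> borel_measurable borel"
    by (intro borel_measurable_continuous_onI continuous_intros)
qed

lemma measurable_snd_N: "snd \<in> borel_measurable N"
  by (intro measurable_N borel_measurable_continuous_onI continuous_intros)

text \<open>By translation invariance the inner integral has the same value for every
  \<open>p\<close>.\<close>

lemma integrable_square_shift:
  "integrable (N \<Otimes>\<^sub>M lborel) (\<lambda>(p, x). (norm (u (x + fst p *\<^sub>R snd p)))\<^sup>2)"
proof (rule integrable_pairI)
  show "(\<lambda>(p, x). (norm (u (x + fst p *\<^sub>R snd p)))\<^sup>2) \<in> borel_measurable borel"
    using measurable_u_shift unfolding case_prod_unfold by measurable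
  have [measurable]: "u \<in> borel_measurable borel" by (rule sq_int_lborelD[OF u])
  have "integrable lborel (\<lambda>x. (norm (u (x + fst p *\<^sub>R snd p)))\<^sup>2)" for p :: "real \<times> vec3"
    using integrable_lborel_translate[OF sq_intD(2)[OF u]] by simp
  moreover have "(\<integral>x. norm ((norm (u (x + fst p *\<^sub>R snd p)))\<^sup>2) \<partial>lborel) = normsq lborel u"
    for p :: "real \<times> vec3"
    using integral_lborel_translate[of "\<lambda>x. (norm (u x))\<^sup>2"] by simp
  ultimately show "AE p in N. integrable lborel (\<lambda>x. (norm (u (x + fst p *\<^sub>R snd p)))\<^sup>2) \<and>
      (\<integral>x. norm ((norm (u (x + fst p *\<^sub>R snd p)))\<^sup>2) \<partial>lborel) \<le> (normsq lborel u)"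
    by simp
qed

lemma integral_square_shift:
  "(\<integral>x. (normsq N (\<lambda>p. u (x + fst p *\<^sub>R snd p))) \<partial>lborel) = measure N UNIV * normsq lborel u"
proof -
  have [measurable]: "u \<in> borel_measurable borel" by (rule sq_int_lborelD[OF u])
  have "(\<integral>x. (normsq N (\<lambda>p. u (x + fst p *\<^sub>R snd p))) \<partial>lborel)
      = (\<integral>p. (normsq lborel (\<lambda>x. u (x + fst p *\<^sub>R snd p))) \<partial>N)"
    by (rule N.Fubini_integral[OF integrable_square_shift])
  also have "\<dots> = (\<integral>p. (normsq lborel u) \<partial>N)"
    using integral_lborel_translate[of "\<lambda>x. (norm (u x))\<^sup>2"] by simp
  finally show ?thesis by (simp add: space_N)
qed

text \<open>Absolute convergence of the integral defining \<open>vpot\<close> is obtained from this,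
  hence only for almost every \<open>x\<close>. Elsewhere \<open>vpot\<close> may take the default
  value 0 of a divergent integral, which is harmless in L2.\<close>

lemma AE_sq_int_shift: "AE x in lborel. sq_int N (\<lambda>p. u (x + fst p *\<^sub>R snd p))"
  using N.AE_integrable_snd[OF integrable_square_shift] measurable_u_shift_N
  by (auto simp: sq_int_def)

text \<open>The length of the integrand is at most \<open>C\<close> times that of the shifted
  \<open>u\<close>; Cauchy-Schwarz against the constant 1 in \<open>p\<close> contributes the mass
  of \<open>N\<close>.\<close>

lemma sq_int_cross3_shift:
  assumes "sq_int N (\<lambda>p. u (x + fst p *\<^sub>R snd p))"
  shows "integrable N (\<lambda>p. cross3 (snd p) (u (x + fst p *\<^sub>R snd p)))"
    "(norm (vpot N u x))\<^sup>2 \<le> C\<^sup>2 * measure N UNIV * normsq N (\<lambda>p. u (x + fst p *\<^sub>R snd p))"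
proof -
  let ?g = "\<lambda>p. norm (u (x + fst p *\<^sub>R snd p))"
  have g: "integrable N ?g" using sq_int_imp_integrable[OF assms finite_measure_axioms] by simp
  have bnd: "AE p in N. norm (cross3 (snd p) (u (x + fst p *\<^sub>R snd p))) \<le> C * ?g p"
    using C(2) by eventually_elim (meson norm_cross3_le order_trans mult_right_mono norm_ge_zero)
  have meas: "(\<lambda>p. cross3 (snd p) (u (x + fst p *\<^sub>R snd p))) \<in> borel_measurable N"
    using measurable_snd_N measurable_u_shift_N by (rule borel_measurable_cross3)
  show int: "integrable N (\<lambda>p. cross3 (snd p) (u (x + fst p *\<^sub>R snd p)))"
    by (rule Bochner_Integration.integrable_bound[OF integrable_mult_right[OF g, of C] meas])
       (use bnd C(1) in \<open>auto elim!: eventually_mono\<close>)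
  have "norm (vpot N u x) \<le> (\<integral>p. norm (cross3 (snd p) (u (x + fst p *\<^sub>R snd p))) \<partial>N)"
    unfolding vpot_def by (rule integral_norm_bound)
  also have "\<dots> \<le> (\<integral>p. C * ?g p \<partial>N)"
    by (rule integral_mono_AE[OF integrable_norm[OF int] integrable_mult_right[OF g] bnd])
  finally have "(norm (vpot N u x))\<^sup>2 \<le> (C * (\<integral>p. ?g p \<partial>N))\<^sup>2"
    using g by (intro power_mono) auto
  also have "\<dots> = C\<^sup>2 * (\<integral>p. \<bar>?g p\<bar> \<partial>N)\<^sup>2" by (simp add: power_mult_distrib)
  also have "\<dots> \<le> C\<^sup>2 * (measure N (space N) * (\<integral>p. (?g p)\<^sup>2 \<partial>N))"
    using assms by (intro mult_left_mono square_integral_le[OF finite_measure_axioms]) (auto simp: sq_int_def)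
  finally show "(norm (vpot N u x))\<^sup>2 \<le> C\<^sup>2 * measure N UNIV * (\<integral>p. (?g p)\<^sup>2 \<partial>N)"
    by (simp add: space_N mult.assoc)
qed

lemma vpot_measurable: "vpot N u \<in> borel_measurable borel"
proof -
  have "(\<lambda>q::vec3 \<times> (real \<times> vec3). cross3 (snd (snd q)) (u (fst q + fst (snd q) *\<^sub>R snd (snd q)))) \<in> borel_measurable borel"
    by (intro borel_measurable_cross3 measurable_compose[OF _ sq_int_lborelD[OF u]]
        borel_measurable_continuous_onI continuous_intros)
  then have "(\<lambda>(x, p). cross3 (snd p) (u (x + fst p *\<^sub>R snd p))) \<in> borel_measurable ((lborel :: vec3 measure) \<Otimes>\<^sub>M N)"
    using measurable_cong_sets[OF trans[OF sets_pair_measure_cong[OF sets_lborel sets_N] sets_borel_pair] refl]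
    unfolding case_prod_unfold by blast
  from borel_measurable_lebesgue_integral[OF this]
  show ?thesis by (simp add: vpot_def[abs_def])
qed

text \<open>When the pointwise bound is integrated over \<open>x\<close>, every shifted copy of
  \<open>u\<close> contributes the same norm; this produces the second factor of the mass.\<close>

lemma sq_int_vpot:
  shows "sq_int lborel (vpot N u)"
    and "normsq lborel (vpot N u) \<le> (C * measure N UNIV)\<^sup>2 * normsq lborel u"
proof -
  let ?b = "\<lambda>x. C\<^sup>2 * measure N UNIV * normsq N (\<lambda>p. u (x + fst p *\<^sub>R snd p))"
  have int: "integrable lborel ?b"
    using N.integrable_snd[OF integrable_square_shift] by simp
  have bnd: "AE x in lborel. (norm (vpot N u x))\<^sup>2 \<le> ?b x"
    using AE_sq_int_shift by eventually_elim (rule sq_int_cross3_shift(2))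
  have int': "integrable lborel (\<lambda>x. (norm (vpot N u x))\<^sup>2)"
    using vpot_measurable bnd by (intro Bochner_Integration.integrable_bound[OF int]) (auto elim!: eventually_mono)
  then show "sq_int lborel (vpot N u)" using vpot_measurable by (simp add: sq_int_def)
  have "normsq lborel (vpot N u) \<le> (\<integral>x. ?b x \<partial>lborel)"
    by (rule integral_mono_AE[OF int' int bnd])
  also have "\<dots> = (C * measure N UNIV)\<^sup>2 * normsq lborel u"
    using integral_square_shift by (simp add: power2_eq_square)
  finally show "normsq lborel (vpot N u) \<le> (C * measure N UNIV)\<^sup>2 * normsq lborel u" .
qed

text \<open>Fubini, the substitution \<open>y = x + t d\<close> and the cyclic symmetry of the
  triple product move shift and cross product from \<open>u\<close> to \<open>f\<close>.\<close>

lemma vpot_adjoint: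
  assumes f: "sq_int lborel f"
  shows "ip (vpot N u) f
       = (\<integral>p. (ip u (\<lambda>y. cross3 (f (y - fst p *\<^sub>R snd p)) (snd p))) \<partial>N)"
proof -
  have [measurable]: "u \<in> borel_measurable borel" "f \<in> borel_measurable borel"
    using u f by (auto dest: sq_int_lborelD)
  let ?h = "\<lambda>p x. cross3 (snd p) (u (x + fst p *\<^sub>R snd p)) \<bullet> f x"
  let ?A = "\<integral>x. (norm (u x))\<^sup>2 \<partial>lborel" and ?B = "\<integral>x. (norm (f x))\<^sup>2 \<partial>lborel"
  have int: "integrable (N \<Otimes>\<^sub>M lborel) (case_prod ?h)"
  proof (rule integrable_pairI)
    have "(\<lambda>q::(real \<times> vec3) \<times> vec3. cross3 (snd (fst q)) (u (snd q + fst (fst q) *\<^sub>R snd (fst q))) \<bullet> f (snd q)) \<in> borel_measurable borel"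
      by (intro borel_measurable_inner borel_measurable_cross3 measurable_compose[OF _ sq_int_lborelD[OF u]]
        measurable_compose[OF _ sq_int_lborelD[OF f]] measurable_shift)
    then show "case_prod ?h \<in> borel_measurable borel" by (simp add: case_prod_unfold)
    show "AE p in N. integrable lborel (?h p) \<and> (\<integral>x. norm (?h p x) \<partial>lborel) \<le> C * (?A + ?B)"
      using C(2)
    proof eventually_elim
      case (elim p)
      let ?k = "\<lambda>x. C * ((norm (u (x + fst p *\<^sub>R snd p)))\<^sup>2 + (norm (f x))\<^sup>2)"
      have ui: "integrable lborel (\<lambda>x. (norm (u (x + fst p *\<^sub>R snd p)))\<^sup>2)"
        using integrable_lborel_translate[OF sq_intD(2)[OF u]] by simp
      have k: "integrable lborel ?k"
        by (intro integrable_mult_right Bochner_Integration.integrable_add ui sq_intD(2)[OF f])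
      have b: "norm (?h p x) \<le> ?k x" for x
      proof -
        let ?a = "norm (u (x + fst p *\<^sub>R snd p))" and ?b = "norm (f x)"
        have "norm (?h p x) \<le> norm (cross3 (snd p) (u (x + fst p *\<^sub>R snd p))) * ?b"
          using Cauchy_Schwarz_ineq2 by simp
        also have "\<dots> \<le> (C * ?a) * ?b"
          by (intro mult_right_mono order_trans[OF norm_cross3_le] elim) auto
        also have "\<dots> = C * (?a * ?b)" by simp
        also have "\<dots> \<le> C * (?a\<^sup>2 + ?b\<^sup>2)"
        proof (rule mult_left_mono[OF _ C(1)])
          show "?a * ?b \<le> ?a\<^sup>2 + ?b\<^sup>2"
            using norm_mult_le_squares[of ?a ?b] zero_le_power2[of ?a] zero_le_power2[of ?b] by argo
        qed
        finally show ?thesis .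
      qed
      have h: "integrable lborel (?h p)"
        by (rule Bochner_Integration.integrable_bound[OF k])
           (use order_trans[OF b abs_ge_self] in \<open>auto simp del: norm_mult\<close>)
      have "(\<integral>x. norm (?h p x) \<partial>lborel) \<le> (\<integral>x. ?k x \<partial>lborel)"
        by (intro integral_mono integrable_norm h k b)
      also have "\<dots> = C * (?A + ?B)"
        using ui sq_intD(2)[OF f] integral_lborel_translate[of "\<lambda>x. (norm (u x))\<^sup>2"] by simp
      finally show ?case using h by simp
    qed
  qed
  have "ip (vpot N u) f = (\<integral>x. (\<integral>p. ?h p x \<partial>N) \<partial>lborel)"
  proof (rule integral_cong_AE)
    show "(\<lambda>x. vpot N u x \<bullet> f x) \<in> borel_measurable lborel" using vpot_measurable by simp
    show "(\<lambda>x. \<integral>p. ?h p x \<partial>N) \<in> borel_measurable lborel" using N.integrable_snd[OF int] by simp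
    show "AE x in lborel. vpot N u x \<bullet> f x = (\<integral>p. ?h p x \<partial>N)"
      using AE_sq_int_shift
    proof eventually_elim
      case (elim x)
      then show ?case unfolding vpot_def
        by (subst integral_inner_left) (use sq_int_cross3_shift(1) in auto)
    qed
  qed
  also have "\<dots> = (\<integral>p. (\<integral>x. ?h p x \<partial>lborel) \<partial>N)" by (rule N.Fubini_integral[OF int])
  also have "\<dots> = (\<integral>p. (ip u (\<lambda>y. cross3 (f (y - fst p *\<^sub>R snd p)) (snd p))) \<partial>N)"
  proof (rule Bochner_Integration.integral_cong[OF refl])
    fix p
    show "(\<integral>x. ?h p x \<partial>lborel) = ip u (\<lambda>y. cross3 (f (y - fst p *\<^sub>R snd p)) (snd p))"
      using integral_lborel_translate[of "\<lambda>y. u y \<bullet> cross3 (f (y - fst p *\<^sub>R snd p)) (snd p)" "fst p *\<^sub>R snd p"]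
      by (simp add: cross3_inner_commute)
  qed
  finally show ?thesis .
qed

text \<open>The gradient part of the adjoint is annihilated by \<open>u\<close> because it is curl-free; the remaining
  directional derivative integrates to \<open>\<phi>\<close> along the rays.\<close>

lemma vpot_weak_curl:
  assumes \<Omega>: "open \<Omega>" "bounded \<Omega>" and u0: "\<And>x. x \<notin> \<Omega> \<Longrightarrow> u x = 0" and uK: "u \<in> Kspace \<Omega>"
    and \<phi>: "test_field \<Omega> \<phi>"
    and FTC: "\<And>y. y \<in> \<Omega> \<Longrightarrow> (\<integral>p. frechet_derivative \<phi> (at (y - fst p *\<^sub>R snd p)) (snd p) \<partial>N) = \<phi> y"
  shows "ip (vpot N u) (curl \<phi>) = ip u \<phi>"
proof -
  note um = sq_int_lborelD[OF u]
  have \<phi>U: "test_field UNIV \<phi>" using test_field_subset[OF \<phi>] by simp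
  define Dp where "Dp p y = frechet_derivative \<phi> (at (y - fst p *\<^sub>R snd p)) (snd p)" for p :: "real \<times> vec3" and y
  have Dp_sum: "Dp p y = (\<Sum>j\<in>UNIV. snd p $ j *\<^sub>R dd \<phi> j (y - fst p *\<^sub>R snd p))" for p y
    unfolding Dp_def by (rule frechet_derivative_eq_sum_dd[OF test_fieldD(1)[OF \<phi>]])
  have dd_meas: "dd \<phi> j \<in> borel_measurable borel" for j
    by (rule borel_measurable_continuous_onI[OF test_fieldD(2)[OF \<phi>]])
  have Dp_meas: "(\<lambda>q. Dp (fst q) (snd q)) \<in> borel_measurable borel"
    unfolding Dp_sum
    by (intro borel_measurable_sum borel_measurable_scaleR measurable_compose[OF _ dd_meas] measurable_shift
        borel_measurable_continuous_onI continuous_intros)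
  obtain M where M: "M \<ge> 0" "\<And>x d. norm (frechet_derivative \<phi> (at x) d) \<le> M * norm d"
    using test_field_derivative_bound[OF \<phi>] by blast
  have Dp_bound: "norm (Dp p y) \<le> M * C" if "norm (snd p) \<le> C" for p y
    using order_trans[OF M(2) mult_left_mono[OF that M(1)]] by (simp add: Dp_def)
  obtain R where R: "\<And>x. x \<in> \<Omega> \<Longrightarrow> norm x \<le> R" using \<Omega>(2) by (auto simp: bounded_iff)
  have "u x = 0" if "x \<notin> cball 0 R" for x using u0[of x] R[of x] that by auto
  \<comment> \<open>On a bounded domain \<open>u\<close> is integrable, so it can be paired with
    \<open>Dp\<close>, for which a sup bound uniform in \<open>p\<close> is at hand.\<close>
  note u1 = integrable_of_sq_int_bounded_support(1)[OF u this]
  have int: "integrable (N \<Otimes>\<^sub>M lborel) (\<lambda>(p, y). u y \<bullet> Dp p y)"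
  proof (rule integrable_pairI)
    have "(\<lambda>q::(real \<times> vec3) \<times> vec3. u (snd q) \<bullet> Dp (fst q) (snd q)) \<in> borel_measurable borel"
      by (intro borel_measurable_inner Dp_meas measurable_compose[OF _ um] measurable_shift)
    then show "(\<lambda>(p, y). u y \<bullet> Dp p y) \<in> borel_measurable borel" by (simp add: case_prod_unfold)
    show "AE p in N. integrable lborel (\<lambda>y. u y \<bullet> Dp p y) \<and> (\<integral>y. norm (u y \<bullet> Dp p y) \<partial>lborel)
        \<le> (\<integral>y. M * C * norm (u y) \<partial>lborel)"
      using C(2)
    proof eventually_elim
      case (elim p)
      have b: "norm (u y \<bullet> Dp p y) \<le> M * C * norm (u y)" for y
        using order_trans[OF Cauchy_Schwarz_ineq2 mult_left_mono[OF Dp_bound[OF elim] norm_ge_zero], of "u y" y]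
        by (simp add: mult.commute)
      have "(\<lambda>y. Dp p y) \<in> borel_measurable borel"
        unfolding Dp_sum by (intro borel_measurable_sum borel_measurable_scaleR measurable_compose[OF _ dd_meas]
           borel_measurable_const borel_measurable_diff measurable_ident_sets[OF refl])
      then have h: "integrable lborel (\<lambda>y. u y \<bullet> Dp p y)"
        using um order_trans[OF b abs_ge_self]
        by (intro Bochner_Integration.integrable_bound[OF integrable_mult_right[OF integrable_norm[OF u1], of "M * C"]]) auto
      then show ?case
        using integral_mono[OF integrable_norm[OF h] integrable_mult_right[OF integrable_norm[OF u1]] b] by blast
    qed
  qed
  have step: "ip u (\<lambda>y. cross3 (curl \<phi> (y - fst p *\<^sub>R snd p)) (snd p)) = ip u (Dp p)" for p
  proof -
    let ?s = "fst p *\<^sub>R snd p"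
    \<comment> \<open>The shifted field is a test field of the whole space. Its gradient part is
      orthogonal to the curls of all test fields of \<open>\<Omega>\<close>, which is what
      membership of \<open>u\<close> in \<open>K\<close> asks for.\<close>
    define \<phi>' where "\<phi>' = (\<lambda>x. \<phi> (x - ?s))"
    have \<phi>': "test_field UNIV \<phi>'" unfolding \<phi>'_def by (rule test_field_translate(1)[OF \<phi>U])
    have gi: "sq_int lborel (grad_dot \<phi>' (snd p))"
      by (rule sq_int_continuous_compact_support[OF continuous_grad_dot[OF \<phi>'] test_fieldD(3)[OF \<phi>'] grad_dot_zero_off_support])
    have "ip u (grad_dot \<phi>' (snd p)) = 0"
    proof (rule Kspace_orthogonal[OF \<Omega>(1) u u0 uK gi])
      fix \<psi> assume "test_field \<Omega> \<psi>"
      then have "test_field UNIV \<psi>" using test_field_subset by blast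
      then show "ip (grad_dot \<phi>' (snd p)) (curl \<psi>) = 0" by (rule integral_grad_dot_curl[OF \<phi>'])
    qed
    moreover have "u y \<bullet> cross3 (curl \<phi> (y - ?s)) (snd p) = u y \<bullet> Dp p y - u y \<bullet> grad_dot \<phi>' (snd p) y" for y
      using curl_cross3[OF test_fieldD(1)[OF \<phi>], of "y - ?s" "snd p"]
      by (simp add: Dp_def \<phi>'_def test_field_translate(3)[OF \<phi>U] inner_diff_right)
    moreover have "Dp p = (\<lambda>y. cross3 (curl \<phi> (y - ?s)) (snd p) + grad_dot \<phi>' (snd p) y)"
      using curl_cross3[OF test_fieldD(1)[OF \<phi>], of _ "snd p"]
      by (simp add: fun_eq_iff Dp_def \<phi>'_def test_field_translate(3)[OF \<phi>U])
    moreover have "sq_int lborel (Dp p)"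
    proof -
      have "frechet_derivative \<phi>' (at y) (snd p) = Dp p y" for y
        unfolding frechet_derivative_eq_sum_dd[OF test_fieldD(1)[OF \<phi>']] Dp_sum
        by (simp add: \<phi>'_def test_field_translate(2)[OF \<phi>U])
      then have eq: "Dp p = (\<lambda>y. frechet_derivative \<phi>' (at y) (snd p))" by simp
      show ?thesis
        unfolding eq
      proof (rule sq_int_continuous_compact_support[OF _ test_fieldD(3)[OF \<phi>']])
        show "continuous_on UNIV (\<lambda>y. frechet_derivative \<phi>' (at y) (snd p))"
          unfolding frechet_derivative_eq_sum_dd[OF test_fieldD(1)[OF \<phi>']]
          by (intro continuous_on_sum continuous_on_scaleR continuous_on_const test_fieldD(2)[OF \<phi>'])
        show "frechet_derivative \<phi>' (at y) (snd p) = 0" if "y \<notin> closure {x. \<phi>' x \<noteq> 0}" for y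
          using frechet_derivative_zero_off_support[OF that] by simp
      qed
    qed
    ultimately show ?thesis
      using sq_int_inner_integrable[OF u gi] sq_int_inner_integrable[OF u, of "Dp p"] by simp
  qed
  have "ip (vpot N u) (curl \<phi>) = (\<integral>p. (ip u (Dp p)) \<partial>N)"
    unfolding vpot_adjoint[OF test_field_sq_int(2)[OF \<phi>]] step ..
  also have "\<dots> = (\<integral>y. (\<integral>p. u y \<bullet> Dp p y \<partial>N) \<partial>lborel)" by (rule N.Fubini_integral[OF int, symmetric])
  also have "\<dots> = ip u \<phi>"
  proof (rule Bochner_Integration.integral_cong[OF refl])
    fix y
    have "integrable N (\<lambda>p. Dp p y)"
    proof (rule integrable_const_bound[where B = "M * C"])
      show "AE p in N. norm (Dp p y) \<le> M * C" using C(2) by eventually_elim (rule Dp_bound)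
      show "(\<lambda>p. Dp p y) \<in> borel_measurable N"
        unfolding Dp_sum
        by (intro measurable_N borel_measurable_sum borel_measurable_scaleR measurable_compose[OF _ dd_meas]
            borel_measurable_continuous_onI continuous_intros)
    qed
    then have "(\<integral>p. u y \<bullet> Dp p y \<partial>N) = u y \<bullet> (\<integral>p. Dp p y \<partial>N)" by (rule integral_inner_right)
    then show "(\<integral>p. u y \<bullet> Dp p y \<partial>N) = u y \<bullet> \<phi> y"
      \<comment> \<open>Off \<open>\<Omega>\<close> the ray formula is not assumed, but there
        \<open>u\<close> vanishes.\<close>
      using FTC[of y] u0[of y] by (cases "y \<in> \<Omega>") (auto simp: Dp_def)
  qed
  finally show ?thesis .
qed

end

end

text \<open>Every direction \<open>d\<close> with \<open>bump e d \<noteq> 0\<close> satisfies \<open>d \<bullet> e \<ge> 1\<close>, so its ray leaves a slab of width \<open>h\<close>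
  with normal \<open>e\<close> by time \<open>h\<close>.\<close>

definition bump :: "vec3 \<Rightarrow> vec3 \<Rightarrow> real" where
  "bump e d = max 0 (1 - norm (d - 2 *\<^sub>R e))"

definition bump_mass :: "vec3 \<Rightarrow> real" where
  "bump_mass e = (\<integral>d. bump e d \<partial>lborel)"

text \<open>Dividing by \<open>bump_mass\<close> makes the directional part a probability density,
  so the mass of \<open>rays e a b\<close> is the elapsed time \<open>b - a\<close>. Half-open
  intervals make the weight exactly additive in the time range.\<close>

definition ray_weight :: "vec3 \<Rightarrow> real \<Rightarrow> real \<Rightarrow> real \<times> vec3 \<Rightarrow> real" where
  "ray_weight e a b p = indicator {a<..b} (fst p) * (bump e (snd p) / bump_mass e)"

definition rays :: "vec3 \<Rightarrow> real \<Rightarrow> real \<Rightarrow> (real \<times> vec3) measure" where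
  "rays e a b = density lborel (\<lambda>p. ennreal (ray_weight e a b p))"

lemma bump_nonneg: "0 \<le> bump e d"
  by (simp add: bump_def)

lemma bump_le_1: "bump e d \<le> 1"
  by (simp add: bump_def)

lemma continuous_bump: "continuous_on UNIV (bump e)"
  unfolding bump_def[abs_def] by (intro continuous_intros)

lemma measurable_bump [measurable]: "bump e \<in> borel_measurable borel"
  by (rule borel_measurable_continuous_onI[OF continuous_bump])

text \<open>The weight lives on the unit ball around \<open>2 e\<close>: lengths are at most 2 + 1,
  components along \<open>e\<close> at least 2 - 1.\<close>

lemma bump_support:
  assumes "norm e = 1" "bump e d \<noteq> 0"
  shows "norm d \<le> 3" "d \<bullet> e \<ge> 1"
proof -
  have d: "norm (d - 2 *\<^sub>R e) \<le> 1" using assms(2) by (auto simp: bump_def max_def split: if_splits)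
  show "norm d \<le> 3" using norm_triangle_ineq[of "d - 2 *\<^sub>R e" "2 *\<^sub>R e"] d assms(1) by simp
  have "\<bar>(d - 2 *\<^sub>R e) \<bullet> e\<bar> \<le> 1" using Cauchy_Schwarz_ineq2[of "d - 2 *\<^sub>R e" e] d assms(1) by simp
  moreover have "(d - 2 *\<^sub>R e) \<bullet> e = d \<bullet> e - 2"
    using assms(1) by (simp add: inner_diff_left power2_norm_eq_inner[symmetric])
  ultimately show "d \<bullet> e \<ge> 1" by simp
qed

lemma bump_support_cball: "d \<notin> cball (2 *\<^sub>R e) 1 \<Longrightarrow> bump e d = 0"
  by (simp add: bump_def dist_norm norm_minus_commute)

text \<open>The purpose of the tent profile: Lipschitz continuity of the weight is what gives the
  averaged field its regularity in \<open>x\<close>.\<close>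

lemma bump_lipschitz: "\<bar>bump e d - bump e d'\<bar> \<le> norm (d - d')"
  using norm_triangle_ineq3[of "d - 2 *\<^sub>R e" "d' - 2 *\<^sub>R e"]
  by (simp add: bump_def max_def) arith

lemma bump_integrable: "integrable lborel (bump e)"
  by (rule integrable_continuous_compact_support[OF continuous_bump compact_cball bump_support_cball])

lemma bump_mass_pos: "bump_mass e > 0"
proof -
  \<comment> \<open>On the concentric ball of radius 1/2 the tent is at least 1/2.\<close>
  have "0 < (\<integral>d. indicator (ball (2 *\<^sub>R e) (1/2)) d * (1/2) \<partial>lborel :: real)"
    using content_ball_pos[of "1/2" "2 *\<^sub>R e"] by simp
  also have "\<dots> \<le> (\<integral>d. bump e d \<partial>lborel)"
  proof (rule integral_mono[OF _ bump_integrable])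
    show "integrable lborel (\<lambda>d. indicator (ball (2 *\<^sub>R e) (1/2)) d * (1/2) :: real)"
      using emeasure_lborel_ball_finite[of "2 *\<^sub>R e" "1/2"] by (intro integrable_mult_left integrable_real_indicator) auto
    show "indicator (ball (2 *\<^sub>R e) (1/2)) d * (1/2) \<le> bump e d" for d
      by (auto simp: indicator_def bump_def dist_norm norm_minus_commute)
  qed
  finally show ?thesis by (simp add: bump_mass_def)
qed

lemma measurable_ray_weight [measurable]: "ray_weight e a b \<in> borel_measurable borel"
proof -
  have [measurable]: "fst \<in> borel_measurable (borel :: (real \<times> vec3) measure)"
    "snd \<in> borel_measurable (borel :: (real \<times> vec3) measure)"
    by (intro borel_measurable_continuous_onI continuous_intros)+
  show ?thesis unfolding ray_weight_def[abs_def] by measurable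
qed

lemma ray_weight_nonneg: "0 \<le> ray_weight e a b p"
  using bump_mass_pos[of e] by (simp add: ray_weight_def bump_nonneg)

lemma ray_weight_split: "a \<le> b \<Longrightarrow> b \<le> c \<Longrightarrow> ray_weight e a c p = ray_weight e a b p + ray_weight e b c p"
  by (auto simp: ray_weight_def indicator_def)

lemma emeasure_rays:
  assumes "a \<le> b"
  shows "emeasure (rays e a b) UNIV = ennreal (b - a)"
proof -
  have [measurable]: "ray_weight e a b \<in> borel_measurable (lborel \<Otimes>\<^sub>M lborel)"
    by (simp add: lborel_prod)
  have "emeasure (rays e a b) UNIV = (\<integral>\<^sup>+p. ennreal (ray_weight e a b p) \<partial>(lborel \<Otimes>\<^sub>M lborel))"
    unfolding lborel_prod rays_def by (subst emeasure_density) auto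
  also have "\<dots> = (\<integral>\<^sup>+t. \<integral>\<^sup>+d. ennreal (ray_weight e a b (t, d)) \<partial>lborel \<partial>lborel)"
    by (rule lborel.nn_integral_fst[symmetric]) measurable
  also have "\<dots> = (\<integral>\<^sup>+t. indicator {a<..b} t * (\<integral>\<^sup>+d. ennreal (bump e d / bump_mass e) \<partial>lborel) \<partial>lborel)"
    using bump_mass_pos[of e] bump_nonneg
    by (intro nn_integral_cong, subst nn_integral_cmult[symmetric])
       (auto simp: ray_weight_def indicator_def intro!: nn_integral_cong)
  also have "(\<integral>\<^sup>+d. ennreal (bump e d / bump_mass e) \<partial>lborel) = 1"
    using bump_integrable[of e] bump_mass_pos[of e] bump_nonneg
    by (subst nn_integral_eq_integral) (auto simp: bump_mass_def[symmetric])
  finally show ?thesis using assms by simp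
qed

lemma rays_ray_measure:
  assumes "a \<le> b" "norm e = 1"
  shows "ray_measure (rays e a b) 3"
proof (intro ray_measure.intro ray_measure_axioms.intro finite_measureI)
  have sp: "space (rays e a b) = UNIV" by (simp add: rays_def)
  show "emeasure (rays e a b) (space (rays e a b)) \<noteq> \<infinity>"
    unfolding sp emeasure_rays[OF assms(1)] by simp
  show "sets (rays e a b) = sets borel" by (simp add: rays_def)
  have "norm (snd p) \<le> 3" if "0 < ray_weight e a b p" for p
    using bump_support(1)[OF assms(2), of "snd p"] that by (cases "bump e (snd p) = 0") (auto simp: ray_weight_def)
  then show "AE p in rays e a b. norm (snd p) \<le> 3"
    unfolding rays_def by (subst AE_density) auto
qed simp

lemma measure_rays: "a \<le> b \<Longrightarrow> measure (rays e a b) UNIV = b - a"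
  by (simp add: measure_def emeasure_rays)

lemma integral_rays:
  fixes g :: "real \<times> vec3 \<Rightarrow> 'b::{banach, second_countable_topology}"
  assumes "g \<in> borel_measurable borel"
  shows "integrable (rays e a b) g \<longleftrightarrow> integrable lborel (\<lambda>p. ray_weight e a b p *\<^sub>R g p)"
    "(\<integral>p. g p \<partial>rays e a b) = (\<integral>p. ray_weight e a b p *\<^sub>R g p \<partial>lborel)"
  unfolding rays_def using assms ray_weight_nonneg
  by (subst integrable_density integral_density; simp)+

text \<open>Along each ray traced backwards from \<open>y\<close> the fundamental theorem of
  calculus gives \<open>\<phi> y - \<phi> (y - h d)\<close>. The second term vanishes because the
  ray has left the slab by time \<open>h\<close>, and averaging over the probability density of
  directions leaves \<open>\<phi> y\<close>.\<close>

lemma integral_rays_derivative: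
  assumes e: "norm e = 1" and h: "0 < h" and slab: "\<Omega> \<subseteq> {x. \<alpha> < x \<bullet> e \<and> x \<bullet> e < \<alpha> + h}"
    and \<phi>: "test_field \<Omega> \<phi>" and y: "y \<in> \<Omega>"
  shows "(\<integral>p. frechet_derivative \<phi> (at (y - fst p *\<^sub>R snd p)) (snd p) \<partial>rays e 0 h) = \<phi> y"
proof -
  interpret ray_measure "rays e 0 h" 3 using rays_ray_measure[of 0 h e] h e by simp
  obtain M where M: "M \<ge> 0" "\<And>x d. norm (frechet_derivative \<phi> (at x) d) \<le> M * norm d"
    using test_field_derivative_bound[OF \<phi>] by blast
  let ?g = "\<lambda>p. frechet_derivative \<phi> (at (y - fst p *\<^sub>R snd p)) (snd p)"
  have g: "?g \<in> borel_measurable borel"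
    unfolding frechet_derivative_eq_sum_dd[OF test_fieldD(1)[OF \<phi>]]
    by (intro borel_measurable_sum borel_measurable_scaleR
        measurable_compose[OF _ borel_measurable_continuous_onI[OF test_fieldD(2)[OF \<phi>]]]
        borel_measurable_continuous_onI continuous_intros)
  have "integrable (rays e 0 h) ?g"
  proof (rule integrable_const_bound[where B = "M * 3", OF _ measurable_N[OF g]])
    show "AE p in rays e 0 h. norm (?g p) \<le> M * 3"
      using C(2) by eventually_elim (rule order_trans[OF M(2) mult_left_mono[OF _ M(1)]])
  qed
  then have int: "integrable (lborel \<Otimes>\<^sub>M lborel) (\<lambda>(t, d). ray_weight e 0 h (t, d) *\<^sub>R ?g (t, d))"
    using integral_rays(1)[OF g] by (simp add: lborel_prod case_prod_unfold)
  have "(\<integral>p. ?g p \<partial>rays e 0 h) = (\<integral>d. (\<integral>t. ray_weight e 0 h (t, d) *\<^sub>R ?g (t, d) \<partial>lborel) \<partial>lborel)"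
    using lborel_pair.integral_snd[OF int] integral_rays(2)[OF g]
    by (simp add: lborel_prod case_prod_unfold)
  also have "\<dots> = (\<integral>d. (bump e d / bump_mass e) *\<^sub>R \<phi> y \<partial>lborel)"
  proof (rule Bochner_Integration.integral_cong[OF refl])
    fix d
    let ?F = "\<lambda>t. - \<phi> (y - t *\<^sub>R d)"
    have der: "((\<lambda>t. \<phi> (y + t *\<^sub>R (- d))) has_vector_derivative frechet_derivative \<phi> (at (y + t *\<^sub>R (- d))) (- d)) (at t)" for t
      by (rule test_field_derivative_on_line[OF \<phi>])
    have neg: "frechet_derivative \<phi> (at x) (- d) = - frechet_derivative \<phi> (at x) d" for x
      using linear_frechet_derivative[OF test_fieldD(1)[OF \<phi>]] by (simp add: linear_neg)
    have F: "(?F has_vector_derivative frechet_derivative \<phi> (at (y - t *\<^sub>R d)) d) (at t within {0..h})" for t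
      using has_vector_derivative_at_within[OF has_vector_derivative_minus[OF der]] by (simp add: neg)
    have cont: "continuous_on {0..h} (\<lambda>t. frechet_derivative \<phi> (at (y - t *\<^sub>R d)) d)"
      unfolding frechet_derivative_eq_sum_dd[OF test_fieldD(1)[OF \<phi>]]
      by (intro continuous_on_sum continuous_on_scaleR continuous_on_const
          continuous_on_compose2[OF test_fieldD(2)[OF \<phi>]] continuous_intros) auto
    have FTC: "(\<integral>t. indicator {0..h} t *\<^sub>R frechet_derivative \<phi> (at (y - t *\<^sub>R d)) d \<partial>lborel) = ?F h - ?F 0"
      using h by (intro integral_FTC_Icc F cont) auto
    have "(\<integral>t. ray_weight e 0 h (t, d) *\<^sub>R ?g (t, d) \<partial>lborel)
        = (\<integral>t. (bump e d / bump_mass e) *\<^sub>R (indicator {0<..h} t *\<^sub>R frechet_derivative \<phi> (at (y - t *\<^sub>R d)) d) \<partial>lborel)"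
      by (intro Bochner_Integration.integral_cong refl) (simp add: ray_weight_def mult.commute)
    also have "\<dots> = (bump e d / bump_mass e) *\<^sub>R (\<integral>t. indicator {0<..h} t *\<^sub>R frechet_derivative \<phi> (at (y - t *\<^sub>R d)) d \<partial>lborel)"
      by (rule integral_scaleR_right)
    \<comment> \<open>The weight lives on a half-open interval, the fundamental theorem on a closed
      one; they differ by a null set.\<close>
    also have "(\<integral>t. indicator {0<..h} t *\<^sub>R frechet_derivative \<phi> (at (y - t *\<^sub>R d)) d \<partial>lborel)
        = (\<integral>t. indicator {0..h} t *\<^sub>R frechet_derivative \<phi> (at (y - t *\<^sub>R d)) d \<partial>lborel)"
    proof (rule integral_cong_AE)
      have [measurable]: "(\<lambda>t. frechet_derivative \<phi> (at (y - t *\<^sub>R d)) d) \<in> borel_measurable borel"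
        unfolding frechet_derivative_eq_sum_dd[OF test_fieldD(1)[OF \<phi>]]
        by (intro borel_measurable_sum borel_measurable_scaleR
        measurable_compose[OF _ borel_measurable_continuous_onI[OF test_fieldD(2)[OF \<phi>]]]
        borel_measurable_continuous_onI continuous_intros)
      show "(\<lambda>t. indicator {0<..h} t *\<^sub>R frechet_derivative \<phi> (at (y - t *\<^sub>R d)) d) \<in> borel_measurable lborel"
        "(\<lambda>t. indicator {0..h} t *\<^sub>R frechet_derivative \<phi> (at (y - t *\<^sub>R d)) d) \<in> borel_measurable lborel"
        by measurable
      show "AE t in lborel. indicator {0<..h} t *\<^sub>R frechet_derivative \<phi> (at (y - t *\<^sub>R d)) d
          = indicator {0..h} t *\<^sub>R frechet_derivative \<phi> (at (y - t *\<^sub>R d)) d"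
        using AE_lborel_singleton[of 0] by eventually_elim (auto simp: indicator_def)
    qed
    also have "(bump e d / bump_mass e) *\<^sub>R \<dots> = (bump e d / bump_mass e) *\<^sub>R \<phi> y"
    proof (cases "bump e d = 0")
      case False
      \<comment> \<open>Moving back by \<open>h d\<close> lowers the component along
        \<open>e\<close> by at least \<open>h\<close>, the width of the open slab.\<close>
      have "y - h *\<^sub>R d \<notin> \<Omega>"
      proof
        assume "y - h *\<^sub>R d \<in> \<Omega>"
        then have "\<alpha> < y \<bullet> e - h * (d \<bullet> e)" using slab by (auto simp: inner_diff_left)
        moreover have "h * (d \<bullet> e) \<ge> h" using bump_support(2)[OF e False] h by simp
        ultimately show False using slab y by auto
      qed
      then have "\<phi> (y - h *\<^sub>R d) = 0" using test_field_zero[OF \<phi>] test_fieldD(4)[OF \<phi>] by blast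
      then show ?thesis unfolding FTC by simp
    qed simp
    finally show "(\<integral>t. ray_weight e 0 h (t, d) *\<^sub>R ?g (t, d) \<partial>lborel) = (bump e d / bump_mass e) *\<^sub>R \<phi> y" .
  qed
  also have "\<dots> = \<phi> y"
    using bump_integrable[of e] bump_mass_pos[of e] by (simp add: bump_mass_def[symmetric])
  finally show ?thesis .
qed

section \<open>Affine changes of variables\<close>

lemma integral_lborel_affine:
  fixes f :: "'a::euclidean_space \<Rightarrow> 'b::{banach, second_countable_topology}"
  assumes [measurable]: "f \<in> borel_measurable borel" and "c \<noteq> 0"
  shows "(\<integral>x. f x \<partial>lborel) = \<bar>c\<bar> ^ DIM('a) *\<^sub>R (\<integral>x. f (t + c *\<^sub>R x) \<partial>lborel)"
proof -
  have "(\<integral>x. f x \<partial>lborel) = (\<integral>x. f x \<partial>density (distr lborel borel (\<lambda>x. t + c *\<^sub>R x)) (\<lambda>_. ennreal (\<bar>c\<bar> ^ DIM('a))))"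
    using lborel_affine[OF assms(2), of t] by (simp add: ennreal_power[symmetric])
  also have "\<dots> = (\<integral>x. \<bar>c\<bar> ^ DIM('a) *\<^sub>R f x \<partial>distr lborel borel (\<lambda>x. t + c *\<^sub>R x))"
    by (rule integral_density) auto
  also have "\<dots> = (\<integral>x. \<bar>c\<bar> ^ DIM('a) *\<^sub>R f (t + c *\<^sub>R x) \<partial>lborel)"
    by (rule integral_distr) measurable
  finally show ?thesis by simp
qed

lemma integrable_lborel_affine:
  fixes f :: "'a::euclidean_space \<Rightarrow> 'b::{banach, second_countable_topology}"
  assumes "integrable lborel f" and "c \<noteq> 0"
  shows "integrable lborel (\<lambda>x. f (t + c *\<^sub>R x))"
proof -
  have [measurable]: "f \<in> borel_measurable borel" using assms(1) by auto
  have "integrable (density (distr lborel borel (\<lambda>x. t + c *\<^sub>R x)) (\<lambda>_. ennreal (\<bar>c\<bar> ^ DIM('a)))) f"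
    using lborel_affine[OF assms(2), of t] assms(1) by (simp add: ennreal_power[symmetric])
  then have "integrable (distr lborel borel (\<lambda>x. t + c *\<^sub>R x)) (\<lambda>x. \<bar>c\<bar> ^ DIM('a) *\<^sub>R f x)"
    by (subst (asm) integrable_density) auto
  then have "integrable (distr lborel borel (\<lambda>x. t + c *\<^sub>R x)) f"
    using assms(2) integrable_scaleR_right[of "inverse (\<bar>c\<bar> ^ DIM('a))" _ "\<lambda>x. \<bar>c\<bar> ^ DIM('a) *\<^sub>R f x"] by simp
  then show ?thesis by (subst (asm) integrable_distr_eq) measurable
qed

section \<open>Compactness of the vector potential\<close>

text \<open>The direction times its weight: the vector kernel that appears once the ray average is
  written as a convolution.\<close>

definition bump_field :: "vec3 \<Rightarrow> vec3 \<Rightarrow> vec3" where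
  "bump_field e z = bump e z *\<^sub>R z"

lemma norm_bump_field: "norm e = 1 \<Longrightarrow> norm (bump_field e z) \<le> 3"
  using bump_support(1)[of e z] mult_mono[OF bump_le_1[of e z], of "norm z" 3] bump_nonneg[of e z]
  by (cases "bump e z = 0") (auto simp: bump_field_def)

lemma cross_bump_field: "cross3 (bump_field e z) w = bump e z *\<^sub>R cross3 z w"
  by (simp add: bump_field_def cross_mult_left)

lemma integrable_indicator_Ioc: "integrable lborel (\<lambda>t::real. indicator {a<..b} t * (c::real))"
  by (cases "a \<le> b") (auto intro!: integrable_mult_left integrable_real_indicator)

text \<open>The constant is 1 + 3: the bound 1 on \<open>bump\<close> for the change of the vector,
  plus Lipschitz constant 1 times the length 3 of vectors with nonzero weight. The length bound
  requires a nonzero weight at \<open>z'\<close>, hence the case distinction and the exchange of the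
  two points.\<close>

lemma bump_field_lipschitz:
  assumes "norm e = 1"
  shows "norm (bump_field e z - bump_field e z') \<le> 4 * norm (z - z')"
proof -
  have aux: "norm (bump_field e z - bump_field e z') \<le> 4 * norm (z - z')" if z': "bump e z' \<noteq> 0" for z z'
  proof -
    have "bump_field e z - bump_field e z' = bump e z *\<^sub>R (z - z') + (bump e z - bump e z') *\<^sub>R z'"
      by (simp add: bump_field_def algebra_simps)
    then have "norm (bump_field e z - bump_field e z') \<le> bump e z * norm (z - z') + \<bar>bump e z - bump e z'\<bar> * norm z'"
      using norm_triangle_ineq[of "bump e z *\<^sub>R (z - z')" "(bump e z - bump e z') *\<^sub>R z'"] bump_nonneg[of e z] by simp
    also have "\<dots> \<le> 1 * norm (z - z') + norm (z - z') * 3"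
      using bump_le_1 bump_lipschitz bump_support(1)[OF assms z'] by (intro add_mono mult_mono) auto
    finally show ?thesis by simp
  qed
  show ?thesis
  proof (cases "bump e z' = 0")
    case True
    then show ?thesis
      using aux[of z z'] by (cases "bump e z = 0") (use aux[of z z'] in \<open>auto simp: bump_field_def norm_minus_commute\<close>)
  qed (rule aux)
qed

context
  fixes e :: vec3 and u :: "vec3 \<Rightarrow> vec3"
  assumes e: "norm e = 1" and u: "integrable lborel u"
begin

text \<open>The contribution of a single time to the potential, before normalisation. For
  \<open>t > 0\<close> it is controlled by the L1 norm of \<open>u\<close> alone, at the price of
  powers of \<open>1 / t\<close>.\<close>

definition ray_average :: "real \<Rightarrow> vec3 \<Rightarrow> vec3" where
  "ray_average t x = (\<integral>d. bump e d *\<^sub>R cross3 d (u (x + t *\<^sub>R d)) \<partial>lborel)"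

lemma u_measurable: "u \<in> borel_measurable borel"
  using u by auto

lemma integral_norm_u_scaled:
  assumes "t > 0"
  shows "integrable lborel (\<lambda>d. norm (u (x + t *\<^sub>R d)))"
    "(\<integral>d. norm (u (x + t *\<^sub>R d)) \<partial>lborel) = norm1 u / t ^ 3"
proof -
  show "integrable lborel (\<lambda>d. norm (u (x + t *\<^sub>R d)))"
    using integrable_lborel_affine[OF integrable_norm[OF u], of t x] assms by simp
  have "(\<lambda>y. norm (u y)) \<in> borel_measurable borel" using u_measurable by simp
  from integral_lborel_affine[OF this, of t x] assms
  show "(\<integral>d. norm (u (x + t *\<^sub>R d)) \<partial>lborel) = norm1 u / t ^ 3" by simp
qed

lemma ray_average_integrand_measurable:
  "(\<lambda>d. bump e d *\<^sub>R cross3 d (u (x + t *\<^sub>R d))) \<in> borel_measurable borel"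
  by (intro borel_measurable_scaleR measurable_bump borel_measurable_cross3 measurable_compose[OF _ u_measurable]
      borel_measurable_continuous_onI continuous_intros)

lemma norm_ray_average_integrand: "norm (bump e d *\<^sub>R cross3 d v) \<le> 3 * norm v"
proof (cases "bump e d = 0")
  case False
  have "norm (bump e d *\<^sub>R cross3 d v) \<le> bump e d * (norm d * norm v)"
    using mult_left_mono[OF norm_cross3_le bump_nonneg] bump_nonneg[of e d] by simp
  also have "\<dots> \<le> 1 * (3 * norm v)"
    by (intro mult_mono bump_le_1 bump_support(1)[OF e False]) (auto simp: bump_nonneg)
  finally show ?thesis by simp
qed simp

lemma ray_average_integrable:
  assumes "t > 0"
  shows "integrable lborel (\<lambda>d. bump e d *\<^sub>R cross3 d (u (x + t *\<^sub>R d)))"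
    "(\<integral>d. norm (bump e d *\<^sub>R cross3 d (u (x + t *\<^sub>R d))) \<partial>lborel) \<le> 3 * norm1 u / t ^ 3"
proof -
  note i = integral_norm_u_scaled(1)[OF assms, of x]
  show int: "integrable lborel (\<lambda>d. bump e d *\<^sub>R cross3 d (u (x + t *\<^sub>R d)))"
    by (rule Bochner_Integration.integrable_bound[OF integrable_mult_right[OF i, of 3]])
       (use ray_average_integrand_measurable order_trans[OF norm_ray_average_integrand abs_ge_self] in \<open>auto simp del: norm_scaleR\<close>)
  have "(\<integral>d. norm (bump e d *\<^sub>R cross3 d (u (x + t *\<^sub>R d))) \<partial>lborel) \<le> (\<integral>d. 3 * norm (u (x + t *\<^sub>R d)) \<partial>lborel)"
    by (rule integral_mono[OF integrable_norm[OF int] integrable_mult_right[OF i] norm_ray_average_integrand])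
  then show "(\<integral>d. norm (bump e d *\<^sub>R cross3 d (u (x + t *\<^sub>R d))) \<partial>lborel) \<le> 3 * norm1 u / t ^ 3"
    using integral_norm_u_scaled(2)[OF assms, of x] by simp
qed

lemma norm_ray_average:
  assumes "t > 0"
  shows "norm (ray_average t x) \<le> 3 * norm1 u / t ^ 3"
  unfolding ray_average_def by (rule order_trans[OF integral_norm_bound ray_average_integrable(2)[OF assms]])

text \<open>Substituting \<open>y = x + t d\<close> moves \<open>x\<close> out of the rough field
  \<open>u\<close> and into the Lipschitz kernel; this is the smoothing behind compactness. The
  Jacobian in dimension 3 accounts for \<open>1 / t ^ 3\<close>.\<close>

lemma ray_average_convolution:
  assumes t: "t > 0"
  shows "ray_average t x = (1 / t ^ 3) *\<^sub>R (\<integral>y. cross3 (bump_field e ((1 / t) *\<^sub>R (y - x))) (u y) \<partial>lborel)"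
proof -
  have eq: "x + t *\<^sub>R ((1 / t) *\<^sub>R (y - x)) = y" for y using t by simp
  have "ray_average t x = \<bar>1 / t\<bar> ^ DIM(vec3) *\<^sub>R (\<integral>y. bump e ((- (1 / t)) *\<^sub>R x + (1 / t) *\<^sub>R y) *\<^sub>R
      cross3 ((- (1 / t)) *\<^sub>R x + (1 / t) *\<^sub>R y) (u (x + t *\<^sub>R ((- (1 / t)) *\<^sub>R x + (1 / t) *\<^sub>R y))) \<partial>lborel)"
    unfolding ray_average_def
    using t by (intro integral_lborel_affine[OF ray_average_integrand_measurable]) simp
  also have "(\<lambda>y. (- (1 / t)) *\<^sub>R x + (1 / t) *\<^sub>R y) = (\<lambda>y. (1 / t) *\<^sub>R (y - x))"
    by (simp add: fun_eq_iff algebra_simps)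
  then have "\<And>y. (- (1 / t)) *\<^sub>R x + (1 / t) *\<^sub>R y = (1 / t) *\<^sub>R (y - x)" by metis
  note this[simp del]
  then have "(\<integral>y. bump e ((- (1 / t)) *\<^sub>R x + (1 / t) *\<^sub>R y) *\<^sub>R
      cross3 ((- (1 / t)) *\<^sub>R x + (1 / t) *\<^sub>R y) (u (x + t *\<^sub>R ((- (1 / t)) *\<^sub>R x + (1 / t) *\<^sub>R y))) \<partial>lborel)
     = (\<integral>y. cross3 (bump_field e ((1 / t) *\<^sub>R (y - x))) (u y) \<partial>lborel)"
    by (simp only: eq cross_bump_field)
  finally show ?thesis using t by (simp add: power_divide)
qed

text \<open>The kernel at \<open>(y - x) / t\<close> has Lipschitz constant \<open>4 / t\<close> in
  \<open>x\<close>, and the Jacobian contributes the other three powers. The singularity at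
  \<open>t = 0\<close> is why short times are treated separately.\<close>

lemma ray_average_lipschitz:
  assumes t: "t > 0"
  shows "norm (ray_average t x - ray_average t x') \<le> 4 * norm1 u / t ^ 4 * norm (x - x')"
proof -
  have bf: "bump_field e \<in> borel_measurable borel" unfolding bump_field_def[abs_def] by measurable
  have meas: "(\<lambda>y. cross3 (bump_field e ((1 / t) *\<^sub>R (y - x))) (u y)) \<in> borel_measurable borel" for x
    by (intro borel_measurable_cross3 measurable_compose[OF _ bf] u_measurable
      borel_measurable_continuous_onI continuous_intros)
  have int: "integrable lborel (\<lambda>y. cross3 (bump_field e ((1 / t) *\<^sub>R (y - x))) (u y))" for x
  proof (rule Bochner_Integration.integrable_bound[OF integrable_mult_right[OF integrable_norm[OF u], of 3]])
    show "AE y in lborel. norm (cross3 (bump_field e ((1 / t) *\<^sub>R (y - x))) (u y)) \<le> norm (3 * norm (u y))"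
      using order_trans[OF norm_cross3_le mult_right_mono[OF norm_bump_field[OF e] norm_ge_zero]] by auto
  qed (use meas in simp)
  have "ray_average t x - ray_average t x' = (1 / t ^ 3) *\<^sub>R (\<integral>y. cross3 (bump_field e ((1 / t) *\<^sub>R (y - x)) - bump_field e ((1 / t) *\<^sub>R (y - x'))) (u y) \<partial>lborel)"
    unfolding ray_average_convolution[OF t] Cross3.left_diff_distrib using int by (simp add: algebra_simps)
  also have "norm \<dots> = (1 / t ^ 3) * norm (\<integral>y. cross3 (bump_field e ((1 / t) *\<^sub>R (y - x)) - bump_field e ((1 / t) *\<^sub>R (y - x'))) (u y) \<partial>lborel)"
    using t by simp
  also have "\<dots> \<le> (1 / t ^ 3) * (\<integral>y. 4 / t * norm (x - x') * norm (u y) \<partial>lborel)"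
  proof (rule mult_left_mono)
    have "norm (cross3 (bump_field e ((1 / t) *\<^sub>R (y - x)) - bump_field e ((1 / t) *\<^sub>R (y - x'))) (u y)) \<le> 4 / t * norm (x - x') * norm (u y)" for y
    proof -
      have "(1 / t) *\<^sub>R (y - x) - (1 / t) *\<^sub>R (y - x') = (1 / t) *\<^sub>R (x' - x)" by (simp add: algebra_simps)
      then have "norm (bump_field e ((1 / t) *\<^sub>R (y - x)) - bump_field e ((1 / t) *\<^sub>R (y - x'))) \<le> 4 / t * norm (x - x')"
        using bump_field_lipschitz[OF e, of "(1 / t) *\<^sub>R (y - x)" "(1 / t) *\<^sub>R (y - x')"] t by (simp add: norm_minus_commute)
      then show ?thesis by (intro order_trans[OF norm_cross3_le] mult_right_mono) auto
    qed
    moreover have "integrable lborel (\<lambda>y. cross3 (bump_field e ((1 / t) *\<^sub>R (y - x)) - bump_field e ((1 / t) *\<^sub>R (y - x'))) (u y))"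
      unfolding Cross3.left_diff_distrib using int by simp
    ultimately show "norm (\<integral>y. cross3 (bump_field e ((1 / t) *\<^sub>R (y - x)) - bump_field e ((1 / t) *\<^sub>R (y - x'))) (u y) \<partial>lborel)
        \<le> (\<integral>y. 4 / t * norm (x - x') * norm (u y) \<partial>lborel)"
      using u by (intro Bochner_Integration.integral_norm_bound_integral) auto
  qed (use t in simp)
  also have "\<dots> = 4 * norm1 u / t ^ 4 * norm (x - x')"
    by (simp add: power_Suc numeral_eq_Suc mult_ac)
  finally show ?thesis .
qed

text \<open>Fubini separates time from direction; \<open>a > 0\<close> bounds the inner integrals by
  a multiple of \<open>1 / a ^ 3\<close>, which justifies it for a field known only to be
  integrable.\<close>

lemma vpot_rays_eq:
  assumes "0 < a" "a \<le> b"
  shows "integrable lborel (\<lambda>t. (indicator {a<..b} t / bump_mass e) *\<^sub>R ray_average t x)"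
    "vpot (rays e a b) u x = (\<integral>t. (indicator {a<..b} t / bump_mass e) *\<^sub>R ray_average t x \<partial>lborel)"
proof -
  let ?g = "\<lambda>p. cross3 (snd p) (u (x + fst p *\<^sub>R snd p))"
  let ?f = "\<lambda>t d. ray_weight e a b (t, d) *\<^sub>R ?g (t, d)"
  have g: "?g \<in> borel_measurable borel"
    by (intro borel_measurable_cross3 measurable_compose[OF _ u_measurable]
      borel_measurable_continuous_onI continuous_intros)
  have f: "?f t d = (indicator {a<..b} t / bump_mass e) *\<^sub>R (bump e d *\<^sub>R cross3 d (u (x + t *\<^sub>R d)))" for t d
    by (simp add: ray_weight_def)
  have int: "integrable (lborel \<Otimes>\<^sub>M lborel) (case_prod ?f)"
  proof (rule lborel_pair.Fubini_integrable)
    have "(\<lambda>p. ray_weight e a b p *\<^sub>R ?g p) \<in> borel_measurable borel" using g by measurable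
    then show meas: "case_prod ?f \<in> borel_measurable (lborel \<Otimes>\<^sub>M lborel)"
      by (simp add: lborel_prod case_prod_unfold)
    show "AE t in lborel. integrable lborel (\<lambda>d. case (t, d) of (t, d) \<Rightarrow> ?f t d)"
    proof (rule AE_I2)
      fix t
      show "integrable lborel (\<lambda>d. case (t, d) of (t, d) \<Rightarrow> ?f t d)"
      proof (cases "t \<in> {a<..b}")
        case True
        then show ?thesis unfolding case_prod_conv f
          using assms by (intro integrable_scaleR_right ray_average_integrable(1)) auto
      next
        case False
        then show ?thesis unfolding case_prod_conv f by simp
      qed
    qed
    have bnd: "(\<integral>d. norm (?f t d) \<partial>lborel) \<le> indicator {a<..b} t * (3 * norm1 u / a ^ 3 / bump_mass e)" for t
    proof (cases "t \<in> {a<..b}")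
      case True
      have "(\<integral>d. norm (?f t d) \<partial>lborel) = (1 / bump_mass e) * (\<integral>d. norm (bump e d *\<^sub>R cross3 d (u (x + t *\<^sub>R d))) \<partial>lborel)"
        unfolding f norm_scaleR[of "indicator {a<..b} t / bump_mass e"] using True bump_mass_pos[of e] by (simp del: norm_scaleR)
      also have "\<dots> \<le> (1 / bump_mass e) * (3 * norm1 u / t ^ 3)"
        using bump_mass_pos[of e] True assms by (intro mult_left_mono ray_average_integrable(2)) auto
      also have "\<dots> \<le> (1 / bump_mass e) * (3 * norm1 u / a ^ 3)"
        using bump_mass_pos[of e] True assms by (intro mult_left_mono divide_left_mono power_mono mult_pos_pos) auto
      finally show ?thesis using True by (simp add: mult.commute)
    next
      case False
      then show ?thesis unfolding f by simp
    qed
    show "integrable lborel (\<lambda>t. \<integral>d. norm (case (t, d) of (t, d) \<Rightarrow> ?f t d) \<partial>lborel)"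
    proof (rule Bochner_Integration.integrable_bound)
      show "integrable lborel (\<lambda>t. indicator {a<..b} t * (3 * norm1 u / a ^ 3 / bump_mass e))"
        by (rule integrable_indicator_Ioc)
      show "(\<lambda>t. \<integral>d. norm (case (t, d) of (t, d) \<Rightarrow> ?f t d) \<partial>lborel) \<in> borel_measurable lborel"
        by (rule lborel.borel_measurable_lebesgue_integral)
           (use measurable_compose[OF meas borel_measurable_norm] in \<open>simp add: case_prod_unfold del: norm_scaleR\<close>)
      show "AE t in lborel. norm (\<integral>d. norm (case (t, d) of (t, d) \<Rightarrow> ?f t d) \<partial>lborel)
         \<le> norm (indicator {a<..b} t * (3 * norm1 u / a ^ 3 / bump_mass e))"
        using order_trans[OF bnd abs_ge_self] by (auto simp del: norm_scaleR)
    qed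
  qed
  have avg: "(\<integral>d. ?f t d \<partial>lborel) = (indicator {a<..b} t / bump_mass e) *\<^sub>R ray_average t x" for t
    unfolding f ray_average_def by (rule integral_scaleR_right)
  show "integrable lborel (\<lambda>t. (indicator {a<..b} t / bump_mass e) *\<^sub>R ray_average t x)"
    using lborel_pair.integrable_fst[OF int] unfolding avg .
  show "vpot (rays e a b) u x = (\<integral>t. (indicator {a<..b} t / bump_mass e) *\<^sub>R ray_average t x \<partial>lborel)"
    using lborel_pair.integral_fst[OF int] unfolding avg vpot_def integral_rays(2)[OF g]
    by (simp add: lborel_prod case_prod_unfold)
qed

lemma norm_integral_ray_average_le:
  assumes "a \<le> b" and "integrable lborel (\<lambda>t. (indicator {a<..b} t / bump_mass e) *\<^sub>R f t)"
    and f: "\<And>t. t \<in> {a<..b} \<Longrightarrow> norm (f t :: vec3) \<le> c"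
  shows "norm (\<integral>t. (indicator {a<..b} t / bump_mass e) *\<^sub>R f t \<partial>lborel) \<le> (b - a) * (c / bump_mass e)"
proof -
  have "norm (\<integral>t. (indicator {a<..b} t / bump_mass e) *\<^sub>R f t \<partial>lborel) \<le> (\<integral>t. indicator {a<..b} t * (c / bump_mass e) \<partial>lborel)"
  proof (rule Bochner_Integration.integral_norm_bound_integral[OF assms(2) integrable_indicator_Ioc])
    fix t
    show "norm ((indicator {a<..b} t / bump_mass e) *\<^sub>R f t) \<le> indicator {a<..b} t * (c / bump_mass e)"
      using f[of t] bump_mass_pos[of e] by (cases "t \<in> {a<..b}") (auto intro: divide_right_mono)
  qed
  then show ?thesis using assms(1) by simp
qed

lemma vpot_rays_lipschitz:
  assumes a: "0 < a" "a \<le> b"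
  shows "norm (vpot (rays e a b) u x - vpot (rays e a b) u x')
     \<le> (b - a) * (4 * norm1 u / a ^ 4 * norm (x - x') / bump_mass e)"
proof -
  have "vpot (rays e a b) u x - vpot (rays e a b) u x' =
      (\<integral>t. (indicator {a<..b} t / bump_mass e) *\<^sub>R (ray_average t x - ray_average t x') \<partial>lborel)"
    using vpot_rays_eq[OF a] by (simp add: scaleR_diff_right)
  also have "norm \<dots> \<le> (b - a) * (4 * norm1 u / a ^ 4 * norm (x - x') / bump_mass e)"
  proof (rule norm_integral_ray_average_le[OF a(2)])
    show "integrable lborel (\<lambda>t. (indicator {a<..b} t / bump_mass e) *\<^sub>R (ray_average t x - ray_average t x'))"
      using vpot_rays_eq(1)[OF a] by (simp add: scaleR_diff_right)
    fix t assume t: "t \<in> {a<..b}"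
    then have "4 * norm1 u / t ^ 4 * norm (x - x') \<le> 4 * norm1 u / a ^ 4 * norm (x - x')"
      using a by (intro mult_right_mono divide_left_mono power_mono mult_pos_pos) auto
    then show "norm (ray_average t x - ray_average t x') \<le> 4 * norm1 u / a ^ 4 * norm (x - x')"
      using ray_average_lipschitz[of t x x'] a t by auto
  qed
  finally show ?thesis .
qed

lemma norm_vpot_rays:
  assumes a: "0 < a" "a \<le> b"
  shows "norm (vpot (rays e a b) u x) \<le> (b - a) * (3 * norm1 u / a ^ 3 / bump_mass e)"
  unfolding vpot_rays_eq(2)[OF a]
proof (rule norm_integral_ray_average_le[OF a(2) vpot_rays_eq(1)[OF a]])
  fix t assume t: "t \<in> {a<..b}"
  then have "3 * norm1 u / t ^ 3 \<le> 3 * norm1 u / a ^ 3"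
    using a by (intro divide_left_mono power_mono mult_pos_pos) auto
  then show "norm (ray_average t x) \<le> 3 * norm1 u / a ^ 3"
    using norm_ray_average[of t x] a t by auto
qed

end

text \<open>Additivity of the weights, at those points where the integral over the whole time range
  converges absolutely.\<close>

lemma vpot_rays_split:
  assumes e: "norm e = 1" and ab: "a \<le> b" "b \<le> c" and u: "sq_int lborel u"
  shows "AE x in lborel. vpot (rays e a c) u x = vpot (rays e a b) u x + vpot (rays e b c) u x"
proof -
  interpret ray_measure "rays e a c" 3 using rays_ray_measure[OF _ e, of a c] ab by simp
  show ?thesis
    using AE_sq_int_shift[OF u]
  proof eventually_elim
    case (elim x)
    let ?g = "\<lambda>p. cross3 (snd p) (u (x + fst p *\<^sub>R snd p))"
    have g: "?g \<in> borel_measurable borel"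
      by (intro borel_measurable_cross3 measurable_compose[OF _ sq_int_lborelD[OF u]]
        borel_measurable_continuous_onI continuous_intros)
    have int: "integrable lborel (\<lambda>p. ray_weight e a c p *\<^sub>R ?g p)"
      using sq_int_cross3_shift(1)[OF u elim] integral_rays(1)[OF g] by simp
    have w: "\<bar>ray_weight e a b p\<bar> \<le> \<bar>ray_weight e a c p\<bar>" "\<bar>ray_weight e b c p\<bar> \<le> \<bar>ray_weight e a c p\<bar>" for p
      using ray_weight_split[OF ab, of e p] ray_weight_nonneg[of e a b p] ray_weight_nonneg[of e b c p] by auto
    have "integrable lborel (\<lambda>p. ray_weight e a b p *\<^sub>R ?g p)" "integrable lborel (\<lambda>p. ray_weight e b c p *\<^sub>R ?g p)"
      using g w by (auto intro!: Bochner_Integration.integrable_bound[OF int] AE_I2 mult_right_mono)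
    then show ?case unfolding vpot_def integral_rays(2)[OF g] ray_weight_split[OF ab] scaleR_add_left by simp
  qed
qed

text \<open>The times up to \<open>\<delta>\<close> contribute an operator of norm at most
  \<open>3 \<delta>\<close>; the remaining times map the bounded sequence to equibounded and
  equicontinuous fields, to which Arzela-Ascoli applies. A diagonal sequence serves a null sequence
  of cut-offs at once.\<close>

lemma vpot_rays_compact:
  fixes u :: "nat \<Rightarrow> vec3 \<Rightarrow> vec3"
  assumes e: "norm e = 1" and h: "0 < h" and u: "\<And>n. sq_int lborel (u n)"
    and u0: "\<And>n x. x \<notin> cball 0 R \<Longrightarrow> u n x = 0" and u1: "\<And>n. (normsq lborel (u n)) \<le> 1"
  obtains r :: "nat \<Rightarrow> nat" where "strict_mono r"
    "\<And>\<epsilon>. \<epsilon> > 0 \<Longrightarrow> \<exists>N. \<forall>i\<ge>N. \<forall>j\<ge>N. (\<integral>x. indicator (cball 0 R) x *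
        (norm (vpot (rays e 0 h) (u (r i)) x - vpot (rays e 0 h) (u (r j)) x))\<^sup>2 \<partial>lborel) < \<epsilon>"
proof -
  let ?B = "cball (0::vec3) R"
  define K where "K = measure lborel ?B + 1"
  have K: "K \<ge> 0" by (simp add: K_def)
  have ui: "integrable lborel (u n)"
    "(\<integral>x. norm (u n x) \<partial>lborel) \<le> measure lborel ?B + normsq lborel (u n)" for n
    using integrable_of_sq_int_bounded_support[OF u[of n], of R] u0[of _ n] by auto
  have uK: "(\<integral>x. norm (u n x) \<partial>lborel) \<le> K" for n using ui(2)[of n] u1[of n] by (simp add: K_def)
  define \<delta> where "\<delta> m = h / (real m + 2)" for m
  have \<delta>: "0 < \<delta> m" "\<delta> m \<le> h" for m using h by (auto simp: \<delta>_def field_simps)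
  define G where "G m n x = vpot (rays e (\<delta> m) h) (u n) x" for m n x
  define P where "P m s \<longleftrightarrow> (\<forall>\<epsilon>>0. \<exists>N. \<forall>i\<ge>N. \<forall>j\<ge>N. \<forall>x\<in>?B. norm (G m (s i) x - G m (s j) x) < \<epsilon>)"
    for m and s :: "nat \<Rightarrow> nat"
  interpret subseqs P
  proof
    fix m and s :: "nat \<Rightarrow> nat"
    assume "strict_mono s"
    define M where "M = (h - \<delta> m) * (3 * K / \<delta> m ^ 3 / bump_mass e)"
    define L where "L = (h - \<delta> m) * (4 * K / \<delta> m ^ 4 / bump_mass e)"
    have pos: "bump_mass e > 0" "h - \<delta> m \<ge> 0" "\<delta> m > 0" using bump_mass_pos \<delta>[of m] by auto
    have bnd: "norm (G m n x) \<le> M" for n x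
    proof -
      have "norm (G m n x) \<le> (h - \<delta> m) * (3 * (\<integral>y. norm (u n y) \<partial>lborel) / \<delta> m ^ 3 / bump_mass e)"
        unfolding G_def using norm_vpot_rays[OF e ui(1) \<delta>] .
      also have "\<dots> \<le> M"
        unfolding M_def using pos uK[of n] by (intro mult_left_mono divide_right_mono) auto
      finally show ?thesis .
    qed
    have lip: "norm (G m n x - G m n x') \<le> L * norm (x - x')" for n x x'
    proof -
      have "norm (G m n x - G m n x') \<le> (h - \<delta> m) * (4 * (\<integral>y. norm (u n y) \<partial>lborel) / \<delta> m ^ 4 * norm (x - x') / bump_mass e)"
        unfolding G_def using vpot_rays_lipschitz[OF e ui(1) \<delta>] .
      also have "\<dots> \<le> (h - \<delta> m) * (4 * K / \<delta> m ^ 4 * norm (x - x') / bump_mass e)"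
        using pos uK[of n] by (intro mult_left_mono divide_right_mono mult_right_mono) auto
      finally show ?thesis by (simp add: L_def)
    qed
    have L: "L \<ge> 0" unfolding L_def using pos K by (intro mult_nonneg_nonneg divide_nonneg_nonneg) auto
    have "\<exists>g k. continuous_on ?B g \<and> strict_mono (k :: nat \<Rightarrow> nat) \<and>
        (\<forall>\<epsilon>>0. \<exists>N. \<forall>n x. n \<ge> N \<and> x \<in> ?B \<longrightarrow> norm (G m (s (k n)) x - g x) < \<epsilon>)"
    proof (rule Arzela_Ascoli[of ?B "\<lambda>n. G m (s n)" M])
      fix x and \<epsilon> :: real assume "\<epsilon> > 0"
      show "\<exists>d>0. \<forall>n y. y \<in> ?B \<and> norm (x - y) < d \<longrightarrow> norm (G m (s n) x - G m (s n) y) < \<epsilon>"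
      proof (intro exI[of _ "\<epsilon> / (L + 1)"] conjI allI impI)
        show "\<epsilon> / (L + 1) > 0" using \<open>\<epsilon> > 0\<close> L by simp
        fix n y assume "y \<in> ?B \<and> norm (x - y) < \<epsilon> / (L + 1)"
        then have "(L + 1) * norm (x - y) < \<epsilon>" using L by (simp add: field_simps)
        moreover have "norm (G m (s n) x - G m (s n) y) \<le> (L + 1) * norm (x - y)"
          by (rule order_trans[OF lip mult_right_mono]) auto
        ultimately show "norm (G m (s n) x - G m (s n) y) < \<epsilon>" by linarith
      qed
    qed (use bnd in auto)
    then obtain g k where k: "strict_mono (k :: nat \<Rightarrow> nat)"
      and g: "\<And>\<epsilon>. \<epsilon> > 0 \<Longrightarrow> \<exists>N. \<forall>n x. n \<ge> N \<and> x \<in> ?B \<longrightarrow> norm (G m (s (k n)) x - g x) < \<epsilon>" by blast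
    have "P m (s \<circ> k)"
      unfolding P_def
    proof (intro allI impI)
      fix \<epsilon> :: real assume "\<epsilon> > 0"
      then obtain N where N: "\<And>n x. n \<ge> N \<Longrightarrow> x \<in> ?B \<Longrightarrow> norm (G m (s (k n)) x - g x) < \<epsilon> / 2"
        using g[of "\<epsilon> / 2"] by auto
      have "norm (G m ((s \<circ> k) i) x - G m ((s \<circ> k) j) x) < \<epsilon>" if "i \<ge> N" "j \<ge> N" "x \<in> ?B" for i j x
        using norm_triangle_lt[of "G m (s (k i)) x - g x" "g x - G m (s (k j)) x" \<epsilon>]
          N[OF that(1,3)] N[OF that(2,3)] by (simp add: norm_minus_commute)
      then show "\<exists>N. \<forall>i\<ge>N. \<forall>j\<ge>N. \<forall>x\<in>?B. norm (G m ((s \<circ> k) i) x - G m ((s \<circ> k) j) x) < \<epsilon>" by blast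
    qed
    then show "\<exists>r'. strict_mono r' \<and> P m (s \<circ> r')" using k by blast
  qed
  \<comment> \<open>The diagonal construction requires that the property passes to further
    subsequences.\<close>
  have stable: "P m (s \<circ> r)" if "strict_mono r" "P m s" for r s :: "nat \<Rightarrow> nat" and m
    unfolding P_def
  proof (intro allI impI)
    fix \<epsilon> :: real assume "\<epsilon> > 0"
    then obtain N where N: "\<forall>i\<ge>N. \<forall>j\<ge>N. \<forall>x\<in>?B. norm (G m (s i) x - G m (s j) x) < \<epsilon>"
      using \<open>P m s\<close> unfolding P_def by blast
    have "r i \<ge> N" if "i \<ge> N" for i using seq_suble[OF \<open>strict_mono r\<close>, of i] that by simp
    then show "\<exists>N. \<forall>i\<ge>N. \<forall>j\<ge>N. \<forall>x\<in>?B. norm (G m ((s \<circ> r) i) x - G m ((s \<circ> r) j) x) < \<epsilon>"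
      using N by (intro exI[of _ N]) auto
  qed
  have Pd: "\<exists>N. \<forall>i\<ge>N. \<forall>j\<ge>N. \<forall>x\<in>?B. norm (G m (diagseq i) x - G m (diagseq j) x) < \<eta>" if "\<eta> > 0" for m \<eta>
  proof -
    \<comment> \<open>Only the tail of the diagonal sequence from index \<open>Suc m\<close> on is a
      subsequence of the one chosen for \<open>m\<close>; hence the shift of indices.\<close>
    have "P m (diagseq \<circ> (+) (Suc m))" by (rule diagseq_holds[OF stable])
    then obtain N where N: "\<forall>i\<ge>N. \<forall>j\<ge>N. \<forall>x\<in>?B.
        norm (G m ((diagseq \<circ> (+) (Suc m)) i) x - G m ((diagseq \<circ> (+) (Suc m)) j) x) < \<eta>"
      using \<open>\<eta> > 0\<close> unfolding P_def by blast
    have "norm (G m (diagseq i) x - G m (diagseq j) x) < \<eta>"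
      if "i \<ge> N + Suc m" "j \<ge> N + Suc m" "x \<in> ?B" for i j x
      using N[rule_format, of "i - Suc m" "j - Suc m" x] that by (simp add: o_def)
    then show ?thesis by blast
  qed
  define A where "A m n = vpot (rays e 0 (\<delta> m)) (u n)" for m n
  define T where "T n = vpot (rays e 0 h) (u n)" for n
  have sqA: "sq_int lborel (A m n)" "normsq lborel (A m n) \<le> 9 * (\<delta> m)\<^sup>2" for m n
  proof -
    interpret ray_measure "rays e 0 (\<delta> m)" 3 using rays_ray_measure[OF _ e] \<delta>(1)[of m] by simp
    show "sq_int lborel (A m n)" unfolding A_def by (rule sq_int_vpot(1)[OF u])
    have "normsq lborel (A m n) \<le> (3 * \<delta> m)\<^sup>2 * normsq lborel (u n)"
      using sq_int_vpot(2)[OF u, of n] measure_rays[of 0 "\<delta> m" e] \<delta>(1)[of m] by (simp add: A_def)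
    also have "\<dots> \<le> (3 * \<delta> m)\<^sup>2 * 1" by (intro mult_left_mono u1) simp
    finally show "normsq lborel (A m n) \<le> 9 * (\<delta> m)\<^sup>2" by (simp add: power_mult_distrib)
  qed
  have sqT: "sq_int lborel (T n)" for n
  proof -
    interpret ray_measure "rays e 0 h" 3 using rays_ray_measure[OF _ e] h by simp
    show ?thesis unfolding T_def by (rule sq_int_vpot(1)[OF u])
  qed
  have split: "AE x in lborel. T n x = A m n x + G m n x" for m n
    unfolding T_def A_def G_def using vpot_rays_split[OF e _ _ u] \<delta>[of m] by simp
  show thesis
  proof (rule that[OF subseq_diagseq])
    fix \<epsilon> :: real assume "\<epsilon> > 0"
    have "\<delta> \<longlonglongrightarrow> 0" unfolding \<delta>_def by real_asymp
    \<comment> \<open>The estimate below has factor 4 on each of the two short-time parts, whose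
      squared norms are at most 9 times the square of \<open>\<delta> m\<close>; hence 72.\<close>
    then have "(\<lambda>m. 72 * (\<delta> m)\<^sup>2) \<longlonglongrightarrow> 72 * 0\<^sup>2" by (intro tendsto_intros)
    then have "eventually (\<lambda>m. 72 * (\<delta> m)\<^sup>2 < \<epsilon> / 2) sequentially"
      using \<open>\<epsilon> > 0\<close> by (intro order_tendstoD(2)[where y = "72 * 0\<^sup>2"]) auto
    then obtain m where m: "72 * (\<delta> m)\<^sup>2 < \<epsilon> / 2" by (auto simp: eventually_sequentially)
    \<comment> \<open>The summand 4 in \<open>4 * K + 4\<close> leaves room for a strict inequality
      after multiplication by \<open>2 * K\<close>.\<close>
    define \<eta> where "\<eta> = sqrt (\<epsilon> / (4 * K + 4))"
    have \<eta>: "\<eta> > 0" "2 * \<eta>\<^sup>2 * K < \<epsilon> / 2"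
    proof -
      show pos: "\<eta> > 0" using \<open>\<epsilon> > 0\<close> K by (simp add: \<eta>_def)
      have "\<eta>\<^sup>2 = \<epsilon> / (4 * K + 4)" using \<open>\<epsilon> > 0\<close> K by (simp add: \<eta>_def)
      then have "4 * (\<eta>\<^sup>2 * K) + 4 * \<eta>\<^sup>2 = \<epsilon>" using K by (simp add: field_simps)
      moreover have "\<eta>\<^sup>2 > 0" using pos by simp
      ultimately show "2 * \<eta>\<^sup>2 * K < \<epsilon> / 2" by argo
    qed
    obtain N where N: "\<forall>i\<ge>N. \<forall>j\<ge>N. \<forall>x\<in>?B. norm (G m (diagseq i) x - G m (diagseq j) x) < \<eta>"
      using Pd[OF \<eta>(1)] by blast
    have "(\<integral>x. indicator ?B x * (norm (T (diagseq i) x - T (diagseq j) x))\<^sup>2 \<partial>lborel) < \<epsilon>" if "i \<ge> N" "j \<ge> N" for i j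
    proof -
      let ?i = "diagseq i" and ?j = "diagseq j"
      let ?k = "\<lambda>x. 4 * (norm (A m ?i x))\<^sup>2 + 4 * (norm (A m ?j x))\<^sup>2 + indicator ?B x * (2 * \<eta>\<^sup>2)"
      have indi: "integrable lborel (\<lambda>x. indicator ?B x * (2 * \<eta>\<^sup>2))"
        using emeasure_lborel_cball_finite[of "0::vec3" R] by (intro integrable_mult_left integrable_real_indicator) auto
      have k: "integrable lborel ?k" using sq_intD(2)[OF sqA(1)] indi by simp
      have AE: "AE x in lborel. indicator ?B x * (norm (T ?i x - T ?j x))\<^sup>2 \<le> ?k x"
        using split[of ?i m] split[of ?j m]
      proof eventually_elim
        case (elim x)
        show ?case
        proof (cases "x \<in> ?B")
          case True
          have "T ?i x - T ?j x = (A m ?i x - A m ?j x) + (G m ?i x - G m ?j x)" using elim by simp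
          then have "(norm (T ?i x - T ?j x))\<^sup>2 \<le> 2 * (norm (A m ?i x - A m ?j x))\<^sup>2 + 2 * (norm (G m ?i x - G m ?j x))\<^sup>2"
            by (simp only: norm_add_square_le)
          also have "(norm (A m ?i x - A m ?j x))\<^sup>2 \<le> 2 * (norm (A m ?i x))\<^sup>2 + 2 * (norm (A m ?j x))\<^sup>2"
            using norm_add_square_le[of "A m ?i x" "- A m ?j x"] by simp
          also have "(norm (G m ?i x - G m ?j x))\<^sup>2 \<le> \<eta>\<^sup>2"
            using N that True by (intro power_mono) (auto intro: less_imp_le)
          finally show ?thesis using True by simp
        qed simp
      qed
      have "(\<integral>x. indicator ?B x * (norm (T ?i x - T ?j x))\<^sup>2 \<partial>lborel) \<le> (\<integral>x. ?k x \<partial>lborel)"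
        by (rule integral_mono_AE'[OF k AE]) (simp add: AE_I2)
      also have "\<dots> = 4 * normsq lborel (A m ?i) + 4 * normsq lborel (A m ?j) + measure lborel ?B * (2 * \<eta>\<^sup>2)"
        using sq_intD(2)[OF sqA(1)] indi by simp
      also have "measure lborel ?B * (2 * \<eta>\<^sup>2) \<le> 2 * \<eta>\<^sup>2 * K"
        by (simp add: K_def algebra_simps)
      also have "4 * normsq lborel (A m ?i) + 4 * normsq lborel (A m ?j) \<le> 72 * (\<delta> m)\<^sup>2"
        using sqA(2)[of m ?i] sqA(2)[of m ?j] by simp
      also have "72 * (\<delta> m)\<^sup>2 + 2 * \<eta>\<^sup>2 * K < \<epsilon>" using m \<eta>(2) by simp
      finally show ?thesis by simp
    qed
    then show "\<exists>N. \<forall>i\<ge>N. \<forall>j\<ge>N. (\<integral>x. indicator ?B x *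
        (norm (vpot (rays e 0 h) (u (diagseq i)) x - vpot (rays e 0 h) (u (diagseq j)) x))\<^sup>2 \<partial>lborel) < \<epsilon>"
      unfolding T_def by blast
  qed
qed

section \<open>Slabs and the lower bound for eigenvalues\<close>

text \<open>The strict inequalities guarantee that a displacement whose component along
  \<open>e\<close> has size at least \<open>h\<close> leaves the slab.\<close>

definition in_slab :: "vec3 set \<Rightarrow> vec3 \<Rightarrow> real \<Rightarrow> bool" where
  "in_slab \<Omega> e h \<longleftrightarrow> norm e = 1 \<and> 0 < h \<and> (\<exists>\<alpha>. \<Omega> \<subseteq> {x. \<alpha> < x \<bullet> e \<and> x \<bullet> e < \<alpha> + h})"

lemma in_slab_subset: "in_slab \<Omega> e h \<Longrightarrow> \<Omega>' \<subseteq> \<Omega> \<Longrightarrow> in_slab \<Omega>' e h"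
  unfolding in_slab_def by blast

lemma in_slab_cball:
  assumes "\<Omega> \<subseteq> cball 0 R" "R \<ge> 0"
  shows "in_slab \<Omega> (axis 1 1) (2 * R + 2)"
  unfolding in_slab_def
proof (intro conjI exI[of _ "- R - 1"] subsetI)
  fix x :: vec3 assume "x \<in> \<Omega>"
  then have "norm x \<le> R" using assms(1) by auto
  then have "\<bar>x \<bullet> axis 1 1\<bar> \<le> R" using Cauchy_Schwarz_ineq2[of x "axis 1 1"] by simp
  then show "x \<in> {x. - R - 1 < x \<bullet> axis 1 1 \<and> x \<bullet> axis 1 1 < - R - 1 + (2 * R + 2)}" by auto
qed (use assms(2) in auto)

text \<open>\<open>V - \<mu> T V\<close> is weakly curl-free in \<open>\<Omega>\<close>, because
  \<open>T V\<close> has weak curl \<open>V\<close> there. A general \<open>U\<close> in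
  \<open>K\<close>, not only \<open>V\<close> itself, is allowed so that eigenfields of smaller
  domains can be inserted.\<close>

lemma eigenfield_inner_vpot:
  assumes \<Omega>: "open \<Omega>" "bounded \<Omega>" and slab: "in_slab \<Omega> e h" and V: "eigenfield \<Omega> \<mu> V"
    and U: "sq_int lborel U" "\<And>x. x \<notin> \<Omega> \<Longrightarrow> U x = 0" "U \<in> Kspace \<Omega>"
  shows "ip U V = \<mu> * ip U (vpot (rays e 0 h) V)"
proof -
  obtain \<alpha> where e: "norm e = 1" "0 < h" and \<alpha>: "\<Omega> \<subseteq> {x. \<alpha> < x \<bullet> e \<and> x \<bullet> e < \<alpha> + h}"
    using slab by (auto simp: in_slab_def)
  interpret ray_measure "rays e 0 h" 3 using rays_ray_measure[of 0 h e] e by simp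
  note V' = eigenfieldD[OF V]
  let ?T = "vpot (rays e 0 h) V"
  have T: "sq_int lborel ?T" by (rule sq_int_vpot(1)[OF V'(1)])
  have w: "sq_int lborel (\<lambda>x. V x - \<mu> *\<^sub>R ?T x)" by (intro sq_int_diff V'(1) sq_int_scaleR T)
  have "ip U (\<lambda>x. (V x - \<mu> *\<^sub>R ?T x)) = 0"
  proof (rule Kspace_orthogonal[OF \<Omega>(1) U w])
    fix \<phi> assume \<phi>: "test_field \<Omega> \<phi>"
    have "ip (\<lambda>x. (V x - \<mu> *\<^sub>R ?T x)) (curl \<phi>)
        = ip V (curl \<phi>) - \<mu> * ip ?T (curl \<phi>)"
      using sq_int_inner_integrable[OF V'(1) test_field_sq_int(2)[OF \<phi>]]
        sq_int_inner_integrable[OF T test_field_sq_int(2)[OF \<phi>]] by (simp add: inner_diff_left)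
    also have "ip ?T (curl \<phi>) = ip V \<phi>"
      by (rule vpot_weak_curl[OF V'(1) \<Omega> V'(2,3) \<phi>]) (use integral_rays_derivative[OF e \<alpha> \<phi>] in auto)
    finally show "ip (\<lambda>x. (V x - \<mu> *\<^sub>R ?T x)) (curl \<phi>) = 0" using V'(5)[OF \<phi>] by simp
  qed
  then show ?thesis
    using sq_int_inner_integrable[OF U(1) V'(1)] sq_int_inner_integrable[OF U(1) T] by (simp add: inner_diff_right)
qed

lemma eigenvalue_slab_bound:
  assumes "open \<Omega>" "bounded \<Omega>" "in_slab \<Omega> e h" "eigenfield \<Omega> \<mu> V" "\<mu> > 0"
  shows "1 \<le> 3 * h * \<mu>"
proof -
  note V = eigenfieldD[OF assms(4)]
  have e: "norm e = 1" "0 < h" using assms(3) by (auto simp: in_slab_def)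
  interpret ray_measure "rays e 0 h" 3 using rays_ray_measure[of 0 h e] e by simp
  let ?T = "vpot (rays e 0 h) V"
  have "1 = \<mu> * ip V ?T"
    using eigenfield_inner_vpot[OF assms(1-4) V(1-3)] V(4) by (simp add: power2_norm_eq_inner)
  moreover have "ip V ?T \<le> 3 * h"
  proof -
    have "ip V ?T \<le> sqrt (normsq lborel ?T)"
      using L2_Cauchy_Schwarz[OF V(1) sq_int_vpot(1)[OF V(1)]] V(4) by simp
    also have "\<dots> \<le> sqrt ((3 * h)\<^sup>2)"
      using sq_int_vpot(2)[OF V(1)] V(4) measure_rays[of 0 h e] e by (intro real_sqrt_le_mono) simp
    also have "\<dots> = \<bar>3 * h\<bar>" by (rule real_sqrt_abs)
    finally show ?thesis using e by simp
  qed
  ultimately show ?thesis using mult_left_mono[of "\<integral>x. V x \<bullet> ?T x \<partial>lborel" "3 * h" \<mu>] \<open>\<mu> > 0\<close> by (simp add: mult.commute)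
qed

section \<open>Comparison of nested domains\<close>

lemma L2_inner_subset:
  assumes "open \<Omega>" "open \<Omega>'" "\<Omega> \<subseteq> \<Omega>'" "\<And>x. x \<in> \<Omega>' - \<Omega> \<Longrightarrow> v x \<bullet> w x = 0"
  shows "L2_inner \<Omega> v w = L2_inner \<Omega>' v w"
proof -
  have "L2_inner \<Omega> v w = (\<integral>x. indicator \<Omega> x *\<^sub>R (v x \<bullet> w x) \<partial>lebesgue)"
    unfolding L2_inner_def using assms(1) by (subst integral_restrict_space) auto
  also have "\<dots> = (\<integral>x. indicator \<Omega>' x *\<^sub>R (v x \<bullet> w x) \<partial>lebesgue)"
    using assms(3,4) by (intro Bochner_Integration.integral_cong) (auto simp: indicator_def)
  also have "\<dots> = L2_inner \<Omega>' v w"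
    unfolding L2_inner_def using assms(2) by (subst integral_restrict_space) auto
  finally show ?thesis .
qed

lemma L2_subset:
  assumes "open \<Omega>" "open \<Omega>'" "\<Omega> \<subseteq> \<Omega>'" "w \<in> L2 \<Omega>'"
  shows "w \<in> L2 \<Omega>"
proof -
  have w: "w \<in> borel_measurable (lebesgue_on \<Omega>')" "integrable (lebesgue_on \<Omega>') (\<lambda>x. (norm (w x))\<^sup>2)"
    using assms(4) by (auto simp: L2_def)
  have "integrable lebesgue (\<lambda>x. indicator \<Omega>' x *\<^sub>R (norm (w x))\<^sup>2)"
    using w(2) assms(2) by (subst (asm) integrable_restrict_space) auto
  then have "integrable lebesgue (\<lambda>x. indicator \<Omega> x *\<^sub>R (indicator \<Omega>' x *\<^sub>R (norm (w x))\<^sup>2))"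
    by (rule integrable_mult_indicator[rotated]) (use assms(1) in auto)
  also have "(\<lambda>x. indicator \<Omega> x *\<^sub>R (indicator \<Omega>' x *\<^sub>R (norm (w x))\<^sup>2)) = (\<lambda>x. indicator \<Omega> x *\<^sub>R (norm (w x))\<^sup>2)"
    using assms(3) by (auto simp: indicator_def fun_eq_iff)
  finally have "integrable (lebesgue_on \<Omega>) (\<lambda>x. (norm (w x))\<^sup>2)"
    using assms(1) by (subst integrable_restrict_space) auto
  then show ?thesis using measurable_restrict_mono[OF w(1) assms(3)] by (simp add: L2_def)
qed

text \<open>A field that is weakly curl-free on the larger domain stays so on the smaller one, since
  test fields of \<open>\<Omega>\<close> are test fields of \<open>\<Omega>'\<close>. The larger
  domain thus adds no conditions on a field supported in the smaller one.\<close>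

lemma Kspace_mono:
  assumes "open \<Omega>" "open \<Omega>'" "\<Omega> \<subseteq> \<Omega>'"
    and U: "sq_int lborel U" "\<And>x. x \<notin> \<Omega> \<Longrightarrow> U x = 0" "U \<in> Kspace \<Omega>"
  shows "U \<in> Kspace \<Omega>'"
  unfolding Kspace_def
proof (intro CollectI conjI ballI impI)
  show "U \<in> L2 \<Omega>'" using sq_int_lebesgue_on[OF assms(2) U(1)] by (simp add: L2_iff_sq_int)
  fix w assume w: "w \<in> L2 \<Omega>'" and curl: "weak_curl \<Omega>' w (\<lambda>_. 0)"
  have "weak_curl \<Omega> w (\<lambda>_. 0)"
    unfolding weak_curl_def
  proof (intro allI impI)
    fix \<phi> assume \<phi>: "test_field \<Omega> \<phi>"
    have "w x \<bullet> curl \<phi> x = 0" if "x \<in> \<Omega>' - \<Omega>" for x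
    proof -
      have "x \<notin> closure {x. \<phi> x \<noteq> 0}" using test_fieldD(4)[OF \<phi>] that by blast
      then show ?thesis by (simp add: curl_zero_off_support)
    qed
    then have "L2_inner \<Omega> w (curl \<phi>) = L2_inner \<Omega>' w (curl \<phi>)" by (rule L2_inner_subset[OF assms(1-3)])
    also have "\<dots> = 0" using curl test_field_subset[OF \<phi> assms(3)] by (simp add: weak_curl_def L2_inner_def)
    finally show "L2_inner \<Omega> w (curl \<phi>) = L2_inner \<Omega> (\<lambda>_. 0) \<phi>" by (simp add: L2_inner_def)
  qed
  then have "L2_inner \<Omega> U w = 0" using U(3) L2_subset[OF assms(1-3) w] by (simp add: Kspace_def)
  moreover have "L2_inner \<Omega> U w = L2_inner \<Omega>' U w" by (rule L2_inner_subset[OF assms(1-3)]) (simp add: U(2))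
  ultimately show "L2_inner \<Omega>' U w = 0" by simp
qed

section \<open>Limits of eigenfields on increasing domains\<close>

text \<open>Meant for supports of test fields: a test field of the union is a test field of all but
  finitely many of the domains.\<close>

lemma compact_subset_increasing_union:
  fixes \<Omega> :: "nat \<Rightarrow> 'a::topological_space set"
  assumes "compact C" "C \<subseteq> (\<Union>n. \<Omega> n)" "\<And>n. open (\<Omega> n)" "mono \<Omega>"
  obtains N where "\<And>n. n \<ge> N \<Longrightarrow> C \<subseteq> \<Omega> n"
proof -
  obtain F where F: "finite F" "C \<subseteq> (\<Union>n\<in>F. \<Omega> n)"
    using compactE_image[OF assms(1), of UNIV \<Omega>] assms(2,3) by auto
  obtain N where N: "\<And>i. i \<in> F \<Longrightarrow> i \<le> N"
    using F(1) finite_nat_set_iff_bounded_le by auto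
  have "C \<subseteq> \<Omega> n" if "n \<ge> N" for n
  proof
    fix x assume "x \<in> C"
    then obtain i where "i \<in> F" "x \<in> \<Omega> i" using F(2) by blast
    then show "x \<in> \<Omega> n" using monoD[OF assms(4), of i n] N[of i] that by auto
  qed
  then show thesis using that by blast
qed

lemma L2_dist_lebesgue_on:
  fixes f :: "vec3 \<Rightarrow> vec3"
  assumes "open \<Omega>" "sq_int lborel f" "\<And>x. x \<notin> \<Omega> \<Longrightarrow> f x = 0"
  shows "normsq (lebesgue_on \<Omega>) f = normsq lborel f"
  using L2_inner_lborel[OF assms(1) sq_int_lborelD[OF assms(2)] sq_int_lborelD[OF assms(2)]] assms(3)
  by (simp add: L2_inner_def power2_norm_eq_inner)

text \<open>Testing the curl-free field \<open>V\<^sub>j - \<mu>\<^sub>j T V\<^sub>j\<close> with \<open>V\<^sub>i\<close>, which lies in the smaller space, expresses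
  the Gram matrix of the eigenfields through the compact operator \<open>T\<close>.\<close>

lemma eigenfields_distance:
  assumes \<Omega>: "open \<Omega>\<^sub>1" "open \<Omega>\<^sub>2" "\<Omega>\<^sub>1 \<subseteq> \<Omega>\<^sub>2" "bounded \<Omega>\<^sub>2" and slab: "in_slab \<Omega>\<^sub>2 e h" and R: "\<Omega>\<^sub>2 \<subseteq> cball 0 R"
    and V1: "eigenfield \<Omega>\<^sub>1 \<mu>\<^sub>1 V\<^sub>1" and V2: "eigenfield \<Omega>\<^sub>2 \<mu>\<^sub>2 V\<^sub>2" and pos: "\<mu>\<^sub>1 > 0" "\<mu>\<^sub>2 > 0"
  defines "T \<equiv> vpot (rays e 0 h)"
  shows "normsq lborel (\<lambda>x. V\<^sub>1 x - V\<^sub>2 x) \<le> 2 * \<bar>\<mu>\<^sub>1 - \<mu>\<^sub>2\<bar> / \<mu>\<^sub>1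
    + 2 * \<mu>\<^sub>2 * sqrt (\<integral>x. indicator (cball 0 R) x * (norm (T V\<^sub>1 x - T V\<^sub>2 x))\<^sup>2 \<partial>lborel)"
proof -
  have e: "norm e = 1" "0 < h" using slab by (auto simp: in_slab_def)
  interpret ray_measure "rays e 0 h" 3 using rays_ray_measure[of 0 h e] e by simp
  note v1 = eigenfieldD[OF V1] and v2 = eigenfieldD[OF V2]
  note T1 = sq_int_vpot(1)[OF v1(1), folded T_def] and T2 = sq_int_vpot(1)[OF v2(1), folded T_def]
  have b1: "bounded \<Omega>\<^sub>1" using \<Omega>(3,4) bounded_subset by blast
  have 11: "1 = \<mu>\<^sub>1 * ip V\<^sub>1 (T V\<^sub>1)"
    using eigenfield_inner_vpot[OF \<Omega>(1) b1 in_slab_subset[OF slab \<Omega>(3)] V1 v1(1-3)] v1(4)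
    by (simp add: power2_norm_eq_inner T_def)
  have V1K: "V\<^sub>1 \<in> Kspace \<Omega>\<^sub>2" by (rule Kspace_mono[OF \<Omega>(1-3) v1(1-3)])
  have 12: "ip V\<^sub>1 V\<^sub>2 = \<mu>\<^sub>2 * ip V\<^sub>1 (T V\<^sub>2)"
    unfolding T_def by (rule eigenfield_inner_vpot[OF \<Omega>(2,4) slab V2 v1(1) _ V1K]) (use v1(2) \<Omega>(3) in auto)
  let ?D = "\<integral>x. indicator (cball 0 R) x * (norm (T V\<^sub>1 x - T V\<^sub>2 x))\<^sup>2 \<partial>lborel"
  \<comment> \<open>Compactness is available on the ball only; the cut-off leaves the pairing
    unchanged because \<open>V\<^sub>1\<close> vanishes outside.\<close>
  let ?d = "\<lambda>x. indicator (cball 0 R) x *\<^sub>R (T V\<^sub>1 x - T V\<^sub>2 x)"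
  have T12: "sq_int lborel (\<lambda>x. T V\<^sub>1 x - T V\<^sub>2 x)" by (rule sq_int_diff[OF T1 T2])
  have nd: "(norm (?d x))\<^sup>2 = indicator (cball 0 R) x * (norm (T V\<^sub>1 x - T V\<^sub>2 x))\<^sup>2" for x
    by (simp add: indicator_def)
  have d: "sq_int lborel ?d"
    unfolding sq_int_def nd
    using sq_int_lborelD[OF T12] integrable_mult_indicator[OF _ sq_intD(2)[OF T12], of "cball 0 R"]
    by (auto intro!: borel_measurable_scaleR borel_measurable_indicator)
  have "ip V\<^sub>1 (T V\<^sub>1) - ip V\<^sub>1 (T V\<^sub>2) = ip V\<^sub>1 (\<lambda>x. (T V\<^sub>1 x - T V\<^sub>2 x))"
    using sq_int_inner_integrable[OF v1(1) T1] sq_int_inner_integrable[OF v1(1) T2] by (simp add: inner_diff_right)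
  also have "\<dots> = ip V\<^sub>1 ?d"
  proof (rule Bochner_Integration.integral_cong[OF refl])
    fix x
    have "V\<^sub>1 x = 0" if "x \<notin> cball 0 R" using v1(2)[of x] \<Omega>(3) R that by blast
    then show "V\<^sub>1 x \<bullet> (T V\<^sub>1 x - T V\<^sub>2 x) = V\<^sub>1 x \<bullet> ?d x" by (cases "x \<in> cball 0 R") (simp, auto)
  qed
  also have "\<bar>\<dots>\<bar> \<le> sqrt ?D"
    using L2_Cauchy_Schwarz[OF v1(1) d] v1(4) unfolding nd by simp
  finally have diff: "\<bar>(ip V\<^sub>1 (T V\<^sub>1)) - ip V\<^sub>1 (T V\<^sub>2)\<bar> \<le> sqrt ?D" by simp
  have inv: "ip V\<^sub>1 (T V\<^sub>1) = 1 / \<mu>\<^sub>1" using 11 pos by (simp add: field_simps)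
  have "normsq lborel (\<lambda>x. V\<^sub>1 x - V\<^sub>2 x) = 2 - 2 * (\<mu>\<^sub>2 * ip V\<^sub>1 (T V\<^sub>2))"
    using L2_norm_diff_expand[OF v1(1) v2(1)] v1(4) v2(4) 12 by simp
  \<comment> \<open>Inserting the ratio of the eigenvalues brings up the difference of
    \<open>T V\<^sub>1\<close> and \<open>T V\<^sub>2\<close>, both tested with
    \<open>V\<^sub>1\<close>, since \<open>1 / \<mu>\<^sub>1\<close> is the pairing of
    \<open>V\<^sub>1\<close> with \<open>T V\<^sub>1\<close>.\<close>
  also have "\<dots> = 2 * (1 - \<mu>\<^sub>2 / \<mu>\<^sub>1) + 2 * \<mu>\<^sub>2 * (1 / \<mu>\<^sub>1 - ip V\<^sub>1 (T V\<^sub>2))"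
    using pos by (simp add: field_simps)
  also have "\<dots> \<le> 2 * \<bar>\<mu>\<^sub>1 - \<mu>\<^sub>2\<bar> / \<mu>\<^sub>1 + 2 * \<mu>\<^sub>2 * sqrt ?D"
  proof (rule add_mono)
    show "2 * (1 - \<mu>\<^sub>2 / \<mu>\<^sub>1) \<le> 2 * \<bar>\<mu>\<^sub>1 - \<mu>\<^sub>2\<bar> / \<mu>\<^sub>1" 
    proof -
      have "2 * (1 - \<mu>\<^sub>2 / \<mu>\<^sub>1) = 2 * (\<mu>\<^sub>1 - \<mu>\<^sub>2) / \<mu>\<^sub>1" using pos by (simp add: field_simps)
      also have "\<dots> \<le> 2 * \<bar>\<mu>\<^sub>1 - \<mu>\<^sub>2\<bar> / \<mu>\<^sub>1" using pos by (intro divide_right_mono mult_left_mono) auto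
      finally show ?thesis .
    qed
    show "2 * \<mu>\<^sub>2 * (1 / \<mu>\<^sub>1 - ip V\<^sub>1 (T V\<^sub>2)) \<le> 2 * \<mu>\<^sub>2 * sqrt ?D"
      using diff inv pos by (intro mult_left_mono) auto
  qed
  finally show ?thesis .
qed

text \<open>Beyond the Cauchy property, two facts carry the equation to the limit: \<open>K\<close>
  of the union is closed in L2, and every test field of the union is eventually one of the
  approximating domains.\<close>

lemma eigenfield_limit:
  fixes \<Omega> :: "nat \<Rightarrow> vec3 set"
  assumes op: "\<And>n. open (\<Omega> n)" and mono: "mono \<Omega>" and bdd: "bounded (\<Union>n. \<Omega> n)"
    and V: "\<And>n. eigenfield (\<Omega> n) (\<mu> n) (V n)" and \<mu>: "\<And>n. \<mu> n > 0" "\<mu> \<longlonglongrightarrow> m" "m > 0"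
  shows "\<exists>W. eigenfield (\<Union>n. \<Omega> n) m W"
proof -
  let ?U = "\<Union>n. \<Omega> n"
  have opU: "open ?U" using op by blast
  have sub: "\<Omega> n \<subseteq> ?U" for n by blast
  obtain R where R: "R > 0" "?U \<subseteq> cball 0 R"
    using bdd unfolding bounded_pos by (metis mem_cball_0 subsetI)
  define e :: vec3 where "e = axis 1 1"
  define h where "h = 2 * R + 2"
  have slab: "in_slab ?U e h" unfolding e_def h_def using R by (intro in_slab_cball) auto
  have e: "norm e = 1" by (simp add: e_def)
  have h: "h > 0" using R by (simp add: h_def)
  define T where "T = vpot (rays e 0 h)"
  note v = eigenfieldD[OF V]
  have v0: "V n x = 0" if "x \<notin> ?U" for n x using v(2)[of x n] that by blast
  obtain r where r: "strict_mono (r :: nat \<Rightarrow> nat)"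
    and Tr: "\<And>\<epsilon>. \<epsilon> > 0 \<Longrightarrow> \<exists>N. \<forall>i\<ge>N. \<forall>j\<ge>N. (\<integral>x. indicator (cball 0 R) x *
        (norm (T (V (r i)) x - T (V (r j)) x))\<^sup>2 \<partial>lborel) < \<epsilon>"
  proof (rule vpot_rays_compact[OF e h, of V R])
    show "V n x = 0" if "x \<notin> cball 0 R" for n x using v0[of x n] that R by blast
  qed (use v in \<open>auto simp: T_def\<close>)
  define W where "W i = V (r i)" for i
  define \<nu> where "\<nu> i = \<mu> (r i)" for i
  have \<nu>: "\<nu> i > 0" "\<nu> \<longlonglongrightarrow> m" for i
    using \<mu>(1) LIMSEQ_subseq_LIMSEQ[OF \<mu>(2) r] by (auto simp: \<nu>_def[abs_def] o_def)
  have W: "eigenfield (\<Omega> (r i)) (\<nu> i) (W i)" for i using V by (simp add: W_def \<nu>_def)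
  note w = eigenfieldD[OF W]
  have W0: "W i x = 0" if "x \<notin> ?U" for i x using v0 that by (simp add: W_def)
  have WK: "W i \<in> Kspace ?U" for i by (rule Kspace_mono[OF op opU sub w(1-3)])
  have dist: "normsq lborel (\<lambda>x. W i x - W j x) \<le> 2 * \<bar>\<nu> i - \<nu> j\<bar> / \<nu> i
      + 2 * \<nu> j * sqrt (\<integral>x. indicator (cball 0 R) x * (norm (T (W i) x - T (W j) x))\<^sup>2 \<partial>lborel)" if "i \<le> j" for i j
    unfolding T_def
  proof (rule eigenfields_distance[OF op op _ _ _ _ W W \<nu>(1) \<nu>(1)])
    have "r i \<le> r j" using that r by (simp add: strict_mono_less_eq)
    then show "\<Omega> (r i) \<subseteq> \<Omega> (r j)" by (rule monoD[OF mono])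
    show "bounded (\<Omega> (r j))" using bdd sub bounded_subset by blast
    show "in_slab (\<Omega> (r j)) e h" by (rule in_slab_subset[OF slab sub])
    show "\<Omega> (r j) \<subseteq> cball 0 R" using R(2) sub by blast
  qed
  have Cauchy: "\<exists>N. \<forall>i\<ge>N. \<forall>j\<ge>N. normsq lborel (\<lambda>x. W i x - W j x) < \<epsilon>" if "\<epsilon> > 0" for \<epsilon>
  proof -
    \<comment> \<open>\<open>m / 2\<close> keeps the eigenvalues between \<open>m / 2\<close> and
      \<open>3 m / 2\<close>; \<open>\<epsilon> m / 32\<close> makes the eigenvalue term at most
      \<open>\<epsilon> / 4\<close>. The operator term is at most \<open>3 \<epsilon> / 8\<close>,
      so the sum stays below \<open>\<epsilon>\<close>.\<close>
    define \<eta> where "\<eta> = min (m / 2) (\<epsilon> * m / 32)"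
    have \<eta>: "\<eta> > 0" "\<eta> \<le> m / 2" "\<eta> \<le> \<epsilon> * m / 32" using \<open>m > 0\<close> \<open>\<epsilon> > 0\<close> by (auto simp: \<eta>_def)
    obtain N1 where N1: "\<And>i. i \<ge> N1 \<Longrightarrow> \<bar>\<nu> i - m\<bar> < \<eta>"
      using LIMSEQ_D[OF \<nu>(2) \<eta>(1)] by auto
    obtain N2 where N2: "\<And>i j. i \<ge> N2 \<Longrightarrow> j \<ge> N2 \<Longrightarrow> (\<integral>x. indicator (cball 0 R) x *
        (norm (T (W i) x - T (W j) x))\<^sup>2 \<partial>lborel) < (\<epsilon> / (8 * m))\<^sup>2"
      using Tr[of "(\<epsilon> / (8 * m))\<^sup>2"] \<open>m > 0\<close> \<open>\<epsilon> > 0\<close> unfolding W_def by auto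
    have le: "normsq lborel (\<lambda>x. W i x - W j x) < \<epsilon>" if ij: "i \<ge> max N1 N2" "j \<ge> max N1 N2" "i \<le> j" for i j
    proof -
      let ?D = "\<integral>x. indicator (cball 0 R) x * (norm (T (W i) x - T (W j) x))\<^sup>2 \<partial>lborel"
      have i: "\<bar>\<nu> i - m\<bar> < \<eta>" and j: "\<bar>\<nu> j - m\<bar> < \<eta>" using N1 ij by auto
      have "sqrt ?D < \<epsilon> / (8 * m)"
        using N2[of i j] ij \<open>m > 0\<close> \<open>\<epsilon> > 0\<close> by (intro real_less_lsqrt) auto
      moreover have "2 * \<nu> j \<le> 3 * m" using j \<eta>(2) by (simp add: abs_if split: if_splits)
      ultimately have 1: "2 * \<nu> j * sqrt ?D \<le> 3 * m * (\<epsilon> / (8 * m))"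
        using \<open>m > 0\<close> by (intro mult_mono[of "2 * \<nu> j"]) auto
      have "2 * \<bar>\<nu> i - \<nu> j\<bar> / \<nu> i \<le> 2 * (2 * \<eta>) / (m / 2)"
        using i j \<eta> \<open>m > 0\<close> by (intro frac_le) (auto simp: abs_if split: if_splits)
      also have "\<dots> \<le> \<epsilon> / 4" using \<eta>(3) \<open>m > 0\<close> by (simp add: field_simps)
      finally have 2: "2 * \<bar>\<nu> i - \<nu> j\<bar> / \<nu> i \<le> \<epsilon> / 4" .
      have "3 * m * (\<epsilon> / (8 * m)) = 3 * \<epsilon> / 8" using \<open>m > 0\<close> by simp
      then show ?thesis using dist[OF ij(3)] 1 2 \<open>\<epsilon> > 0\<close> by argo
    qed
    \<comment> \<open>The estimate relies on the nesting of the domains, so the other order of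
      indices follows by symmetry of the distance.\<close>
    have "normsq lborel (\<lambda>x. W i x - W j x) < \<epsilon>" if "i \<ge> max N1 N2" "j \<ge> max N1 N2" for i j
      using le[OF that] le[OF that(2,1)] by (cases "i \<le> j") (auto simp: norm_minus_commute)
    then show ?thesis by blast
  qed
  \<comment> \<open>Completeness is applied on the union, which has finite measure; the fields
    vanish outside, so distances are the same as on the whole space.\<close>
  have WL: "sq_int (lebesgue_on ?U) (W i)" for i by (rule sq_int_lebesgue_on[OF opU w(1)])
  have fin: "finite_measure (lebesgue_on ?U)"
    using bdd opU by (intro finite_measure_lebesgue_on lmeasurable_open)
  have CauchyL: "\<exists>N. \<forall>i\<ge>N. \<forall>j\<ge>N. normsq (lebesgue_on ?U) (\<lambda>x. W i x - W j x) < \<epsilon>" if "\<epsilon> > 0" for \<epsilon>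
  proof -
    have "normsq (lebesgue_on ?U) (\<lambda>x. W i x - W j x) = normsq lborel (\<lambda>x. W i x - W j x)" for i j
      by (rule L2_dist_lebesgue_on[OF opU sq_int_diff[OF w(1) w(1)]]) (simp add: W0)
    then show ?thesis using Cauchy[OF that] by simp
  qed
  obtain v' where v': "sq_int (lebesgue_on ?U) v'" "(\<lambda>n. \<integral>x. (norm (W n x - v' x))\<^sup>2 \<partial>lebesgue_on ?U) \<longlonglongrightarrow> 0"
    using L2_complete[OF fin WL CauchyL] by blast
  obtain X where X: "sq_int lborel X" "\<And>x. x \<notin> ?U \<Longrightarrow> X x = 0" "AE x in lebesgue_on ?U. X x = v' x"
    using borel_representative[OF opU, of v'] v'(1) by (auto simp: L2_iff_sq_int)
  have XL: "sq_int (lebesgue_on ?U) X" by (rule sq_int_lebesgue_on[OF opU X(1)])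
  have eq: "normsq (lebesgue_on ?U) (\<lambda>x. W n x - v' x) = normsq (lebesgue_on ?U) (\<lambda>x. W n x - X x)" for n
  proof (rule integral_cong_AE)
    show "(\<lambda>x. (norm (W n x - v' x))\<^sup>2) \<in> borel_measurable (lebesgue_on ?U)"
      by (rule borel_measurable_integrable[OF sq_intD(2)[OF sq_int_diff[OF WL v'(1)]]])
    show "(\<lambda>x. (norm (W n x - X x))\<^sup>2) \<in> borel_measurable (lebesgue_on ?U)"
      by (rule borel_measurable_integrable[OF sq_intD(2)[OF sq_int_diff[OF WL XL]]])
    show "AE x in lebesgue_on ?U. (norm (W n x - v' x))\<^sup>2 = (norm (W n x - X x))\<^sup>2"
      using X(3) by eventually_elim simp
  qed
  have limL: "(\<lambda>n. \<integral>x. (norm (W n x - X x))\<^sup>2 \<partial>lebesgue_on ?U) \<longlonglongrightarrow> 0" using v'(2) unfolding eq .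
  have eq2: "normsq (lebesgue_on ?U) (\<lambda>x. W n x - X x) = normsq lborel (\<lambda>x. W n x - X x)" for n
    by (rule L2_dist_lebesgue_on[OF opU sq_int_diff[OF w(1) X(1)]]) (simp add: W0 X(2))
  have lim: "(\<lambda>n. \<integral>x. (norm (W n x - X x))\<^sup>2 \<partial>lborel) \<longlonglongrightarrow> 0" using limL unfolding eq2 .
  have "eigenfield ?U m X"
    unfolding eigenfield_def
  proof (intro conjI allI impI)
    show "X \<in> Kspace ?U"
      unfolding Kspace_def
    proof (intro CollectI conjI ballI impI)
      show "X \<in> L2 ?U" using XL by (simp add: L2_iff_sq_int)
      fix z assume z: "z \<in> L2 ?U" "weak_curl ?U z (\<lambda>_. 0)"
      have "L2_inner ?U (W n) z = 0" for n using WK[of n] z by (simp add: Kspace_def)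
      then show "L2_inner ?U X z = 0"
        using L2_inner_tendsto[OF WL XL _ limL, of z] z(1) LIMSEQ_unique[OF _ tendsto_const]
        by (simp add: L2_inner_def L2_iff_sq_int)
    qed
    show "normsq lborel X = 1"
      using L2_norm_tendsto[OF w(1) X(1) lim] w(4) LIMSEQ_unique[OF _ tendsto_const] by simp
    fix \<phi> assume \<phi>: "test_field ?U \<phi>"
    obtain N where N: "\<And>n. n \<ge> N \<Longrightarrow> closure {x. \<phi> x \<noteq> 0} \<subseteq> \<Omega> n"
      using compact_subset_increasing_union[OF test_fieldD(3,4)[OF \<phi>] op mono] by blast
    have "ip (W n) (curl \<phi>) = \<nu> n * ip (W n) \<phi>" if "n \<ge> N" for n
    proof (rule w(5))
      have "r n \<ge> N" using seq_suble[OF r, of n] that by simp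
      then show "test_field (\<Omega> (r n)) \<phi>" using \<phi> N unfolding test_field_def by blast
    qed
    then have ev: "eventually (\<lambda>n. ip (W n) (curl \<phi>) = \<nu> n * ip (W n) \<phi>) sequentially"
      by (auto simp: eventually_sequentially)
    have 1: "(\<lambda>n. \<integral>x. W n x \<bullet> curl \<phi> x \<partial>lborel) \<longlonglongrightarrow> (ip X (curl \<phi>))"
      by (rule L2_inner_tendsto[OF w(1) X(1) test_field_sq_int(2)[OF \<phi>] lim])
    have 2: "(\<lambda>n. \<nu> n * ip (W n) \<phi>) \<longlonglongrightarrow> m * ip X \<phi>"
      by (intro tendsto_mult \<nu>(2) L2_inner_tendsto[OF w(1) X(1) test_field_sq_int(1)[OF \<phi>] lim])
    show "ip X (curl \<phi>) = m * ip X \<phi>"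
      using LIMSEQ_unique[OF 1 Lim_transform_eventually[OF 2]] ev by (simp add: eq_commute)
  qed (use X in auto)
  then show ?thesis by blast
qed

section \<open>Homotheties\<close>

lemma test_field_affine:
  assumes \<phi>: "test_field A \<phi>" and s: "s \<noteq> 0" and B: "\<And>x. c + s *\<^sub>R x \<in> A \<Longrightarrow> x \<in> B"
  shows "test_field B (\<lambda>x. \<phi> (c + s *\<^sub>R x))" "curl (\<lambda>x. \<phi> (c + s *\<^sub>R x)) x = s *\<^sub>R curl \<phi> (c + s *\<^sub>R x)"
proof -
  let ?\<psi> = "\<lambda>x. \<phi> (c + s *\<^sub>R x)"
  have der: "(?\<psi> has_derivative (\<lambda>d. frechet_derivative \<phi> (at (c + s *\<^sub>R x)) (s *\<^sub>R d))) (at x)" for x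
  proof -
    have "((\<lambda>x. c + s *\<^sub>R x) has_derivative (\<lambda>d. s *\<^sub>R d)) (at x)" by (auto intro!: derivative_eq_intros)
    from has_derivative_compose[OF this test_field_has_derivative[OF \<phi>]] show ?thesis .
  qed
  have dd: "dd ?\<psi> j x = s *\<^sub>R dd \<phi> j (c + s *\<^sub>R x)" for j x
    using frechet_derivative_at[OF der[of x]] linear_frechet_derivative[OF test_fieldD(1)[OF \<phi>]]
    by (simp add: dd_def linear_cmul fun_eq_iff)
  show "curl ?\<psi> x = s *\<^sub>R curl \<phi> (c + s *\<^sub>R x)"
    by (simp add: curl_def pd_eq_dd dd vec_eq_iff forall_3 algebra_simps)
  let ?S = "closure {y. \<phi> y \<noteq> 0}" and ?G = "\<lambda>y. (1 / s) *\<^sub>R (y - c)"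
  have G: "compact (?G ` ?S)"
    by (intro compact_continuous_image test_fieldD(3)[OF \<phi>] continuous_intros)
  have sub: "closure {x. ?\<psi> x \<noteq> 0} \<subseteq> ?G ` ?S"
  proof (rule closure_minimal[OF _ compact_imp_closed[OF G]], rule subsetI)
    fix x assume "x \<in> {x. ?\<psi> x \<noteq> 0}"
    then have "c + s *\<^sub>R x \<in> ?S" using closure_subset[of "{y. \<phi> y \<noteq> 0}"] by auto
    moreover have "x = ?G (c + s *\<^sub>R x)" using s by simp
    ultimately show "x \<in> ?G ` ?S" by blast
  qed
  have "?G y \<in> B" if "y \<in> ?S" for y
    using B[of "?G y"] test_fieldD(4)[OF \<phi>] that s by auto
  then have "closure {x. ?\<psi> x \<noteq> 0} \<subseteq> B" using sub by blast
  moreover have "compact (closure {x. ?\<psi> x \<noteq> 0})"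
    using compact_Int_closed[OF G closed_closure, of "{x. ?\<psi> x \<noteq> 0}"] sub by (simp add: Int_absorb1)
  moreover have "?\<psi> differentiable (at x)" for x using der differentiable_def by blast
  moreover have "continuous_on UNIV (dd ?\<psi> j)" for j
    unfolding dd[abs_def]
    by (intro continuous_on_scaleR continuous_on_const continuous_on_compose2[OF test_fieldD(2)[OF \<phi>]] continuous_intros) auto
  ultimately show "test_field B ?\<psi>" unfolding test_field_def dd_def[abs_def] by simp
qed

text \<open>A competitor in the definition of \<open>K\<close> may be replaced by its Borel
  representative, so orthogonality is tested only against fields to which substitutions in
  \<open>lborel\<close> integrals apply.\<close>

lemma KspaceI:
  assumes \<Omega>: "open \<Omega>" and V: "sq_int lborel V" "\<And>x. x \<notin> \<Omega> \<Longrightarrow> V x = 0"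
    and orth: "\<And>w. sq_int lborel w \<Longrightarrow> (\<And>\<phi>. test_field \<Omega> \<phi> \<Longrightarrow> ip w (curl \<phi>) = 0) \<Longrightarrow>
      ip V w = 0"
  shows "V \<in> Kspace \<Omega>"
  unfolding Kspace_def
proof (intro CollectI conjI ballI impI)
  show VL: "V \<in> L2 \<Omega>" using sq_int_lebesgue_on[OF \<Omega> V(1)] by (simp add: L2_iff_sq_int)
  fix w assume w: "w \<in> L2 \<Omega>" "weak_curl \<Omega> w (\<lambda>_. 0)"
  obtain W where W: "sq_int lborel W" "\<And>x. x \<notin> \<Omega> \<Longrightarrow> W x = 0" "AE x in lebesgue_on \<Omega>. W x = w x"
    using borel_representative[OF \<Omega> w(1)] by blast
  have WL: "W \<in> L2 \<Omega>" using sq_int_lebesgue_on[OF \<Omega> W(1)] by (simp add: L2_iff_sq_int)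
  have "ip W (curl \<phi>) = 0" if \<phi>: "test_field \<Omega> \<phi>" for \<phi>
    using L2_inner_test_field(2)[OF \<Omega> \<phi> sq_int_lborelD[OF W(1)]] w(2) \<phi>
      L2_inner_cong_AE[OF WL w(1) test_field_L2(2)[OF \<Omega> \<phi>] W(3)] by (simp add: weak_curl_def L2_inner_def[of _ "\<lambda>_. 0"])
  then have "ip V W = 0" using orth[OF W(1)] by blast
  then have "L2_inner \<Omega> W V = 0"
    using L2_inner_lborel[OF \<Omega> sq_int_lborelD[OF W(1)] sq_int_lborelD[OF V(1)]] W(2) by (simp add: inner_commute)
  then have "L2_inner \<Omega> w V = 0" using L2_inner_cong_AE[OF WL w(1) VL W(3)] by simp
  then show "L2_inner \<Omega> V w = 0" by (simp add: L2_inner_def inner_commute)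
qed

text \<open>Curl has the dimension of an inverse length, hence the factor \<open>1 / s\<close>. Test
  fields and curl-free fields correspond under the homothety, and therefore so do the spaces
  \<open>K\<close>. The case \<open>s = 1\<close> covers translations.\<close>

lemma eigenfield_homothety:
  assumes \<Omega>: "open \<Omega>" and s: "s > 0" and V: "eigenfield \<Omega> \<mu> V"
  shows "\<exists>W. eigenfield ((\<lambda>x. c + s *\<^sub>R x) ` \<Omega>) (\<mu> / s) W"
proof -
  note v = eigenfieldD[OF V]
  define F where "F x = c + s *\<^sub>R x" for x :: vec3
  define G where "G y = (- (1 / s)) *\<^sub>R c + (1 / s) *\<^sub>R y" for y :: vec3
  have FG: "F (G y) = y" "G (F x) = x" for x y using s by (auto simp: F_def G_def algebra_simps)
  have mem: "F x \<in> F ` \<Omega> \<longleftrightarrow> x \<in> \<Omega>" "G y \<in> \<Omega> \<longleftrightarrow> y \<in> F ` \<Omega>" for x y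
    using FG by (metis imageE imageI)+
  have op: "open (F ` \<Omega>)"
  proof -
    have "F ` \<Omega> = G -` \<Omega>" using mem(2) by auto
    moreover have "continuous_on UNIV G" unfolding G_def[abs_def] by (intro continuous_intros)
    ultimately show ?thesis using \<Omega> by (simp add: open_vimage)
  qed
  have cov: "(\<integral>y. f y \<partial>lborel) = s ^ 3 * (\<integral>x. f (F x) \<partial>lborel)" if "f \<in> borel_measurable borel" for f :: "vec3 \<Rightarrow> real"
    using integral_lborel_affine[OF that, of s c] s by (simp add: F_def)
  have Gm: "G \<in> borel_measurable borel" "F \<in> borel_measurable borel"
    unfolding G_def[abs_def] F_def[abs_def] by (intro borel_measurable_continuous_onI continuous_intros)+
  \<comment> \<open>Compensates the Jacobian \<open>s ^ 3\<close>, so that the norm stays 1.\<close>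
  define a where "a = 1 / sqrt (s ^ 3)"
  have a: "a\<^sup>2 * s ^ 3 = 1" using s by (simp add: a_def power_divide)
  define W where "W y = a *\<^sub>R V (G y)" for y
  have sqG: "sq_int lborel (\<lambda>y. f (G y))" if "sq_int lborel f" for f :: "vec3 \<Rightarrow> vec3"
    using integrable_lborel_affine[OF sq_intD(2)[OF that], of "1 / s" "(- (1 / s)) *\<^sub>R c"] s
      measurable_compose[OF Gm(1) sq_int_lborelD[OF that]] by (simp add: sq_int_def G_def)
  have sqF: "sq_int lborel (\<lambda>y. f (F y))" if "sq_int lborel f" for f :: "vec3 \<Rightarrow> vec3"
    using integrable_lborel_affine[OF sq_intD(2)[OF that], of s c] s
      measurable_compose[OF Gm(2) sq_int_lborelD[OF that]] by (simp add: sq_int_def F_def)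
  have W1: "sq_int lborel W" unfolding W_def[abs_def] by (intro sq_int_scaleR sqG v(1))
  have W2: "W y = 0" if "y \<notin> F ` \<Omega>" for y using v(2)[of "G y"] mem(2)[of y] that by (simp add: W_def)
  have covW: "ip W f = s ^ 3 * a * ip V (\<lambda>x. f (F x))"
    if "f \<in> borel_measurable borel" for f
    using cov[OF borel_measurable_inner[OF sq_int_lborelD[OF W1] that]] by (simp add: W_def FG)
  have pull: "test_field \<Omega> (\<lambda>x. \<phi> (F x))" "curl (\<lambda>x. \<phi> (F x)) x = s *\<^sub>R curl \<phi> (F x)" if "test_field (F ` \<Omega>) \<phi>" for \<phi> x
    using test_field_affine[OF that, of s c \<Omega>] s mem(1) by (auto simp: F_def)
  have push: "test_field (F ` \<Omega>) (\<lambda>y. \<phi> (G y))" "curl (\<lambda>y. \<phi> (G y)) y = (1 / s) *\<^sub>R curl \<phi> (G y)" if "test_field \<Omega> \<phi>" for \<phi> y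
    using test_field_affine[OF that, of "1 / s" "(- (1 / s)) *\<^sub>R c" "F ` \<Omega>"] s mem(2) by (auto simp: G_def)
  have "eigenfield (F ` \<Omega>) (\<mu> / s) W"
    unfolding eigenfield_def
  proof (intro conjI allI impI)
    have "(\<lambda>y. (norm (W y))\<^sup>2) \<in> borel_measurable borel" using sq_int_lborelD[OF W1] by measurable
    from cov[OF this] have "normsq lborel W = s ^ 3 * (a\<^sup>2 * normsq lborel V)"
      by (simp add: W_def FG power_mult_distrib)
    then show "normsq lborel W = 1" using a v(4) by (simp add: mult.commute)
    show "W \<in> Kspace (F ` \<Omega>)"
    proof (rule KspaceI[OF op W1 W2])
      fix w assume w: "sq_int lborel w" "\<And>\<phi>. test_field (F ` \<Omega>) \<phi> \<Longrightarrow> ip w (curl \<phi>) = 0"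
      have "ip V (\<lambda>x. w (F x)) = 0"
      proof (rule Kspace_orthogonal[OF \<Omega> v(1-3) sqF[OF w(1)]])
        fix \<phi> assume \<phi>: "test_field \<Omega> \<phi>"
        have "0 = ip w (\<lambda>y. curl (\<lambda>y. \<phi> (G y)) y)" using w(2)[OF push(1)[OF \<phi>]] by simp
        also have "\<dots> = s ^ 3 * ip (\<lambda>x. w (F x)) (\<lambda>x. ((1 / s) *\<^sub>R curl \<phi> x))"
          using cov[OF borel_measurable_inner[OF sq_int_lborelD[OF w(1)]
            sq_int_lborelD[OF test_field_sq_int(2)[OF push(1)[OF \<phi>]]]]] by (simp add: push(2)[OF \<phi>] FG)
        finally show "ip (\<lambda>x. w (F x)) (curl \<phi>) = 0" using s by simp
      qed
      then show "ip W w = 0" using covW[OF sq_int_lborelD[OF w(1)]] by simp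
    qed
    fix \<phi> assume \<phi>: "test_field (F ` \<Omega>) \<phi>"
    have "ip W (curl \<phi>) = s ^ 3 * a * ip V (\<lambda>x. ((1 / s) *\<^sub>R curl (\<lambda>x. \<phi> (F x)) x))"
      using covW[OF sq_int_lborelD[OF test_field_sq_int(2)[OF \<phi>]]] s by (simp add: pull(2)[OF \<phi>])
    also have "\<dots> = s ^ 3 * a * ((1 / s) * (\<mu> * ip V (\<lambda>x. \<phi> (F x))))"
      using v(5)[OF pull(1)[OF \<phi>]] by simp
    also have "\<dots> = \<mu> / s * ip W \<phi>"
      using covW[OF sq_int_lborelD[OF test_field_sq_int(1)[OF \<phi>]]] by simp
    finally show "ip W (curl \<phi>) = \<mu> / s * ip W \<phi>" .
  qed (use W1 W2 in auto)
  then show ?thesis unfolding F_def[abs_def] by blast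
qed

section \<open>Axially symmetric convex domains\<close>

text \<open>Rodrigues' formula for the rotation about the unit vector \<open>d\<close>, with
  \<open>c\<close> and \<open>s\<close> in place of the cosine and sine of the angle; as a pair of
  numbers they can be solved for algebraically.\<close>

definition rot :: "vec3 \<Rightarrow> real \<Rightarrow> real \<Rightarrow> vec3 \<Rightarrow> vec3" where
  "rot d c s x = (x \<bullet> d) *\<^sub>R d + c *\<^sub>R (x - (x \<bullet> d) *\<^sub>R d) + s *\<^sub>R cross3 d x"

text \<open>The axis passes through the origin. Points with given \<open>x \<bullet> d\<close> and
  given norm form one orbit of the rotations about \<open>d\<close>, so this is rotational symmetry
  stated without matrices.\<close>

definition axially_invariant :: "vec3 \<Rightarrow> vec3 set \<Rightarrow> bool" where
  "axially_invariant d \<Omega> \<longleftrightarrow> norm d = 1 \<and> (\<forall>x y. x \<in> \<Omega> \<longrightarrow> x \<bullet> d = y \<bullet> d \<longrightarrow> norm x = norm y \<longrightarrow> y \<in> \<Omega>)"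

lemma axially_invariantD:
  "axially_invariant d \<Omega> \<Longrightarrow> x \<in> \<Omega> \<Longrightarrow> x \<bullet> d = y \<bullet> d \<Longrightarrow> norm x = norm y \<Longrightarrow> y \<in> \<Omega>"
  unfolding axially_invariant_def by blast

lemma cross3_cross3: "cross3 d (cross3 e x) = (d \<bullet> x) *\<^sub>R e - (d \<bullet> e) *\<^sub>R (x::vec3)"
  by (simp add: cross3_simps forall_3)

lemma inner_self_unit: "norm d = 1 \<Longrightarrow> d \<bullet> d = 1"
  by (simp add: power2_norm_eq_inner[symmetric])

lemma rot_inner_axis:
  assumes "norm d = 1" shows "rot d c s x \<bullet> d = x \<bullet> d"
  using inner_self_unit[OF assms] dot_cross_self[of d x] dot_cross_self[of x d] by (simp add: rot_def inner_add_left inner_diff_left)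

lemma linear_rot: "linear (rot d c s)"
  by (rule linearI) (simp_all add: rot_def algebra_simps cross_add_right cross_mult_right)

text \<open>Pythagoras: the three summands are orthogonal, and \<open>cross3 d x\<close> is as long
  as the component of \<open>x\<close> perpendicular to \<open>d\<close>.\<close>

lemma norm_rot:
  assumes d: "norm d = 1" and cs: "c\<^sup>2 + s\<^sup>2 = 1"
  shows "norm (rot d c s x) = norm x"
proof -
  define x' where "x' = x - (x \<bullet> d) *\<^sub>R d"
  have dd: "d \<bullet> d = 1" by (rule inner_self_unit[OF d])
  have 1: "x' \<bullet> d = 0" "d \<bullet> x' = 0" by (simp_all add: x'_def inner_diff_left inner_diff_right dd inner_commute)
  have 2: "cross3 d x \<bullet> d = 0" "d \<bullet> cross3 d x = 0" "x' \<bullet> cross3 d x = 0" "cross3 d x \<bullet> x' = 0"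
    using dot_cross_self[of d x] dot_cross_self[of x d] by (simp_all add: x'_def inner_diff_left inner_diff_right)
  have xx: "x' \<bullet> x' = x \<bullet> x - (x \<bullet> d)\<^sup>2"
    by (simp add: x'_def inner_diff_left inner_diff_right dd inner_commute power2_eq_square)
  have cc: "cross3 d x \<bullet> cross3 d x = x \<bullet> x - (x \<bullet> d)\<^sup>2"
    using norm_cross_dot[of d x] d by (simp add: power2_norm_eq_inner inner_commute algebra_simps)
  have "rot d c s x \<bullet> rot d c s x = (x \<bullet> d)\<^sup>2 + c\<^sup>2 * (x' \<bullet> x') + s\<^sup>2 * (cross3 d x \<bullet> cross3 d x)"
    unfolding rot_def x'_def[symmetric]
    by (simp add: inner_add_left inner_add_right dd 1 2 power2_eq_square)
  also have "\<dots> = (x \<bullet> d)\<^sup>2 + (c\<^sup>2 + s\<^sup>2) * (x \<bullet> x - (x \<bullet> d)\<^sup>2)"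
    unfolding xx cc by (simp add: algebra_simps)
  also have "\<dots> = x \<bullet> x" by (simp add: cs)
  finally show ?thesis by (simp add: norm_eq_sqrt_inner)
qed

lemma rot_rot:
  assumes "norm d = 1"
  shows "rot d c s (rot d c' s' x) = rot d (c * c' - s * s') (s * c' + c * s') x"
proof -
  have dd: "d \<bullet> d = 1" by (rule inner_self_unit[OF assms])
  have cr: "cross3 d (rot d c' s' x) = c' *\<^sub>R cross3 d x + s' *\<^sub>R ((x \<bullet> d) *\<^sub>R d - x)"
    by (simp add: rot_def cross_add_right cross_mult_right Cross3.right_diff_distrib cross3_cross3 dd inner_commute)
  show ?thesis
    unfolding rot_def[of d c s] rot_inner_axis[OF assms] cr by (simp add: rot_def algebra_simps)
qed

text \<open>The rotation is the square of the rotation by half the angle, so its determinant is the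
  square of plus or minus 1.\<close>

lemma rot_matrix:
  assumes d: "norm d = 1" and cs: "c\<^sup>2 + s\<^sup>2 = 1"
  obtains R :: "real^3^3" where "orthogonal_matrix R" "det R = 1" "\<And>x. R *v x = rot d c s x"
proof -
  obtain t where t: "c = cos t" "s = sin t" using sincos_total_2pi[of c s] cs by metis
  let ?S = "matrix (rot d (cos (t/2)) (sin (t/2))) :: real^3^3"
  have S: "?S *v x = rot d (cos (t/2)) (sin (t/2)) x" for x by (rule fun_cong[OF matrix_vector_mul(2)[OF linear_rot]])
  have "orthogonal_transformation (rot d (cos (t/2)) (sin (t/2)))"
    unfolding orthogonal_transformation using linear_rot norm_rot[OF d] by simp
  then have orth: "orthogonal_matrix ?S" using orthogonal_transformation_matrix by blast
  have "det ?S * det ?S = 1" using det_orthogonal_matrix[OF orth] by auto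
  then have "det (?S ** ?S) = 1" by (simp add: det_mul)
  moreover have "orthogonal_matrix (?S ** ?S)" using orth by (rule orthogonal_matrix_mul[OF _ orth])
  moreover have "(?S ** ?S) *v x = rot d c s x" for x
  proof -
    have "cos (t/2) * cos (t/2) - sin (t/2) * sin (t/2) = c" "sin (t/2) * cos (t/2) + cos (t/2) * sin (t/2) = s"
      using cos_add[of "t/2" "t/2"] sin_add[of "t/2" "t/2"] t by simp_all
    then show ?thesis by (simp add: matrix_vector_mul_assoc[symmetric] S rot_rot[OF d])
  qed
  ultimately show thesis using that by blast
qed

text \<open>In the plane perpendicular to \<open>d\<close>, the vectors \<open>x'\<close> and
  \<open>z\<close> form an orthogonal frame of equal lengths; \<open>c\<close> and \<open>s\<close>
  are the coordinates of \<open>y'\<close> in it. If \<open>q = 0\<close>, both points lie on the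
  axis and coincide.\<close>

lemma rot_transitive:
  assumes d: "norm d = 1" and xy: "x \<bullet> d = y \<bullet> d" "norm x = norm y"
  obtains c s where "c\<^sup>2 + s\<^sup>2 = 1" "rot d c s x = y"
proof -
  have dd: "d \<bullet> d = 1" by (rule inner_self_unit[OF d])
  define x' where "x' = x - (x \<bullet> d) *\<^sub>R d"
  define y' where "y' = y - (x \<bullet> d) *\<^sub>R d"
  have xd: "x' \<bullet> d = 0" "y' \<bullet> d = 0" by (simp_all add: x'_def y'_def inner_diff_left dd xy(1))
  have "x \<bullet> x = y \<bullet> y" using xy(2) by (simp add: norm_eq)
  then have nn: "x' \<bullet> x' = y' \<bullet> y'"
    using xy(1) by (simp add: x'_def y'_def inner_diff_left inner_diff_right dd inner_commute)
  define q where "q = x' \<bullet> x'"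
  define z where "z = cross3 d x'"
  have zx: "z = cross3 d x"
    by (simp add: z_def x'_def Cross3.right_diff_distrib cross_mult_right)
  show thesis
  proof (cases "q = 0")
    case True
    then have "x' = 0" "y' = 0" using nn by (auto simp: q_def)
    then have "rot d 1 0 x = y" by (simp add: rot_def x'_def y'_def)
    then show ?thesis by (intro that[of 1 0]) auto
  next
    case False
    define c where "c = (x' \<bullet> y') / q"
    define s where "s = (z \<bullet> y') / q"
    have zz: "z \<bullet> z = q" using norm_cross_dot[of d x'] d xd
      by (simp add: z_def q_def power2_norm_eq_inner inner_commute)
    have xz: "x' \<bullet> z = 0" "z \<bullet> x' = 0" using dot_cross_self(2)[of x' d] by (simp_all add: z_def inner_commute)
    have "cross3 y' z = (x' \<bullet> y') *\<^sub>R d" unfolding z_def cross3_cross3 using xd by (simp add: inner_commute)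
    then have "(x' \<bullet> y')\<^sup>2 + (y' \<bullet> z)\<^sup>2 = (norm y' * norm z)\<^sup>2" using norm_cross_dot[of y' z] d by simp
    also have "\<dots> = q * q" using nn zz by (simp add: power_mult_distrib power2_norm_eq_inner q_def)
    finally have sum: "(x' \<bullet> y')\<^sup>2 + (z \<bullet> y')\<^sup>2 = q * q" by (simp add: inner_commute)
    have cs: "c\<^sup>2 + s\<^sup>2 = 1"
      using sum False by (simp add: c_def s_def power_divide add_divide_distrib[symmetric] power2_eq_square)
    have xy': "x' \<bullet> y' = c * q" "y' \<bullet> x' = c * q" "z \<bullet> y' = s * q" "y' \<bullet> z = s * q"
      using False by (simp_all add: c_def s_def inner_commute)
    \<comment> \<open>The difference has squared length \<open>q + q - 2 q = 0\<close>.\<close>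
    have "(y' - (c *\<^sub>R x' + s *\<^sub>R z)) \<bullet> (y' - (c *\<^sub>R x' + s *\<^sub>R z)) = q + (c\<^sup>2 + s\<^sup>2) * q - 2 * (c\<^sup>2 + s\<^sup>2) * q"
      using nn by (simp add: inner_diff_left inner_diff_right inner_add_left inner_add_right xy' xz zz q_def[symmetric]
          power2_eq_square algebra_simps)
    then have "y' = c *\<^sub>R x' + s *\<^sub>R z" by (simp add: cs)
    moreover have "y = (x \<bullet> d) *\<^sub>R d + y'" by (simp add: y'_def)
    ultimately have "rot d c s x = y" by (simp add: rot_def x'_def[symmetric] zx[symmetric])
    then show ?thesis using that cs by blast
  qed
qed

text \<open>Translating by the point \<open>a\<close> puts the axis through the origin. Two points
  of equal height and norm are related by a Rodrigues rotation, and that is one of the matrices in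
  the definition of axial symmetry.\<close>

lemma axially_symmetric_imp_invariant:
  assumes "axially_symmetric \<Omega>"
  obtains a d where "axially_invariant d ((\<lambda>x. x - a) ` \<Omega>)"
proof -
  obtain a d0 :: vec3 where d0: "d0 \<noteq> 0" and inv: "\<And>R::real^3^3. orthogonal_matrix R \<Longrightarrow> det R = 1 \<Longrightarrow> R *v d0 = d0 \<Longrightarrow>
      (\<lambda>x. a + R *v (x - a)) ` \<Omega> = \<Omega>"
    using assms unfolding axially_symmetric_def by blast
  define d where "d = (1 / norm d0) *\<^sub>R d0"
  have d: "norm d = 1" "d0 = norm d0 *\<^sub>R d" using d0 by (simp_all add: d_def)
  have "axially_invariant d ((\<lambda>x. x - a) ` \<Omega>)"
    unfolding axially_invariant_def
  proof (intro conjI allI impI)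
    fix x y assume x: "x \<in> (\<lambda>x. x - a) ` \<Omega>" and xy: "x \<bullet> d = y \<bullet> d" "norm x = norm y"
    obtain c s where cs: "c\<^sup>2 + s\<^sup>2 = 1" "rot d c s x = y" using rot_transitive[OF d(1) xy] .
    obtain R :: "real^3^3" where R: "orthogonal_matrix R" "det R = 1" "\<And>x. R *v x = rot d c s x"
      using rot_matrix[OF d(1) cs(1)] by blast
    have "rot d c s d = d" using inner_self_unit[OF d(1)] by (simp add: rot_def)
    then have "R *v d0 = d0" using d(2) R(3)[of d0] linear_cmul[OF linear_rot, of d c s "norm d0" d] by simp
    then have "(\<lambda>x. a + R *v (x - a)) ` \<Omega> = \<Omega>" by (rule inv[OF R(1,2)])
    moreover obtain w where w: "w \<in> \<Omega>" "x = w - a" using x by blast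
    moreover have "a + R *v (w - a) = a + y" using cs(2) R(3)[of x] w(2) by simp
    moreover have "a + R *v (w - a) \<in> (\<lambda>x. a + R *v (x - a)) ` \<Omega>" using w(1) by (rule imageI)
    ultimately have "a + y \<in> \<Omega>" by simp
    then show "y \<in> (\<lambda>x. x - a) ` \<Omega>" by (auto intro!: image_eqI[of _ _ "a + y"])
  qed (rule d(1))
  then show thesis using that by blast
qed

text \<open>An orthogonal matrix that fixes \<open>d\<close> preserves the norm and the component
  along \<open>d\<close>; its transpose provides the preimages.\<close>

lemma axially_invariant_imp_symmetric:
  assumes "axially_invariant d \<Omega>"
  shows "axially_symmetric \<Omega>"
  unfolding axially_symmetric_def
proof (rule exI[of _ 0], rule exI[of _ d], intro conjI allI impI)
  show "d \<noteq> 0" using assms by (auto simp: axially_invariant_def)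
  fix R :: "real^3^3" assume R: "orthogonal_matrix R \<and> det R = 1 \<and> R *v d = d"
  then have ot: "orthogonal_transformation ((*v) R)" by (simp add: orthogonal_transformation_matrix)
  have inner: "(R *v x) \<bullet> d = x \<bullet> d" for x
    using ot R unfolding orthogonal_transformation_def by metis
  have norm: "norm (R *v x) = norm x" for x using ot by (simp add: orthogonal_transformation)
  have "R *v x \<in> \<Omega>" if "x \<in> \<Omega>" for x
    by (rule axially_invariantD[OF assms that]) (simp_all add: inner norm)
  moreover have "y \<in> (*v) R ` \<Omega>" if "y \<in> \<Omega>" for y
  proof -
    have eq: "R *v (transpose R *v y) = y"
      using R by (metis matrix_vector_mul_assoc matrix_vector_mul_lid orthogonal_matrix_def)
    have "transpose R *v y \<in> \<Omega>"
      by (rule axially_invariantD[OF assms that]) (use inner[of "transpose R *v y"] norm[of "transpose R *v y"] eq in simp_all)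
    then show ?thesis using eq by (metis imageI)
  qed
  ultimately show "(\<lambda>x. 0 + R *v (x - 0)) ` \<Omega> = \<Omega>" by auto
qed

text \<open>Half a turn sends \<open>x\<close> to its mirror image in the axis, and the midpoint of
  the two lies on the axis.\<close>

lemma axially_invariant_axis_point:
  assumes "axially_invariant d \<Omega>" "convex \<Omega>" "x \<in> \<Omega>"
  shows "(x \<bullet> d) *\<^sub>R d \<in> \<Omega>"
proof -
  have d: "norm d = 1" using assms(1) by (simp add: axially_invariant_def)
  note dd = inner_self_unit[OF d]
  let ?y = "(2 * (x \<bullet> d)) *\<^sub>R d - x"
  have "?y \<bullet> ?y = x \<bullet> x"
    by (simp add: inner_diff_left inner_diff_right dd inner_commute algebra_simps)
  then have "?y \<in> \<Omega>"
    by (intro axially_invariantD[OF assms(1,3)]) (simp_all add: norm_eq_sqrt_inner inner_diff_left dd)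
  from convexD[OF assms(2,3) this, of "1/2" "1/2"] show ?thesis by (simp add: algebra_simps)
qed

lemma axially_invariant_translate_axis:
  assumes "axially_invariant d \<Omega>"
  shows "axially_invariant d ((\<lambda>x. x - t *\<^sub>R d) ` \<Omega>)"
  unfolding axially_invariant_def
proof (intro conjI allI impI)
  show d: "norm d = 1" using assms by (simp add: axially_invariant_def)
  fix x y assume x: "x \<in> (\<lambda>x. x - t *\<^sub>R d) ` \<Omega>" and xy: "x \<bullet> d = y \<bullet> d" "norm x = norm y"
  have "x \<bullet> x = y \<bullet> y" using xy(2) by (simp add: norm_eq)
  then have "(x + t *\<^sub>R d) \<bullet> (x + t *\<^sub>R d) = (y + t *\<^sub>R d) \<bullet> (y + t *\<^sub>R d)"
    using xy(1) by (simp add: inner_add_left inner_add_right inner_commute)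
  then have "norm (x + t *\<^sub>R d) = norm (y + t *\<^sub>R d)" by (simp add: norm_eq_sqrt_inner)
  moreover have "x + t *\<^sub>R d \<in> \<Omega>" using x by auto
  ultimately have "y + t *\<^sub>R d \<in> \<Omega>"
    using axially_invariantD[OF assms] xy(1) by (simp add: inner_add_left)
  then show "y \<in> (\<lambda>x. x - t *\<^sub>R d) ` \<Omega>" by (auto intro!: image_eqI[of _ _ "y + t *\<^sub>R d"])
qed

lemma axially_invariant_scale:
  assumes "axially_invariant d \<Omega>" "s > 0"
  shows "axially_invariant d ((\<lambda>x. s *\<^sub>R x) ` \<Omega>)"
  unfolding axially_invariant_def
proof (intro conjI allI impI)
  show "norm d = 1" using assms by (simp add: axially_invariant_def)
  fix x y assume x: "x \<in> (\<lambda>x. s *\<^sub>R x) ` \<Omega>" and xy: "x \<bullet> d = y \<bullet> d" "norm x = norm y"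
  obtain w where w: "w \<in> \<Omega>" "x = s *\<^sub>R w" using x by blast
  have "(1 / s) *\<^sub>R y \<in> \<Omega>"
  proof (rule axially_invariantD[OF assms(1) w(1)])
    show "w \<bullet> d = (1 / s) *\<^sub>R y \<bullet> d" using xy(1) w(2) assms(2) by (simp add: field_simps)
    show "norm w = norm ((1 / s) *\<^sub>R y)" using xy(2) w(2) assms(2) by (simp add: field_simps)
  qed
  then show "y \<in> (\<lambda>x. s *\<^sub>R x) ` \<Omega>" using assms(2) by (auto intro!: image_eqI[of _ _ "(1 / s) *\<^sub>R y"])
qed

text \<open>If all points were close to the axis, a thin slab parallel to it would contain the
  domain; if all heights were close to that of \<open>p\<close>, a thin slab perpendicular to it
  would. So there are a disc of radius at least \<open>w / 4\<close> centred on the axis and an axis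
  point at distance at least \<open>w / 8\<close> from its centre; the cone they span contains the
  ball.\<close>

lemma axially_invariant_contains_ball:
  assumes inv: "axially_invariant d \<Omega>" and cvx: "convex \<Omega>" and ne: "\<Omega> \<noteq> {}" and w: "w > 0"
    and slab: "\<And>e h. in_slab \<Omega> e h \<Longrightarrow> w \<le> h"
  obtains t where "ball (t *\<^sub>R d) (w / 32) \<subseteq> \<Omega>"
proof -
  have d: "norm d = 1" using inv by (simp add: axially_invariant_def)
  note dd = inner_self_unit[OF d]
  note axis = axially_invariant_axis_point[OF inv cvx]
  have "\<exists>p\<in>\<Omega>. norm (p - (p \<bullet> d) *\<^sub>R d) \<ge> w / 4"
  proof (rule ccontr)
    assume "\<not> (\<exists>p\<in>\<Omega>. norm (p - (p \<bullet> d) *\<^sub>R d) \<ge> w / 4)"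
    then have small: "norm (x - (x \<bullet> d) *\<^sub>R d) < w / 4" if "x \<in> \<Omega>" for x using that by force
    obtain e :: vec3 where e: "norm e = 1" "d \<bullet> e = 0"
    proof -
      obtain z :: vec3 where z: "z \<noteq> 0" "orthogonal d z"
        using orthogonal_to_vector_exists[of d] by auto
      show thesis by (rule that[of "(1 / norm z) *\<^sub>R z"]) (use z in \<open>auto simp: orthogonal_def\<close>)
    qed
    have "in_slab \<Omega> e (w / 2)"
      unfolding in_slab_def
    proof (intro conjI exI[of _ "- w / 4"] subsetI)
      fix x assume "x \<in> \<Omega>"
      have "x \<bullet> e = (x - (x \<bullet> d) *\<^sub>R d) \<bullet> e" using e(2) by (simp add: inner_diff_left)
      then have "\<bar>x \<bullet> e\<bar> < w / 4"
        using Cauchy_Schwarz_ineq2[of "x - (x \<bullet> d) *\<^sub>R d" e] e(1) small[OF \<open>x \<in> \<Omega>\<close>] by simp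
      then have "- w / 4 < x \<bullet> e" "x \<bullet> e < - w / 4 + w / 2" unfolding abs_less_iff by linarith+
      then show "x \<in> {x. - w / 4 < x \<bullet> e \<and> x \<bullet> e < - w / 4 + w / 2}" by blast
    qed (use w e in auto)
    from slab[OF this] w show False by simp
  qed
  then obtain p where p: "p \<in> \<Omega>" "norm (p - (p \<bullet> d) *\<^sub>R d) \<ge> w / 4" by blast
  define k where "k = p \<bullet> d"
  define \<rho> where "\<rho> = norm (p - (p \<bullet> d) *\<^sub>R d)"
  have "\<exists>q\<in>\<Omega>. \<bar>q \<bullet> d - k\<bar> \<ge> w / 8"
  proof (rule ccontr)
    assume "\<not> (\<exists>q\<in>\<Omega>. \<bar>q \<bullet> d - k\<bar> \<ge> w / 8)"
    then have small: "\<bar>x \<bullet> d - k\<bar> < w / 8" if "x \<in> \<Omega>" for x using that by force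
    have "in_slab \<Omega> d (w / 4)"
      unfolding in_slab_def
    proof (intro conjI exI[of _ "k - w / 8"] subsetI)
      fix x assume "x \<in> \<Omega>"
      then have "k - w / 8 < x \<bullet> d" "x \<bullet> d < k - w / 8 + w / 4"
        using small[of x] unfolding abs_less_iff by linarith+
      then show "x \<in> {x. k - w / 8 < x \<bullet> d \<and> x \<bullet> d < k - w / 8 + w / 4}" by blast
    qed (use w d in auto)
    from slab[OF this] w show False by simp
  qed
  then obtain q where q: "q \<in> \<Omega>" "\<bar>q \<bullet> d - k\<bar> \<ge> w / 8" by blast
  define \<sigma> where "\<sigma> = q \<bullet> d - k"
  have \<rho>: "\<rho> \<ge> w / 4" "\<rho> > 0" using p(2) w by (auto simp: \<rho>_def)
  have \<sigma>: "\<bar>\<sigma>\<bar> \<ge> w / 8" using q(2) by (simp add: \<sigma>_def)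
  have kd: "k *\<^sub>R d \<in> \<Omega>" using axis[OF p(1)] by (simp add: k_def)
  have seg: "(k + l * \<sigma>) *\<^sub>R d \<in> \<Omega>" if "0 \<le> l" "l \<le> 1" for l
  proof -
    have "(1 - l) *\<^sub>R (k *\<^sub>R d) + l *\<^sub>R ((q \<bullet> d) *\<^sub>R d) \<in> \<Omega>"
      by (rule convexD[OF cvx kd axis[OF q(1)]]) (use that in auto)
    then show ?thesis by (simp add: \<sigma>_def algebra_simps)
  qed
  have disc: "k *\<^sub>R d + z \<in> \<Omega>" if z: "z \<bullet> d = 0" "norm z \<le> \<rho>" for z
  proof (cases "z = 0")
    case False
    let ?w = "(\<rho> / norm z) *\<^sub>R z"
    have zz: "z \<bullet> z > 0" "z \<bullet> z = norm z * norm z"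
      using False by (auto simp: power2_norm_eq_inner[symmetric] power2_eq_square)
    have "p \<bullet> p = k\<^sup>2 + \<rho>\<^sup>2"
      unfolding \<rho>_def k_def power2_norm_eq_inner
      by (simp add: inner_diff_left inner_diff_right dd inner_commute power2_eq_square)
    moreover have "(k *\<^sub>R d + ?w) \<bullet> (k *\<^sub>R d + ?w) = k\<^sup>2 + \<rho>\<^sup>2"
      using z(1) False by (simp add: inner_add_left inner_add_right dd inner_commute[of d z] zz(2) power2_eq_square)
    ultimately have "k *\<^sub>R d + ?w \<in> \<Omega>"
      using z(1) by (intro axially_invariantD[OF inv p(1)]) (simp_all add: norm_eq_sqrt_inner inner_add_left dd k_def)
    moreover have "norm z / \<rho> \<le> 1" using z(2) \<rho> by simp
    ultimately have "(1 - norm z / \<rho>) *\<^sub>R (k *\<^sub>R d) + (norm z / \<rho>) *\<^sub>R (k *\<^sub>R d + ?w) \<in> \<Omega>"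
      using \<rho> by (intro convexD[OF cvx kd]) auto
    moreover have "(1 - norm z / \<rho>) *\<^sub>R (k *\<^sub>R d) + (norm z / \<rho>) *\<^sub>R (k *\<^sub>R d + ?w) = k *\<^sub>R d + z"
      using \<rho> False by (simp add: algebra_simps)
    ultimately show ?thesis by simp
  qed (simp add: kd)
  have "ball ((k + \<sigma> / 4) *\<^sub>R d) (w / 32) \<subseteq> \<Omega>"
  proof
    fix x assume "x \<in> ball ((k + \<sigma> / 4) *\<^sub>R d) (w / 32)"
    define y where "y = x - (k + \<sigma> / 4) *\<^sub>R d"
    have y: "norm y < w / 32" using \<open>x \<in> _\<close> by (simp add: y_def dist_norm norm_minus_commute)
    define y' where "y' = y - (y \<bullet> d) *\<^sub>R d"
    have y'd: "y' \<bullet> d = 0" by (simp add: y'_def inner_diff_left dd)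
    have yd: "\<bar>y \<bullet> d\<bar> < w / 32" using Cauchy_Schwarz_ineq2[of y d] d y by simp
    have "norm y' \<le> norm y + \<bar>y \<bullet> d\<bar>" using norm_triangle_ineq4[of y "(y \<bullet> d) *\<^sub>R d"] d by (simp add: y'_def)
    then have "norm (2 *\<^sub>R y') \<le> \<rho>" using y yd \<rho> w by simp
    then have A: "k *\<^sub>R d + 2 *\<^sub>R y' \<in> \<Omega>" using y'd by (intro disc) auto
    have "\<sigma> \<noteq> 0" using \<sigma> w by auto
    \<comment> \<open>\<open>x\<close> is the midpoint of the disc point with offset
      \<open>2 y'\<close> and of an axis point, whose position on the segment is \<open>l\<close>.
      The radius \<open>w / 32\<close> keeps \<open>l\<close> between 0 and 1 and
      \<open>2 y'\<close> within the disc.\<close>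
    define l where "l = 1/2 + 2 * (y \<bullet> d) / \<sigma>"
    have "\<bar>2 * (y \<bullet> d) / \<sigma>\<bar> \<le> 1/2"
      using yd \<sigma> \<open>\<sigma> \<noteq> 0\<close> by (simp add: abs_divide divide_le_eq abs_mult)
    then have l: "0 \<le> l" "l \<le> 1" unfolding l_def abs_le_iff by linarith+
    have "(1/2) *\<^sub>R (k *\<^sub>R d + 2 *\<^sub>R y') + (1/2) *\<^sub>R ((k + l * \<sigma>) *\<^sub>R d) \<in> \<Omega>"
      by (rule convexD[OF cvx A seg[OF l]]) auto
    also have "(1/2) *\<^sub>R (k *\<^sub>R d + 2 *\<^sub>R y') + (1/2) *\<^sub>R ((k + l * \<sigma>) *\<^sub>R d) = y' + (k + \<sigma> / 4 + y \<bullet> d) *\<^sub>R d"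
    proof -
      have "(k + l * \<sigma>) = k + \<sigma> / 2 + 2 * (y \<bullet> d)" using \<open>\<sigma> \<noteq> 0\<close> by (simp add: l_def distrib_right)
      then show ?thesis by (simp add: algebra_simps flip: scaleR_add_left)
    qed
    also have "\<dots> = x" by (simp add: y'_def y_def algebra_simps)
    finally show "x \<in> \<Omega>" .
  qed
  then show thesis by (rule that)
qed

section \<open>Diameter bound and nested subsequences of convex bodies\<close>

text \<open>Up to halfway to \<open>x\<close>, the convex hull of \<open>x\<close> and the ball of
  radius \<open>r\<close> contains balls of radius \<open>r / 2\<close> centred on the segment.
  Disjoint such balls have total volume at most that of \<open>\<Omega>\<close>, which limits their
  number.\<close>

lemma convex_diameter_bound:
  fixes \<Omega> :: "'a::euclidean_space set"
  assumes cvx: "convex \<Omega>" and meas: "\<Omega> \<in> lmeasurable" and r: "r > 0" "ball 0 r \<subseteq> \<Omega>" and x: "x \<in> \<Omega>"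
  shows "norm x \<le> 2 * r * (measure lebesgue \<Omega> / measure lebesgue (ball (0::'a) (r / 2)) + 1)"
proof -
  define \<beta> where "\<beta> = measure lebesgue (ball (0::'a) (r / 2))"
  have \<beta>: "\<beta> > 0" using r by (simp add: \<beta>_def content_ball_pos)
  show ?thesis
  proof (cases "x = 0")
    case False
    \<comment> \<open>The centres are spaced by \<open>r\<close>, and about
      \<open>norm x / (2 r)\<close> of them fit into the first half of the segment.\<close>
    define N where "N = nat \<lfloor>norm x / (2 * r)\<rfloor>"
    have N: "norm x / (2 * r) - 1 \<le> real N" "real N \<le> norm x / (2 * r)"
      using r by (auto simp: N_def of_nat_nat)
    define c where "c i = (real i * r / norm x) *\<^sub>R x" for i
    have sub: "ball (c i) (r / 2) \<subseteq> \<Omega>" if "i < N" for i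
    proof
      fix y assume y: "y \<in> ball (c i) (r / 2)"
      define t where "t = real i * r / norm x"
      have "real i \<le> norm x / (2 * r)" using N(2) that by simp
      then have "real i * r * 2 \<le> norm x" using r by (simp add: field_simps)
      then have t: "0 \<le> t" "t \<le> 1/2" using False r by (auto simp: t_def field_simps)
      \<comment> \<open>Solves \<open>y = t x + (1 - t) z\<close>; it remains to see that
        \<open>z\<close> lies in the ball of radius \<open>r\<close>.\<close>
      define z where "z = (1 / (1 - t)) *\<^sub>R (y - c i)"
      have "norm (y - c i) < r / 2" using y by (simp add: dist_norm norm_minus_commute)
      moreover have "r / 2 \<le> r * (1 - t)" using t r by simp
      ultimately have "norm (y - c i) < r * (1 - t)" by linarith
      then have "norm z < r" using t by (simp add: z_def divide_less_eq)
      then have "z \<in> \<Omega>" using r(2) by auto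
      from convexD[OF cvx x this, of t "1 - t"] have "t *\<^sub>R x + (1 - t) *\<^sub>R z \<in> \<Omega>" using t by simp
      moreover have "(1 - t) *\<^sub>R z = y - c i" using t by (simp add: z_def)
      moreover have "t *\<^sub>R x = c i" by (simp add: c_def t_def)
      ultimately show "y \<in> \<Omega>" by simp
    qed
    have disj: "disjoint_family_on (\<lambda>i. ball (c i) (r / 2)) {..<N}"
      unfolding disjoint_family_on_def
    proof (intro ballI impI)
      fix i j assume "i \<in> {..<N}" "j \<in> {..<N}" "i \<noteq> j"
      have "c i - c j = ((real i - real j) * r / norm x) *\<^sub>R x"
        by (simp add: c_def scaleR_diff_left[symmetric] diff_divide_distrib left_diff_distrib)
      then have "dist (c i) (c j) = \<bar>real i - real j\<bar> * r" using False r by (simp add: dist_norm abs_mult)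
      moreover have "\<bar>real i - real j\<bar> \<ge> 1" using \<open>i \<noteq> j\<close> by linarith
      ultimately have "dist (c i) (c j) \<ge> r" using mult_right_mono[of 1 "\<bar>real i - real j\<bar>" r] r by simp
      then show "ball (c i) (r / 2) \<inter> ball (c j) (r / 2) = {}"
        by (intro disjoint_ballI) auto
    qed
    have "real N * \<beta> = (\<Sum>i<N. measure lebesgue (ball (c i) (r / 2)))"
    proof -
      have "measure lebesgue (ball (c i) (r / 2)) = \<beta>" for i
        unfolding \<beta>_def using r by (simp add: content_ball)
      then show ?thesis by simp
    qed
    also have "\<dots> = measure lebesgue (\<Union>i<N. ball (c i) (r / 2))"
    proof -
      have "emeasure lborel (ball (c i) (r / 2)) \<noteq> top" for i
        using emeasure_lborel_ball_finite[of "c i" "r / 2"] by auto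
      then show ?thesis using disj by (subst measure_finite_Union) auto
    qed
    also have "\<dots> \<le> measure lebesgue \<Omega>"
      using sub meas by (intro measure_mono_fmeasurable) (auto intro!: sets.finite_UN)
    finally have "real N \<le> measure lebesgue \<Omega> / \<beta>" using \<beta> by (simp add: field_simps)
    then have "norm x / (2 * r) \<le> measure lebesgue \<Omega> / \<beta> + 1" using N(1) by linarith
    then show ?thesis using r by (simp add: \<beta>_def field_simps)
  qed (use r \<beta> in \<open>simp add: \<beta>_def\<close>)
qed

text \<open>As in Blaschke's selection theorem, the distance functions are 1-Lipschitz, so a
  subsequence of them converges uniformly. Since every body contains \<open>ball 0 r\<close>, a
  distance below \<open>\<delta> r\<close> turns into inclusion after division by
  \<open>1 + \<delta>\<close>. The slightly smaller factor \<open>exp (- \<delta>)\<close> is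
  recorded because products of exponentials are easy to track.\<close>

lemma convex_bodies_nested_subsequence:
  fixes \<Omega> :: "nat \<Rightarrow> 'a::euclidean_space set"
  assumes cvx: "\<And>n. convex (\<Omega> n)" and r: "r > 0" "\<And>n. ball 0 r \<subseteq> \<Omega> n" and D: "\<And>n. \<Omega> n \<subseteq> cball 0 D"
  obtains p :: "nat \<Rightarrow> nat" where "strict_mono p"
    "\<And>j x. x \<in> \<Omega> (p j) \<Longrightarrow> exp (- ((1/2) ^ j)) *\<^sub>R x \<in> \<Omega> (p (Suc j))"
proof -
  have z: "0 \<in> \<Omega> n" for n using r(1) r(2)[of n] centre_in_ball by blast
  define F where "F n x = infdist x (\<Omega> n)" for n x
  have lip: "\<bar>F n x - F n y\<bar> \<le> dist x y" for n x y
    using infdist_triangle[of x "\<Omega> n" y] infdist_triangle[of y "\<Omega> n" x] by (auto simp: F_def dist_commute abs_le_iff)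
  have "\<exists>g k. continuous_on (cball 0 D) g \<and> strict_mono (k :: nat \<Rightarrow> nat) \<and>
      (\<forall>\<epsilon>>0. \<exists>N. \<forall>n x. n \<ge> N \<and> x \<in> cball 0 D \<longrightarrow> norm (F (k n) x - g x) < \<epsilon>)"
  proof (rule Arzela_Ascoli[of "cball 0 D" F D])
    show "norm (F n x) \<le> D" if "x \<in> cball 0 D" for n x
      using infdist_le[OF z, of x n] infdist_nonneg[of x "\<Omega> n"] that by (simp add: F_def)
    show "\<exists>d>0. \<forall>n y. y \<in> cball 0 D \<and> norm (x - y) < d \<longrightarrow> norm (F n x - F n y) < \<epsilon>" if "\<epsilon> > 0" for x \<epsilon>
      using lip that by (intro exI[of _ \<epsilon>]) (auto simp: dist_norm intro: le_less_trans)
  qed auto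
  then obtain g k where k: "strict_mono (k :: nat \<Rightarrow> nat)"
    and g: "\<And>\<epsilon>. \<epsilon> > 0 \<Longrightarrow> \<exists>N. \<forall>n x. n \<ge> N \<and> x \<in> cball 0 D \<longrightarrow> norm (F (k n) x - g x) < \<epsilon>" by blast
  have "\<exists>N. \<forall>n\<ge>N. \<forall>m\<ge>N. \<forall>x\<in>\<Omega> (k n). exp (- ((1/2) ^ j)) *\<^sub>R x \<in> \<Omega> (k m)" for j
  proof -
    define \<delta> :: real where "\<delta> = (1/2) ^ j"
    have \<delta>: "\<delta> > 0" by (simp add: \<delta>_def)
    then have "\<delta> * r / 2 > 0" using r(1) by simp
    from g[OF this] obtain N where N: "\<And>n x. n \<ge> N \<Longrightarrow> x \<in> cball 0 D \<Longrightarrow> norm (F (k n) x - g x) < \<delta> * r / 2"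
      by blast
    have "exp (- \<delta>) *\<^sub>R x \<in> \<Omega> (k m)" if "n \<ge> N" "m \<ge> N" "x \<in> \<Omega> (k n)" for n m x
    proof -
      have xD: "x \<in> cball 0 D" using D that(3) by blast
      have "F (k n) x = 0" using that(3) by (simp add: F_def)
      then have "F (k m) x < \<delta> * r" using N[OF that(1) xD] N[OF that(2) xD]
        unfolding real_norm_def abs_less_iff by linarith
      then obtain y where y: "y \<in> \<Omega> (k m)" "dist x y < \<delta> * r"
        using z[of "k m"] unfolding F_def infdist_def by (auto simp: cINF_less_iff split: if_splits)
      have "norm ((1 / \<delta>) *\<^sub>R (x - y)) < r" using y(2) \<delta> by (simp add: dist_norm divide_less_eq mult.commute)
      then have "(1 / \<delta>) *\<^sub>R (x - y) \<in> ball 0 r" by simp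
      then have w: "(1 / \<delta>) *\<^sub>R (x - y) \<in> \<Omega> (k m)" using r(2) by blast
      \<comment> \<open>\<open>x / (1 + \<delta>)\<close> is a convex combination of the nearby
        point \<open>y\<close> and of \<open>(x - y) / \<delta>\<close>, which lies in the inner
        ball.\<close>
      have "(1 / (1 + \<delta>)) *\<^sub>R y + (\<delta> / (1 + \<delta>)) *\<^sub>R ((1 / \<delta>) *\<^sub>R (x - y)) \<in> \<Omega> (k m)"
        using \<delta> by (intro convexD[OF cvx y(1) w]) (auto simp: add_divide_distrib[symmetric])
      also have "(1 / (1 + \<delta>)) *\<^sub>R y + (\<delta> / (1 + \<delta>)) *\<^sub>R ((1 / \<delta>) *\<^sub>R (x - y)) = (1 / (1 + \<delta>)) *\<^sub>R x"
        using \<delta> by (simp add: algebra_simps)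
      finally have "(1 / (1 + \<delta>)) *\<^sub>R x \<in> \<Omega> (k m)" .
      \<comment> \<open>Since \<open>1 + \<delta> \<le> exp \<delta>\<close>, this is a further
        contraction towards 0, which stays inside a convex set containing 0.\<close>
      moreover define l where "l = exp (- \<delta>) * (1 + \<delta>)"
      have "l \<le> 1" using exp_ge_add_one_self[of \<delta>] by (simp add: l_def exp_minus field_simps)
      moreover have "l \<ge> 0" using \<delta> by (simp add: l_def)
      ultimately have "(1 - l) *\<^sub>R 0 + l *\<^sub>R ((1 / (1 + \<delta>)) *\<^sub>R x) \<in> \<Omega> (k m)"
        by (intro convexD[OF cvx z]) auto
      then show ?thesis using \<delta> by (simp add: l_def)
    qed
    then show ?thesis unfolding \<delta>_def by blast
  qed
  then obtain N where N: "\<And>j n m x. n \<ge> N j \<Longrightarrow> m \<ge> N j \<Longrightarrow> x \<in> \<Omega> (k n) \<Longrightarrow> exp (- ((1/2) ^ j)) *\<^sub>R x \<in> \<Omega> (k m)"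
    by metis
  \<comment> \<open>The sum of the thresholds gives \<open>q j \<ge> N j\<close>; the summand
    \<open>j\<close> makes \<open>q\<close> strictly increasing.\<close>
  define q where "q j = (\<Sum>i\<le>j. N i) + j" for j
  have q: "strict_mono q" unfolding strict_mono_Suc_iff by (simp add: q_def)
  have qN: "q j \<ge> N j" "q (Suc j) \<ge> N j" for j
  proof -
    have "N j \<le> (\<Sum>i\<le>j. N i)" by (rule member_le_sum) auto
    then show "q j \<ge> N j" by (simp add: q_def)
    then show "q (Suc j) \<ge> N j" using strict_monoD[OF q, of j "Suc j"] by simp
  qed
  show thesis
  proof (rule that[of "k \<circ> q"])
    show "strict_mono (k \<circ> q)" using k q by (rule strict_mono_o)
  qed (use N[OF qN] in simp)
qed

text \<open>The slab estimate bounds every width from below by \<open>1 / (3 M)\<close>, and the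
  inscribed ball has radius 1/32 of that, hence 96. One translation puts the axis through the
  origin, another one along the axis centres the ball.\<close>

lemma axially_symmetric_normalised:
  assumes \<Omega>: "bounded_convex_domain \<Omega>" "axially_symmetric \<Omega>" and W: "eigenfield \<Omega> \<mu> W" and \<mu>: "0 < \<mu>" "\<mu> \<le> M"
  obtains \<Omega>\<^sub>1 d W\<^sub>1 where "open \<Omega>\<^sub>1" "convex \<Omega>\<^sub>1" "bounded \<Omega>\<^sub>1" "measure lebesgue \<Omega>\<^sub>1 = measure lebesgue \<Omega>"
    "axially_invariant d \<Omega>\<^sub>1" "ball 0 (1 / (96 * M)) \<subseteq> \<Omega>\<^sub>1" "eigenfield \<Omega>\<^sub>1 \<mu> W\<^sub>1"
proof -
  have bcd: "open \<Omega>" "\<Omega> \<noteq> {}" "bounded \<Omega>" "convex \<Omega>" using \<Omega>(1) by (auto simp: bounded_convex_domain_def)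
  have M: "M > 0" using \<mu> by simp
  have tr: "open ((+) c ` \<Omega>)" "convex ((+) c ` \<Omega>)" "bounded ((+) c ` \<Omega>)" "measure lebesgue ((+) c ` \<Omega>) = measure lebesgue \<Omega>"
    "\<exists>W'. eigenfield ((+) c ` \<Omega>) \<mu> W'" for c
    using bcd eigenfield_homothety[OF bcd(1) _ W, of 1 c]
    by (auto intro: open_translation convex_translation bounded_translation simp: measure_translation)
  obtain a d where inv: "axially_invariant d ((\<lambda>x. x - a) ` \<Omega>)"
    using axially_symmetric_imp_invariant[OF \<Omega>(2)] .
  have eqa: "(\<lambda>x. x - a) ` \<Omega> = (+) (- a) ` \<Omega>" by simp
  obtain W0 where W0: "eigenfield ((\<lambda>x. x - a) ` \<Omega>) \<mu> W0" using tr(5)[of "- a"] unfolding eqa by blast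
  have slab: "1 / (3 * M) \<le> h" if "in_slab ((\<lambda>x. x - a) ` \<Omega>) e h" for e h
  proof -
    have h: "h > 0" using that by (simp add: in_slab_def)
    have "1 \<le> 3 * h * \<mu>"
      by (rule eigenvalue_slab_bound[OF _ _ that W0 \<mu>(1)]) (use tr[of "- a"] in \<open>simp_all only: eqa\<close>)
    also have "\<dots> \<le> 3 * h * M" using \<mu>(2) h by (intro mult_left_mono) auto
    finally show ?thesis using M by (simp add: field_simps)
  qed
  have "convex ((\<lambda>x. x - a) ` \<Omega>)" "(\<lambda>x. x - a) ` \<Omega> \<noteq> {}" "1 / (3 * M) > 0"
    using tr(2)[of "- a"] bcd(2) M by (simp_all only: eqa) auto
  from axially_invariant_contains_ball[OF inv this slab]
  obtain t where t: "ball (t *\<^sub>R d) (1 / (3 * M) / 32) \<subseteq> (\<lambda>x. x - a) ` \<Omega>" .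
  let ?U = "(\<lambda>x. x - t *\<^sub>R d) ` (\<lambda>x. x - a) ` \<Omega>"
  have eqU: "?U = (+) (- (a + t *\<^sub>R d)) ` \<Omega>" by (auto simp: image_iff algebra_simps)
  have "ball 0 (1 / (96 * M)) \<subseteq> ?U"
  proof
    fix x assume "x \<in> ball (0::vec3) (1 / (96 * M))"
    then have "x + t *\<^sub>R d \<in> ball (t *\<^sub>R d) (1 / (3 * M) / 32)" by (simp add: dist_norm)
    then have "x + t *\<^sub>R d \<in> (\<lambda>x. x - a) ` \<Omega>" using t by blast
    then show "x \<in> ?U" by (rule image_eqI[rotated]) simp
  qed
  then show thesis
    using tr[of "- (a + t *\<^sub>R d)"] axially_invariant_translate_axis[OF inv, of t] that unfolding eqU by blast
qed

text \<open>The axes vary with \<open>n\<close>, so the rotation that carries \<open>y\<close> to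
  \<open>x\<close> about the limit axis is performed about \<open>d n\<close> instead. The image of
  \<open>y\<close> tends to \<open>x\<close>, hence lies in the open set \<open>\<Omega> N\<close>
  and in \<open>\<Omega> n\<close> for some \<open>n \<ge> N\<close>; the symmetry of
  \<open>\<Omega> n\<close> about \<open>d n\<close> leads back to \<open>y\<close>.\<close>

lemma axially_invariant_increasing_union:
  assumes inv: "\<And>n. axially_invariant (d n) (\<Omega> n)" and d: "d \<longlonglongrightarrow> l" and mono: "mono \<Omega>" and op: "\<And>n. open (\<Omega> n)"
  shows "axially_invariant l (\<Union>n. \<Omega> n)"
  unfolding axially_invariant_def
proof (intro conjI allI impI)
  have dn: "norm (d n) = 1" for n using inv by (simp add: axially_invariant_def)
  have "(\<lambda>n. norm (d n)) \<longlonglongrightarrow> norm l" by (rule tendsto_norm[OF d])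
  then show l: "norm l = 1" using LIMSEQ_unique[OF _ tendsto_const[of 1]] by (simp add: dn)
  fix x y assume "x \<in> (\<Union>n. \<Omega> n)" and xy: "x \<bullet> l = y \<bullet> l" "norm x = norm y"
  then obtain N where N: "x \<in> \<Omega> N" by blast
  obtain c s where cs: "c\<^sup>2 + s\<^sup>2 = 1" "rot l c s y = x"
    using rot_transitive[OF l xy(1)[symmetric] xy(2)[symmetric]] .
  have "(\<lambda>n. cross3 (d n) y) \<longlonglongrightarrow> cross3 l y"
    using continuous_cross[of _ d "\<lambda>_. y"] d
      isCont_tendsto_compose[of l "\<lambda>z. cross3 z y", OF _ d] continuous_cross[of "at l" "\<lambda>z. z" "\<lambda>_. y"] by simp
  then have "(\<lambda>n. rot (d n) c s y) \<longlonglongrightarrow> rot l c s y"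
    unfolding rot_def by (intro tendsto_intros d)
  then have "eventually (\<lambda>n. rot (d n) c s y \<in> \<Omega> N) sequentially"
    using cs(2) N op[of N] by (auto intro: topological_tendstoD)
  then have "eventually (\<lambda>n. rot (d n) c s y \<in> \<Omega> N \<and> n \<ge> N) sequentially"
    using eventually_ge_at_top[of N] by (rule eventually_conj)
  then obtain n where n: "rot (d n) c s y \<in> \<Omega> N" "n \<ge> N" by (auto simp: eventually_sequentially)
  then have "rot (d n) c s y \<in> \<Omega> n" using monoD[OF mono n(2)] by blast
  then have "y \<in> \<Omega> n"
    by (rule axially_invariantD[OF inv]) (simp_all add: rot_inner_axis[OF dn] norm_rot[OF dn cs(1)])
  then show "y \<in> (\<Union>n. \<Omega> n)" by blast
qed

lemma convex_increasing_union:
  assumes "\<And>n. convex (\<Omega> n)" "mono \<Omega>"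
  shows "convex (\<Union>n::nat. \<Omega> n)"
proof (rule convexI)
  fix x y and u v :: real assume "x \<in> (\<Union>n. \<Omega> n)" "y \<in> (\<Union>n. \<Omega> n)" and uv: "0 \<le> u" "0 \<le> v" "u + v = 1"
  then obtain i j where "x \<in> \<Omega> i" "y \<in> \<Omega> j" by blast
  then have "x \<in> \<Omega> (max i j)" "y \<in> \<Omega> (max i j)"
    using monoD[OF assms(2), of i "max i j"] monoD[OF assms(2), of j "max i j"] by auto
  then show "u *\<^sub>R x + v *\<^sub>R y \<in> (\<Union>n. \<Omega> n)" using convexD[OF assms(1) _ _ uv] by blast
qed

text \<open>The inscribed ball and the volume confine all domains to \<open>cball 0 D\<close>; this
  keeps the eigenvalues away from 0 and supplies the compactness. Since the scalings
  \<open>s j\<close> tend to 1, the rescaled eigenvalues and volumes have the limits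
  \<open>m\<close> and \<open>V\<close>.\<close>

lemma limit_domain:
  assumes \<Omega>: "\<And>n. open (\<Omega> n)" "\<And>n. convex (\<Omega> n)" "\<And>n. bounded (\<Omega> n)" "\<And>n. measure lebesgue (\<Omega> n) = V"
    and inv: "\<And>n. axially_invariant (d n) (\<Omega> n)" and r: "r > 0" "\<And>n. ball 0 r \<subseteq> \<Omega> n"
    and W: "\<And>n. eigenfield (\<Omega> n) (\<mu> n) (W n)" and \<mu>: "\<And>n. \<mu> n > 0" "\<mu> \<longlonglongrightarrow> m"
  shows "m > 0" "\<exists>U. bounded_convex_domain U \<and> measure lebesgue U = V \<and> axially_symmetric U \<and> curl_eigenvalue U m"
proof -
  define D where "D = 2 * r * (V / measure lebesgue (ball (0::vec3) (r / 2)) + 1)"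
  have D: "\<Omega> n \<subseteq> cball 0 D" for n
  proof
    fix x assume "x \<in> \<Omega> n"
    have "\<Omega> n \<in> lmeasurable" using \<Omega> by (intro lmeasurable_open)
    from convex_diameter_bound[OF \<Omega>(2) this r(1,2) \<open>x \<in> \<Omega> n\<close>]
    show "x \<in> cball 0 D" using \<Omega>(4) by (simp add: D_def)
  qed
  have "0 \<in> \<Omega> 0" using r(1) r(2)[of 0] centre_in_ball by blast
  then have D0: "D \<ge> 0" using D[of 0] by auto
  show m: "m > 0"
  proof -
    \<comment> \<open>A slab of width \<open>2 * D + 2\<close> contains every domain.\<close>
    have "1 / (3 * (2 * D + 2)) \<le> \<mu> n" for n
    proof -
      from eigenvalue_slab_bound[OF \<Omega>(1,3) in_slab_cball[OF D D0] W \<mu>(1)]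
      show ?thesis using D0 by (simp add: field_simps)
    qed
    then have "1 / (3 * (2 * D + 2)) \<le> m" by (intro LIMSEQ_le_const[OF \<mu>(2)]) auto
    moreover have "1 / (3 * (2 * D + 2)) > 0" using D0 by simp
    ultimately show ?thesis by linarith
  qed
  have "d n \<in> sphere 0 1" for n using inv by (simp add: axially_invariant_def)
  then obtain l k where k: "strict_mono (k :: nat \<Rightarrow> nat)" and l: "(d \<circ> k) \<longlonglongrightarrow> l"
    using compact_sphere[of "0::vec3" 1] unfolding compact_def by (metis (no_types, lifting))
  obtain p :: "nat \<Rightarrow> nat" where p: "strict_mono p"
    and nest: "\<And>j x. x \<in> \<Omega> (k (p j)) \<Longrightarrow> exp (- ((1/2) ^ j)) *\<^sub>R x \<in> \<Omega> (k (p (Suc j)))"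
    using convex_bodies_nested_subsequence[of "\<lambda>n. \<Omega> (k n)" r D] \<Omega>(2) r D by blast
  \<comment> \<open>\<open>s (Suc j) / s j = exp ((1/2) ^ j)\<close> is exactly the dilation that nests consecutive domains\<close>
  define s :: "nat \<Rightarrow> real" where "s j = exp (- 2 * (1/2) ^ j)" for j
  have s: "s j > 0" "s j \<le> 1" for j by (simp_all add: s_def)
  have slim: "s \<longlonglongrightarrow> 1"
  proof -
    have "(\<lambda>j. exp (- 2 * (1/2) ^ j)) \<longlonglongrightarrow> exp (- 2 * 0 :: real)"
      by (intro tendsto_intros LIMSEQ_realpow_zero) auto
    then show ?thesis by (simp add: s_def[abs_def])
  qed
  define q where "q j = k (p j)" for j
  define \<Theta> where "\<Theta> j = (\<lambda>x. s j *\<^sub>R x) ` \<Omega> (q j)" for j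
  let ?U = "\<Union>j. \<Theta> j"
  have op: "open (\<Theta> j)" for j unfolding \<Theta>_def using \<Omega>(1) s(1)[of j] by (intro open_scaling) auto
  have cvx: "convex (\<Theta> j)" for j unfolding \<Theta>_def by (intro convex_scaling \<Omega>(2))
  have "\<Theta> j \<subseteq> \<Theta> (Suc j)" for j
  proof
    fix y assume "y \<in> \<Theta> j"
    then obtain x where x: "x \<in> \<Omega> (q j)" "y = s j *\<^sub>R x" by (auto simp: \<Theta>_def)
    have "s j = s (Suc j) * exp (- ((1/2) ^ j))" by (simp add: s_def exp_add[symmetric])
    then have "y = s (Suc j) *\<^sub>R (exp (- ((1/2) ^ j)) *\<^sub>R x)" using x(2) by simp
    moreover have "exp (- ((1/2) ^ j)) *\<^sub>R x \<in> \<Omega> (q (Suc j))" using nest x(1) by (simp add: q_def)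
    ultimately show "y \<in> \<Theta> (Suc j)" unfolding \<Theta>_def by blast
  qed
  then have mono: "mono \<Theta>" by (rule mono_iff_le_Suc[THEN iffD2, OF allI])
  have bdd: "bounded ?U"
  proof (rule bounded_subset[OF bounded_cball[of 0 D]], rule subsetI)
    fix y assume "y \<in> ?U"
    then obtain j x where x: "x \<in> \<Omega> (q j)" "y = s j *\<^sub>R x" by (auto simp: \<Theta>_def)
    have "norm y \<le> 1 * norm x" unfolding x(2) norm_scaleR using s[of j] by (intro mult_right_mono) auto
    then show "y \<in> cball 0 D" using D[of "q j"] x(1) by auto
  qed
  have opU: "open ?U" using op by blast
  have cvxU: "convex ?U" by (rule convex_increasing_union[OF cvx mono])
  have q: "strict_mono q" unfolding q_def using strict_mono_o[OF k p] by (simp add: o_def)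
  have eig: "\<exists>Z. eigenfield (\<Theta> j) (\<mu> (q j) / s j) Z" for j
    using eigenfield_homothety[OF \<Omega>(1)[of "q j"] s(1)[of j] W[of "q j"], of 0] by (simp add: \<Theta>_def)
  then obtain Z where Z: "\<And>j. eigenfield (\<Theta> j) (\<mu> (q j) / s j) (Z j)" by metis
  have "(\<lambda>j. \<mu> (q j)) \<longlonglongrightarrow> m" using LIMSEQ_subseq_LIMSEQ[OF \<mu>(2) q] by (simp add: o_def)
  then have "(\<lambda>j. \<mu> (q j) / s j) \<longlonglongrightarrow> m / 1" by (intro tendsto_divide slim) auto
  then have "\<exists>X. eigenfield ?U m X"
    using \<mu>(1) s(1) m by (intro eigenfield_limit[OF op mono bdd Z]) auto
  then have "curl_eigenvalue ?U m" using curl_eigenvalue_iff[OF opU] by blast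
  moreover have "measure lebesgue ?U = V"
  proof (rule LIMSEQ_unique)
    show "(\<lambda>j. measure lebesgue (\<Theta> j)) \<longlonglongrightarrow> measure lebesgue ?U"
    proof (rule Lim_measure_incseq[OF _ mono])
      show "range \<Theta> \<subseteq> sets lebesgue" using op by auto
      show "emeasure lebesgue ?U \<noteq> \<infinity>" 
        unfolding infinity_ennreal_def by (rule fmeasurableD2[OF lmeasurable_open[OF bdd opU]])
    qed
    have "measure lebesgue (\<Theta> j) = s j ^ 3 * V" for j
      using measure_lebesgue_affine[of "s j" 0 "\<Omega> (q j)"] s(1)[of j] \<Omega>(4) by (simp add: \<Theta>_def)
    moreover have "(\<lambda>j. s j ^ 3 * V) \<longlonglongrightarrow> 1 ^ 3 * V" by (intro tendsto_intros slim)
    ultimately show "(\<lambda>j. measure lebesgue (\<Theta> j)) \<longlonglongrightarrow> V" by simp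
  qed
  moreover have "axially_symmetric ?U"
  proof (rule axially_invariant_imp_symmetric)
    show "axially_invariant l ?U"
    proof (rule axially_invariant_increasing_union[OF _ _ mono op])
      show "axially_invariant (d (q j)) (\<Theta> j)" for j
        unfolding \<Theta>_def by (rule axially_invariant_scale[OF inv s(1)])
      show "(\<lambda>j. d (q j)) \<longlonglongrightarrow> l" using LIMSEQ_subseq_LIMSEQ[OF l p] by (simp add: o_def q_def)
    qed
  qed
  moreover have "?U \<noteq> {}"
  proof -
    have "0 \<in> \<Omega> (q 0)" using r(1) r(2)[of "q 0"] centre_in_ball by blast
    then have "s 0 *\<^sub>R 0 \<in> \<Theta> 0" unfolding \<Theta>_def by (rule imageI)
    then show ?thesis by blast
  qed
  ultimately show "\<exists>U. bounded_convex_domain U \<and> measure lebesgue U = V \<and> axially_symmetric U \<and> curl_eigenvalue U m"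
    using opU cvxU bdd convex_connected[OF cvxU] unfolding bounded_convex_domain_def by blast
qed

section \<open>Existence of a minimiser\<close>

lemma ball_axially_symmetric: "axially_symmetric (ball 0 r)"
proof (rule axially_invariant_imp_symmetric)
  show "axially_invariant (axis 1 1) (ball 0 r)" by (auto simp: axially_invariant_def)
qed

text \<open>Supplies an admissible domain when the set of all positive eigenvalues of admissible
  domains is empty.\<close>

lemma exists_ball_volume:
  assumes "V > 0"
  obtains r where "r > 0" "measure lebesgue (ball (0::vec3) r) = V"
proof -
  define c where "c = unit_ball_vol (real DIM(vec3))"
  have c: "c > 0" by (simp add: c_def)
  define r where "r = root 3 (V / c)"
  have r: "r > 0" "r ^ 3 = V / c" using assms c by (simp_all add: r_def)
  have "measure lebesgue (ball (0::vec3) r) = c * r ^ 3" using r(1) by (simp add: content_ball c_def)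
  then show thesis using that r c by simp
qed

theorem theorem3p6:
  fixes V :: real
  assumes "V > 0"
  shows "\<exists>\<Omega>. bounded_convex_domain \<Omega> \<and> measure lebesgue \<Omega> = V \<and> axially_symmetric \<Omega> \<and>
           (\<forall>\<Omega>'. bounded_convex_domain \<Omega>' \<and> measure lebesgue \<Omega>' = V \<and> axially_symmetric \<Omega>'
                 \<longrightarrow> mu1 \<Omega> \<le> mu1 \<Omega>')"
proof -
  define adm where "adm \<Omega> \<longleftrightarrow> bounded_convex_domain \<Omega> \<and> measure lebesgue \<Omega> = V \<and> axially_symmetric \<Omega>" for \<Omega>
  define spec where "spec \<Omega> = {\<mu>. \<mu> > 0 \<and> curl_eigenvalue \<Omega> \<mu>}" for \<Omega>
  have mu1: "mu1 \<Omega> = Inf (spec \<Omega>)" for \<Omega> by (simp add: mu1_def spec_def)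
  have bdd: "bdd_below (spec \<Omega>)" for \<Omega> by (rule bdd_belowI[of _ 0]) (auto simp: spec_def)
  \<comment> \<open>Minimising over all positive eigenvalues of all admissible domains at once
    reduces the claim to finding a domain that has \<open>Inf S\<close> itself as an
    eigenvalue.\<close>
  define S where "S = (\<Union>\<Omega>\<in>Collect adm. spec \<Omega>)"
  have Spos: "\<mu> > 0" if "\<mu> \<in> S" for \<mu> using that by (auto simp: S_def spec_def)
  have bddS: "bdd_below S" using Spos by (intro bdd_belowI[of _ 0]) (auto intro: less_imp_le)
  have "\<exists>\<Omega>. adm \<Omega> \<and> (\<forall>\<Omega>'. adm \<Omega>' \<longrightarrow> mu1 \<Omega> \<le> mu1 \<Omega>')"
  proof (cases "S = {}")
    case True
    obtain r where r: "r > 0" "measure lebesgue (ball (0::vec3) r) = V" using exists_ball_volume[OF assms] .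
    have "adm (ball 0 r)"
      unfolding adm_def bounded_convex_domain_def using r ball_axially_symmetric convex_connected[OF convex_ball] by auto
    \<comment> \<open>With \<open>S\<close> empty, all admissible domains share the same value
      \<open>Inf {}\<close>, so any of them is a minimiser.\<close>
    moreover have "mu1 \<Omega> = Inf {}" if "adm \<Omega>" for \<Omega> using True that by (simp add: S_def mu1)
    ultimately show ?thesis by (metis order_refl)
  next
    case False
    define m where "m = Inf S"
    have m_le: "m \<le> \<mu>" if "\<mu> \<in> S" for \<mu> unfolding m_def by (rule cInf_lower[OF that bddS])
    have "\<exists>\<mu>\<in>S. \<mu> < m + 1 / (real n + 1)" for n
      using cInf_lessD[OF False, of "m + 1 / (real n + 1)"] by (auto simp: m_def)
    then obtain \<mu> where \<mu>: "\<And>n. \<mu> n \<in> S" "\<And>n. \<mu> n < m + 1 / (real n + 1)" by metis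
    have "\<mu> \<longlonglongrightarrow> m"
    proof (rule tendsto_sandwich[OF _ _ tendsto_const])
      show "(\<lambda>n. m + 1 / (real n + 1)) \<longlonglongrightarrow> m" by real_asymp
      show "eventually (\<lambda>n. m \<le> \<mu> n) sequentially" using m_le \<mu>(1) by simp
      show "eventually (\<lambda>n. \<mu> n \<le> m + 1 / (real n + 1)) sequentially"
        using \<mu>(2) by (intro always_eventually allI less_imp_le)
    qed
    have pos: "\<mu> n > 0" for n using Spos \<mu>(1) by blast
    have "m \<ge> 0" unfolding m_def using False Spos by (intro cInf_greatest) (auto intro: less_imp_le)
    \<comment> \<open>A uniform bound for the eigenvalues, which fixes the radius of the inscribed
      balls.\<close>
    have bnd: "\<mu> n \<le> m + 1" for n
    proof -
      have "1 / (real n + 1) \<le> 1" by simp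
      then show ?thesis using \<mu>(2)[of n] by linarith
    qed
    have "\<exists>\<Omega> d W. open \<Omega> \<and> convex \<Omega> \<and> bounded \<Omega> \<and> measure lebesgue \<Omega> = V \<and> axially_invariant d \<Omega> \<and>
        ball 0 (1 / (96 * (m + 1))) \<subseteq> \<Omega> \<and> eigenfield \<Omega> (\<mu> n) W" for n
    proof -
      obtain \<Omega> where \<Omega>: "adm \<Omega>" "curl_eigenvalue \<Omega> (\<mu> n)" using \<mu>(1)[of n] by (auto simp: S_def spec_def)
      have "open \<Omega>" using \<Omega>(1) by (simp add: adm_def bounded_convex_domain_def)
      then obtain W where "eigenfield \<Omega> (\<mu> n) W" using \<Omega>(2) curl_eigenvalue_iff by blast
      from axially_symmetric_normalised[OF _ _ this pos bnd] \<Omega>(1)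
      show ?thesis unfolding adm_def by metis
    qed
    then obtain \<Omega> d W where seq: "\<And>n. open (\<Omega> n)" "\<And>n. convex (\<Omega> n)" "\<And>n. bounded (\<Omega> n)"
      "\<And>n. measure lebesgue (\<Omega> n) = V" "\<And>n. axially_invariant (d n) (\<Omega> n)"
      "\<And>n. ball 0 (1 / (96 * (m + 1))) \<subseteq> \<Omega> n" "\<And>n. eigenfield (\<Omega> n) (\<mu> n) (W n)" by metis
    have r: "1 / (96 * (m + 1)) > 0" using \<open>m \<ge> 0\<close> by simp
    note lim = limit_domain[OF seq(1-5) r seq(6,7) pos \<open>\<mu> \<longlonglongrightarrow> m\<close>]
    obtain U where U: "adm U" "curl_eigenvalue U m" using lim(2) unfolding adm_def by blast
    \<comment> \<open>\<open>m\<close> is an eigenvalue of \<open>U\<close> and a lower bound of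
      \<open>S\<close>, so \<open>U\<close> realises the infimum over all positive
      eigenvalues.\<close>
    have "m \<in> spec U" using U(2) lim(1) by (simp add: spec_def)
    then have U_le: "mu1 U \<le> m" unfolding mu1 using bdd by (rule cInf_lower)
    have ge: "m \<le> mu1 \<Omega>'" if "adm \<Omega>'" "spec \<Omega>' \<noteq> {}" for \<Omega>'
      unfolding mu1 using that m_le by (intro cInf_greatest) (auto simp: S_def)
    \<comment> \<open>a domain without positive eigenvalues would have \<open>mu1\<close> equal to the unspecified real \<open>Inf {}\<close>\<close>
    show ?thesis
    proof (cases "\<exists>\<Omega>''. adm \<Omega>'' \<and> spec \<Omega>'' = {} \<and> mu1 \<Omega>'' < m")
      case True
      then obtain \<Omega>'' where E: "adm \<Omega>''" "spec \<Omega>'' = {}" "mu1 \<Omega>'' < m" by blast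
      \<comment> \<open>\<open>Inf {}\<close> is the common value of the admissible domains without
        positive eigenvalues, and it lies below \<open>m\<close>, which bounds the value of all the
        others from below.\<close>
      have "mu1 \<Omega>'' \<le> mu1 \<Omega>'" if "adm \<Omega>'" for \<Omega>'
        using ge[OF that] E by (cases "spec \<Omega>' = {}") (auto simp: mu1)
      then show ?thesis using E(1) by blast
    next
      case False
      \<comment> \<open>Here \<open>m\<close> bounds \<open>mu1\<close> from below for both kinds of
        domains.\<close>
      have "mu1 U \<le> mu1 \<Omega>'" if "adm \<Omega>'" for \<Omega>'
        using ge[OF that] False that U_le by (cases "spec \<Omega>' = {}") force+
      then show ?thesis using U(1) by blast
    qed
  qed
  then show ?thesis by (simp add: adm_def)
qed

end
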